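(* Let $E$ be a graph and $R$ a commutative ring with unit. Let $\mathcal{A}$ be a ring and $\Phi:L_R(E)\to\mathcal{A}$ a ring homomorphism. Then the following conditions are equivalent: (i) $\Phi$ is injective; (ii) the restriction of $\Phi$ to the commutative core $M_R(E)$ is injective; (iii) both of these conditions are satisfied: (a) $\Phi(rv)\neq 0$ for all $v\in E^0$ and all $r\in R\setminus\{0\}$; (b) for every distinguished path $\alpha$, the $*$-$R$-algebra $\langle\Phi(\omega_\alpha)\rangle$ generated by $\Phi(\omega_\alpha)$ is $*$-isomorphic to $R[x,x^{-1}]$.
   Context: A graph $E=(E^0,E^1,r,s)$ consists of arbitrary sets $E^0$ (vertices), $E^1$ (edges) and maps $r,s:E^1\to E^0$. A vertex $v$ is regular if $s^{-1}(v)$ is finite and nonempty. A path is a vertex (length $0$, $s(v)=r(v)=v$) or a finite sequence $\mu=e_1\cdots e_n$ of edges with $r(e_i)=s(e_{i+1})$; $s(\mu)=s(e_1)$, $r(\mu)=r(e_n)$; $\mathrm{Path}(E)$ is the set of all paths. A path of positive length is closed if $r(e_n)=s(e_1)$, and a closed path is a cycle if $s(e_i)\ne s(e_j)$ for $i\ne j$. An exit for $\mu=e_1\cdots e_n$ is an edge $e$ with $s(e)=s(e_i)$, $e\neq e_i$ for some $i$. The Leavitt path algebra $L_R(E)$ is the universal $R$-algebra generated by pairwise orthogonal idempotents $\{v:v\in E^0\}$ and elements $\{e,e^*:e\in E^1\}$ subject to: $s(e)e=e=er(e)$; $r(e)e^*=e^*=e^*s(e)$; $e^*e=r(e)$ and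 $e^*f=0$ for $e\ne f$; $v=\sum_{s(e)=v}ee^*$ for every regular vertex $v$. For $\mu=e_1\cdots e_n$, $\mu^*=e_n^*\cdots e_1^*$ (and $v^*=v$). The $R$-linear involution on $L_R(E)$ is $(\sum r_i\alpha_i\beta_i^* )^*=\sum r_i\beta_i\alpha_i^*$. Put $G_E=\{\mu\nu^*:\mu,\nu\in\mathrm{Path}(E),\ r(\mu)=r(\nu)\}\subset L_R(E)$. An element $x$ is normal if $xx^*=x^*x$. $G_E^M$ is the set of normal elements of $G_E$, and the commutative core $M_R(E)$ is the $R$-subalgebra (not necessarily unital) of $L_R(E)$ generated by $G_E^M$. A distinguished path is a path $\alpha$ such that $r(\alpha)$ lies on a cycle without exits and, if $\alpha=e_1\cdots e_n$ has positive length, none of $s(e_1),\dots,s(e_n)$ lies on that cycle; $\lambda_\alpha$ denotes that cycle, based at $r(\alpha)$. Put $\omega_\alpha=\alpha\lambda_\alpha\alpha^*$, with $\omega_\alpha^*\omega_\alpha=\omega_\alpha\omega_\alpha^*=\alpha\alpha^*$, and let $\langle\omega_\alpha\rangle$ be the $*$-$R$-subalgebra of $L_R(E)$ generated by $\omega_\alpha$ (it is unital with unit $\alpha\alpha^*$). The $*$-$R$-algebra $\langle\Phi(\omega_\alpha)\rangle$ is the image $\Phi(\langle\omega_\alpha\rangle)\subseteq\mathcal{A}$, with $R$-action $r\,\Phi(y)=\Phi(ry)$ and involution $\Phi(y)^*=\Phi(y^* )$ for $y\in\langle\omega_\alpha\rangle$ (condition (b) includes that this involution is well defined). $R[x,x^{-1}]$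 is the Laurent polynomial ring with the $R$-linear involution $x^*=x^{-1}$; a $*$-isomorphism is an $R$-algebra isomorphism preserving the involutions. *)

theory Defs
  imports "HOL-Library.Poly_Mapping" "Graph_Theory.Graph_Theory"
begin

text \<open>
  A graph \<open>E = (E\<^sup>0, E\<^sup>1, r, s)\<close> is a \<^const>\<open>wf_digraph\<close>: \<open>verts E\<close> and \<open>arcs E\<close> are arbitrary
  sets, \<open>s = tail E\<close> and \<open>r = head E\<close>. A commutative ring with unit is a type of sort
  \<open>{comm_ring, comm_monoid_mult}\<close>; unlike \<^class>\<open>comm_ring_1\<close> this sort admits the zero ring.
\<close>

section \<open>Paths, cycles and distinguished paths\<close>

text \<open>
  A path is a pair of its source and its list of edges, so that \<open>(v, [])\<close> is the path \<open>v\<close> of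
  length \<open>0\<close>.
\<close>

definition paths :: "('v, 'e) pre_digraph \<Rightarrow> ('v \<times> 'e list) set" where
  "paths E = {(u, p). \<exists>v. pre_digraph.awalk E u p v}"

definition path_range :: "('v, 'e) pre_digraph \<Rightarrow> 'v \<times> 'e list \<Rightarrow> 'v" where
  "path_range E \<alpha> = (if snd \<alpha> = [] then fst \<alpha> else head E (last (snd \<alpha>)))"

text \<open>
  The library predicate \<^const>\<open>pre_digraph.cycle\<close> asks for a nonempty closed walk whose edges have
  pairwise distinct targets. On a closed walk this is the same as having pairwise distinct sources.
\<close>

lemma cas_head_last: "\<lbrakk>pre_digraph.cas E u c v; c \<noteq> []\<rbrakk> \<Longrightarrow> head E (last c) = v"
  by (induction c arbitrary: u) (auto simp: pre_digraph.cas.simps)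

lemma cycle_iff_distinct_sources:
  assumes "pre_digraph.awalk E v c v"
  shows "pre_digraph.cycle E c \<longleftrightarrow> c \<noteq> [] \<and> distinct (map (tail E) c)"
proof (cases "c = []")
  case True
  then show ?thesis by (simp add: pre_digraph.cycle_def)
next
  case False
  have cas: "pre_digraph.cas E v c v"
    using assms by (simp add: pre_digraph.awalk_def)
  have verts: "pre_digraph.awalk_verts E u c = map (tail E) c @ [head E (last c)]" for u
    using False by (simp add: pre_digraph.awalk_verts_conv)
  have verts': "pre_digraph.awalk_verts E v c = tail E (hd c) # map (head E) c"
    using False by (simp add: pre_digraph.awalk_verts_conv'[OF cas])
  have "head E (last c) = v"
    using cas False by (rule cas_head_last)
  moreover have "tail E (hd c) = v"
    using cas False by (simp add: pre_digraph.cas_simp)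
  moreover obtain e m where "c = e # m" using False by (cases c) auto
  ultimately have "distinct (tl (pre_digraph.awalk_verts E u c)) \<longleftrightarrow> distinct (map (tail E) c)" for u
    using verts by auto
  then show ?thesis using assms False by (auto simp: pre_digraph.cycle_def)
qed

definition exitless_cycle :: "('v, 'e) pre_digraph \<Rightarrow> 'e list \<Rightarrow> bool" where
  "exitless_cycle E c \<longleftrightarrow> pre_digraph.cycle E c \<and>
    \<not> (\<exists>e\<in>arcs E. \<exists>f\<in>set c. tail E e = tail E f \<and> e \<noteq> f)"

definition distinguished :: "('v, 'e) pre_digraph \<Rightarrow> 'v \<times> 'e list \<Rightarrow> bool" where
  "distinguished E \<alpha> \<longleftrightarrow> \<alpha> \<in> paths E \<and>
    (\<exists>c. exitless_cycle E c \<and> path_range E \<alpha> \<in> tail E ` set c \<and>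
      (\<forall>e\<in>set (snd \<alpha>). tail E e \<notin> tail E ` set c))"

definition lambda_cycle :: "('v, 'e) pre_digraph \<Rightarrow> 'v \<times> 'e list \<Rightarrow> 'e list" where
  "lambda_cycle E \<alpha> =
    (THE c. exitless_cycle E c \<and> pre_digraph.awalk E (path_range E \<alpha>) c (path_range E \<alpha>))"

lemma exitless_cycle_prefix:
  assumes "pre_digraph.cas E u c v" "pre_digraph.cas E u d w"
    and "\<And>e f. \<lbrakk>e \<in> set d; f \<in> set c; tail E e = tail E f\<rbrakk> \<Longrightarrow> e = f"
    and "length c \<le> length d"
  shows "\<exists>d'. d = c @ d'"
  using assms
proof (induction c arbitrary: u d)
  case (Cons f c)
  then obtain e d1 where d: "d = e # d1" by (cases d) auto
  with Cons.prems have "e = f" by (auto simp: pre_digraph.cas.simps)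
  moreover have "\<exists>d'. d1 = c @ d'"
    using Cons.prems d \<open>e = f\<close> by (intro Cons.IH[of "head E f"]) (auto simp: pre_digraph.cas.simps)
  ultimately show ?case using d by simp
qed simp

lemma ex1_lambda_cycle:
  assumes "distinguished E \<alpha>" and "wf_digraph E"
  shows "\<exists>!c. exitless_cycle E c \<and> pre_digraph.awalk E (path_range E \<alpha>) c (path_range E \<alpha>)"
proof -
  interpret wf_digraph E by fact
  let ?v = "path_range E \<alpha>"
  obtain c where c: "exitless_cycle E c" "?v \<in> tail E ` set c"
    using assms by (auto simp: distinguished_def)
  then obtain u where u: "awalk u c u" "c \<noteq> []"
    by (auto simp: exitless_cycle_def cycle_def)
  have "?v \<in> set (awalk_verts u c)"
    using c(2) u(2) by (simp add: awalk_verts_conv)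
  then obtain q r where qr: "c = q @ r" "awalk ?v (r @ q) ?v"
    using rotate_awalkE[OF u(1)] by metis
  have "cycle (r @ q)"
    using c(1) u qr by (auto simp: exitless_cycle_def cycle_iff_distinct_sources)
  then have ex: "exitless_cycle E (r @ q) \<and> awalk ?v (r @ q) ?v"
    using c(1) qr by (auto simp: exitless_cycle_def)
  have le: "d = d'" if d: "exitless_cycle E d" "awalk ?v d ?v"
    and d': "exitless_cycle E d'" "awalk ?v d' ?v" and len: "length d \<le> length d'" for d d'
  proof -
    have "\<exists>t. d' = d @ t"
      using d d' len by (intro exitless_cycle_prefix[of E ?v d ?v d' ?v])
        (auto simp: exitless_cycle_def awalk_def)
    then obtain t where t: "d' = d @ t" by blast
    have "t = []"
    proof (rule ccontr)
      assume "t \<noteq> []"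
      have "d \<noteq> []" using d(1) by (auto simp: exitless_cycle_def cycle_def)
      have "cas ?v t ?v" using d(2) d'(2) t by auto
      then have "tail E (hd t) = ?v" using \<open>t \<noteq> []\<close> by (simp add: cas_simp)
      moreover have "tail E (hd d) = ?v"
        using d(2) \<open>d \<noteq> []\<close> by (simp add: awalk_def cas_simp)
      moreover have "distinct (map (tail E) (d @ t))"
        using d' t by (simp add: exitless_cycle_def cycle_iff_distinct_sources)
      ultimately show False using \<open>d \<noteq> []\<close> \<open>t \<noteq> []\<close>
        by (cases d; cases t) auto
    qed
    with t show ?thesis by simp
  qed
  show ?thesis using ex le by (metis nle_le)
qed

section \<open>Leavitt path algebras\<close>

subsection \<open>The free algebra on the vertices, edges and ghost edges\<close>

datatype ('v, 'e) lpa_gen = Vertex 'v | Edge 'e | Ghost 'e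

datatype 'g free_mon = Word (letters: "'g list")

instantiation free_mon :: (type) monoid_add
begin

definition "0 = Word []"

definition "x + y = Word (letters x @ letters y)"

instance
  by standard (simp_all add: zero_free_mon_def plus_free_mon_def)

end

text \<open>
  \<open>'g free_mon \<Rightarrow>\<^sub>0 'r\<close> with its convolution product is the free unital \<open>'r\<close>-algebra on \<open>'g\<close>. The
  free (nonunital) algebra on the generators of \<open>E\<close> consists of the combinations of nonempty words
  in these generators.
\<close>

type_synonym ('v, 'e, 'r) falg = "('v, 'e) lpa_gen free_mon \<Rightarrow>\<^sub>0 'r"

definition lpa_gens :: "('v, 'e) pre_digraph \<Rightarrow> ('v, 'e) lpa_gen set" where
  "lpa_gens E = Vertex ` verts E \<union> Edge ` arcs E \<union> Ghost ` arcs E"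

definition free_alg :: "('v, 'e) pre_digraph \<Rightarrow> ('v, 'e, 'r::zero) falg set" where
  "free_alg E = {x. \<forall>w\<in>Poly_Mapping.keys x. letters w \<noteq> [] \<and> set (letters w) \<subseteq> lpa_gens E}"

definition monom_of :: "('v, 'e) lpa_gen list \<Rightarrow> ('v, 'e, 'r::{comm_ring, comm_monoid_mult}) falg"
  where "monom_of gs = Poly_Mapping.single (Word gs) 1"

subsection \<open>The defining relations\<close>

definition regular_vertex :: "('v, 'e) pre_digraph \<Rightarrow> 'v \<Rightarrow> bool" where
  "regular_vertex E v \<longleftrightarrow> v \<in> verts E \<and>
    finite {e \<in> arcs E. tail E e = v} \<and> {e \<in> arcs E. tail E e = v} \<noteq> {}"

inductive_set lpa_relators ::
  "('v, 'e) pre_digraph \<Rightarrow> ('v, 'e, 'r::{comm_ring, comm_monoid_mult}) falg set"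
  for E :: "('v, 'e) pre_digraph" where
  idem: "v \<in> verts E \<Longrightarrow> monom_of [Vertex v, Vertex v] - monom_of [Vertex v] \<in> lpa_relators E"
| orth: "\<lbrakk>v \<in> verts E; w \<in> verts E; v \<noteq> w\<rbrakk> \<Longrightarrow> monom_of [Vertex v, Vertex w] \<in> lpa_relators E"
| src_edge: "e \<in> arcs E \<Longrightarrow>
    monom_of [Vertex (tail E e), Edge e] - monom_of [Edge e] \<in> lpa_relators E"
| edge_rng: "e \<in> arcs E \<Longrightarrow>
    monom_of [Edge e, Vertex (head E e)] - monom_of [Edge e] \<in> lpa_relators E"
| rng_ghost: "e \<in> arcs E \<Longrightarrow>
    monom_of [Vertex (head E e), Ghost e] - monom_of [Ghost e] \<in> lpa_relators E"
| ghost_src: "e \<in> arcs E \<Longrightarrow>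
    monom_of [Ghost e, Vertex (tail E e)] - monom_of [Ghost e] \<in> lpa_relators E"
| ghost_edge_same: "e \<in> arcs E \<Longrightarrow>
    monom_of [Ghost e, Edge e] - monom_of [Vertex (head E e)] \<in> lpa_relators E"
| ghost_edge_diff: "\<lbrakk>e \<in> arcs E; f \<in> arcs E; e \<noteq> f\<rbrakk> \<Longrightarrow>
    monom_of [Ghost e, Edge f] \<in> lpa_relators E"
| regular: "regular_vertex E v \<Longrightarrow>
    monom_of [Vertex v] - (\<Sum>e\<in>{e \<in> arcs E. tail E e = v}. monom_of [Edge e, Ghost e])
      \<in> lpa_relators E"

inductive_set lpa_ideal ::
  "('v, 'e) pre_digraph \<Rightarrow> ('v, 'e, 'r::{comm_ring, comm_monoid_mult}) falg set"
  for E :: "('v, 'e) pre_digraph" where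
  relator: "x \<in> lpa_relators E \<Longrightarrow> x \<in> lpa_ideal E"
| zero: "0 \<in> lpa_ideal E"
| add: "\<lbrakk>x \<in> lpa_ideal E; y \<in> lpa_ideal E\<rbrakk> \<Longrightarrow> x + y \<in> lpa_ideal E"
| scale: "x \<in> lpa_ideal E \<Longrightarrow> Poly_Mapping.map ((*) r) x \<in> lpa_ideal E"
| mult_left: "\<lbrakk>a \<in> free_alg E; x \<in> lpa_ideal E\<rbrakk> \<Longrightarrow> a * x \<in> lpa_ideal E"
| mult_right: "\<lbrakk>x \<in> lpa_ideal E; a \<in> free_alg E\<rbrakk> \<Longrightarrow> x * a \<in> lpa_ideal E"

subsection \<open>The quotient algebra\<close>

definition lpa_rel :: "('v, 'e) pre_digraph \<Rightarrow>
    (('v, 'e, 'r::{comm_ring, comm_monoid_mult}) falg \<times> ('v, 'e, 'r) falg) set" where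
  "lpa_rel E = {(x, y). x \<in> free_alg E \<and> y \<in> free_alg E \<and> x - y \<in> lpa_ideal E}"

definition lpa_class :: "('v, 'e) pre_digraph \<Rightarrow>
    ('v, 'e, 'r::{comm_ring, comm_monoid_mult}) falg \<Rightarrow> ('v, 'e, 'r) falg set" where
  "lpa_class E x = lpa_rel E `` {x}"

definition lpa :: "('v, 'e) pre_digraph \<Rightarrow>
    ('v, 'e, 'r::{comm_ring, comm_monoid_mult}) falg set set" where
  "lpa E = free_alg E // lpa_rel E"

definition lpa_zero :: "('v, 'e) pre_digraph \<Rightarrow>
    ('v, 'e, 'r::{comm_ring, comm_monoid_mult}) falg set" where
  "lpa_zero E = lpa_class E 0"

definition lpa_add :: "('v, 'e) pre_digraph \<Rightarrow>
    ('v, 'e, 'r::{comm_ring, comm_monoid_mult}) falg set \<Rightarrow>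
    ('v, 'e, 'r) falg set \<Rightarrow> ('v, 'e, 'r) falg set" where
  "lpa_add E X Y = (\<Union>x\<in>X. \<Union>y\<in>Y. lpa_class E (x + y))"

definition lpa_mult :: "('v, 'e) pre_digraph \<Rightarrow>
    ('v, 'e, 'r::{comm_ring, comm_monoid_mult}) falg set \<Rightarrow>
    ('v, 'e, 'r) falg set \<Rightarrow> ('v, 'e, 'r) falg set" where
  "lpa_mult E X Y = (\<Union>x\<in>X. \<Union>y\<in>Y. lpa_class E (x * y))"

definition lpa_scale :: "('v, 'e) pre_digraph \<Rightarrow> 'r::{comm_ring, comm_monoid_mult} \<Rightarrow>
    ('v, 'e, 'r) falg set \<Rightarrow> ('v, 'e, 'r) falg set" where
  "lpa_scale E r X = (\<Union>x\<in>X. lpa_class E (Poly_Mapping.map ((*) r) x))"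

text \<open>
  The involution is induced by the one of the free algebra that fixes the vertices, exchanges \<open>e\<close>
  and \<open>e\<^sup>*\<close>, and reverses words.
\<close>

primrec gen_star :: "('v, 'e) lpa_gen \<Rightarrow> ('v, 'e) lpa_gen" where
  "gen_star (Vertex v) = Vertex v"
| "gen_star (Edge e) = Ghost e"
| "gen_star (Ghost e) = Edge e"

definition word_star :: "('v, 'e) lpa_gen free_mon \<Rightarrow> ('v, 'e) lpa_gen free_mon" where
  "word_star w = Word (rev (map gen_star (letters w)))"

definition falg_star :: "('v, 'e, 'r::zero) falg \<Rightarrow> ('v, 'e, 'r) falg" where
  "falg_star x = Poly_Mapping.map_key word_star x"

definition lpa_star :: "('v, 'e) pre_digraph \<Rightarrow>
    ('v, 'e, 'r::{comm_ring, comm_monoid_mult}) falg set \<Rightarrow> ('v, 'e, 'r) falg set" where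
  "lpa_star E X = (\<Union>x\<in>X. lpa_class E (falg_star x))"

subsection \<open>The operations are well defined\<close>

lemma lookup_map_mult [simp]:
  "Poly_Mapping.lookup (Poly_Mapping.map ((*) r) x) k = r * Poly_Mapping.lookup x k"
  for r :: "'r::mult_zero"
  by (simp add: Poly_Mapping.map.rep_eq when_def)

lemma map_mult_add:
  "Poly_Mapping.map ((*) r) (x + y) = Poly_Mapping.map ((*) r) x + Poly_Mapping.map ((*) r) y"
  for r :: "'r::comm_ring"
  by (rule poly_mapping_eqI) (simp add: lookup_add distrib_left)

lemma map_mult_diff:
  "Poly_Mapping.map ((*) r) (x - y) = Poly_Mapping.map ((*) r) x - Poly_Mapping.map ((*) r) y"
  for r :: "'r::comm_ring"
  by (rule poly_mapping_eqI) (simp add: lookup_minus right_diff_distrib)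

lemma map_mult_uminus_one: "Poly_Mapping.map ((*) (- 1)) x = - x"
  for x :: "'k \<Rightarrow>\<^sub>0 'r::{comm_ring, comm_monoid_mult}"
  by (rule poly_mapping_eqI) simp

lemma gen_star_gen_star [simp]: "gen_star (gen_star g) = g"
  by (cases g) simp_all

lemma word_star_word_star [simp]: "word_star (word_star w) = w"
  by (cases w) (simp add: word_star_def rev_map comp_def)

lemma inj_word_star: "inj word_star"
  by (metis injI word_star_word_star)

lemma word_star_plus: "word_star (v + w) = word_star w + word_star v"
  by (simp add: word_star_def plus_free_mon_def)

lemma lookup_falg_star [simp]:
  "Poly_Mapping.lookup (falg_star x) w = Poly_Mapping.lookup x (word_star w)"
  by (simp add: falg_star_def map_key.rep_eq[OF inj_word_star])

lemma falg_star_zero [simp]: "falg_star 0 = 0"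
  by (rule poly_mapping_eqI) simp

lemma falg_star_falg_star [simp]: "falg_star (falg_star x) = x"
  by (rule poly_mapping_eqI) simp

lemma falg_star_add: "falg_star (x + y) = falg_star x + falg_star y"
  for x :: "('v, 'e, 'r::monoid_add) falg"
  by (rule poly_mapping_eqI) (simp add: lookup_add)

lemma falg_star_diff: "falg_star (x - y) = falg_star x - falg_star y"
  for x :: "('v, 'e, 'r::ab_group_add) falg"
  by (rule poly_mapping_eqI) (simp add: lookup_minus)

lemma falg_star_sum: "falg_star (sum f A) = (\<Sum>a\<in>A. falg_star (f a))"
  for f :: "'i \<Rightarrow> ('v, 'e, 'r::comm_monoid_add) falg"
  by (induction A rule: infinite_finite_induct) (simp_all add: falg_star_add)

lemma falg_star_scale:
  "falg_star (Poly_Mapping.map ((*) r) x) = Poly_Mapping.map ((*) r) (falg_star x)"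
  for r :: "'r::mult_zero"
  by (rule poly_mapping_eqI) simp

lemma falg_star_single: "falg_star (Poly_Mapping.single w a) = Poly_Mapping.single (word_star w) a"
  by (rule poly_mapping_eqI) (auto simp: lookup_single when_def)

lemma falg_star_monom_of:
  "falg_star (monom_of gs) = monom_of (rev (map gen_star gs))"
  by (simp add: monom_of_def falg_star_single word_star_def)

lemma falg_sum_singles: "x = (\<Sum>w\<in>Poly_Mapping.keys x. Poly_Mapping.single w (Poly_Mapping.lookup x w))"
  for x :: "'k \<Rightarrow>\<^sub>0 'r::comm_monoid_add"
  by (rule poly_mapping_eqI)
    (auto simp: lookup_sum lookup_single when_def in_keys_iff sum.delta'[OF finite_keys])

lemma falg_star_mult: "falg_star (x * y) = falg_star y * falg_star x"
  for x :: "('v, 'e, 'r::comm_ring) falg"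
proof -
  let ?s = "\<lambda>x w. Poly_Mapping.single w (Poly_Mapping.lookup x w)"
  let ?t = "\<lambda>x w. Poly_Mapping.single (word_star w) (Poly_Mapping.lookup x w)"
  have star: "falg_star z = (\<Sum>w\<in>Poly_Mapping.keys z. ?t z w)" for z :: "('v, 'e, 'r) falg"
    by (subst falg_sum_singles[of z]) (simp add: falg_star_sum falg_star_single)
  have "x * y = (\<Sum>v\<in>Poly_Mapping.keys x. \<Sum>w\<in>Poly_Mapping.keys y. ?s x v * ?s y w)"
    by (subst falg_sum_singles[of x], subst falg_sum_singles[of y]) (simp add: sum_product)
  then have "falg_star (x * y)
      = (\<Sum>v\<in>Poly_Mapping.keys x. \<Sum>w\<in>Poly_Mapping.keys y. ?t y w * ?t x v)"
    by (simp add: falg_star_sum mult_single falg_star_single word_star_plus mult.commute)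
  also have "\<dots> = (\<Sum>w\<in>Poly_Mapping.keys y. \<Sum>v\<in>Poly_Mapping.keys x. ?t y w * ?t x v)"
    by (rule sum.swap)
  also have "\<dots> = falg_star y * falg_star x"
    by (simp add: star sum_product)
  finally show ?thesis .
qed

lemma free_alg_zero [simp]: "0 \<in> free_alg E"
  by (simp add: free_alg_def)

lemma free_alg_add: "\<lbrakk>x \<in> free_alg E; y \<in> free_alg E\<rbrakk> \<Longrightarrow> x + y \<in> free_alg E"
  using keys_add[of x y] by (auto simp: free_alg_def)

lemma free_alg_uminus: "x \<in> free_alg E \<Longrightarrow> - x \<in> free_alg E"
  for x :: "('v, 'e, 'r::ab_group_add) falg"
  by (simp add: free_alg_def in_keys_iff)

lemma free_alg_diff: "\<lbrakk>x \<in> free_alg E; y \<in> free_alg E\<rbrakk> \<Longrightarrow> x - y \<in> free_alg E"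
  for x :: "('v, 'e, 'r::ab_group_add) falg"
  using free_alg_add[of x E "- y"] by (simp add: free_alg_uminus)

lemma free_alg_sum: "(\<And>i. i \<in> I \<Longrightarrow> f i \<in> free_alg E) \<Longrightarrow> sum f I \<in> free_alg E"
  for f :: "'i \<Rightarrow> ('v, 'e, 'r::comm_monoid_add) falg"
  by (induction I rule: infinite_finite_induct) (simp_all add: free_alg_add)

lemma free_alg_mult: "\<lbrakk>x \<in> free_alg E; y \<in> free_alg E\<rbrakk> \<Longrightarrow> x * y \<in> free_alg E"
  for x :: "('v, 'e, 'r::comm_ring) falg"
  using keys_mult[of x y] by (fastforce simp: free_alg_def plus_free_mon_def)

lemma free_alg_scale: "x \<in> free_alg E \<Longrightarrow> Poly_Mapping.map ((*) r) x \<in> free_alg E"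
  for x :: "('v, 'e, 'r::comm_ring) falg"
  by (auto simp: free_alg_def in_keys_iff)

lemma free_alg_monom_of: "\<lbrakk>gs \<noteq> []; set gs \<subseteq> lpa_gens E\<rbrakk> \<Longrightarrow> monom_of gs \<in> free_alg E"
  by (auto simp: free_alg_def monom_of_def in_keys_iff lookup_single when_def split: if_splits)

lemma gen_star_lpa_gens: "g \<in> lpa_gens E \<Longrightarrow> gen_star g \<in> lpa_gens E"
  by (auto simp: lpa_gens_def)

lemma free_alg_star: "x \<in> free_alg E \<Longrightarrow> falg_star x \<in> free_alg E"
proof -
  assume x: "x \<in> free_alg E"
  have "letters w \<noteq> [] \<and> set (letters w) \<subseteq> lpa_gens E"
    if "w \<in> Poly_Mapping.keys (falg_star x)" for w
  proof -
    have "letters (word_star w) \<noteq> [] \<and> set (letters (word_star w)) \<subseteq> lpa_gens E"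
      using x that by (simp add: free_alg_def in_keys_iff)
    then show ?thesis
      using gen_star_lpa_gens[of "gen_star g" E for g] by (fastforce simp: word_star_def)
  qed
  then show ?thesis by (simp add: free_alg_def)
qed

context wf_digraph
begin

lemma lpa_relators_free_alg: "x \<in> lpa_relators G \<Longrightarrow> x \<in> free_alg G"
  by (induction rule: lpa_relators.induct)
    (auto intro!: free_alg_diff free_alg_sum free_alg_monom_of
      simp: lpa_gens_def regular_vertex_def)

lemma lpa_ideal_free_alg: "x \<in> lpa_ideal G \<Longrightarrow> x \<in> free_alg G"
  by (induction rule: lpa_ideal.induct)
    (auto intro: lpa_relators_free_alg free_alg_add free_alg_scale free_alg_mult)

lemma lpa_relators_star: "x \<in> lpa_relators G \<Longrightarrow> falg_star x \<in> lpa_relators G"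
  by (induction rule: lpa_relators.induct)
    (auto intro: lpa_relators.intros simp: falg_star_diff falg_star_monom_of falg_star_sum)

end

lemma lpa_ideal_uminus: "x \<in> lpa_ideal E \<Longrightarrow> - x \<in> lpa_ideal E"
  using lpa_ideal.scale[of x E "- 1"] by (simp add: map_mult_uminus_one)

lemma lpa_ideal_diff: "\<lbrakk>x \<in> lpa_ideal E; y \<in> lpa_ideal E\<rbrakk> \<Longrightarrow> x - y \<in> lpa_ideal E"
  using lpa_ideal.add[OF _ lpa_ideal_uminus, of x E y] by simp

lemma lpa_ideal_star:
  assumes "wf_digraph E" and "x \<in> lpa_ideal E"
  shows "falg_star x \<in> lpa_ideal E"
  using assms(2)
  by (induction rule: lpa_ideal.induct)
    (auto intro: lpa_ideal.intros wf_digraph.lpa_relators_star[OF assms(1)] free_alg_star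
      simp: falg_star_add falg_star_scale falg_star_mult)

lemma equiv_lpa_rel: "equiv (free_alg E) (lpa_rel E)"
proof (rule equivI)
  show "lpa_rel E \<subseteq> free_alg E \<times> free_alg E"
    by (auto simp: lpa_rel_def)
  show "refl_on (free_alg E) (lpa_rel E)"
    by (auto simp: lpa_rel_def refl_on_def lpa_ideal.zero)
  show "sym (lpa_rel E)"
    using lpa_ideal_uminus by (fastforce simp: lpa_rel_def intro: symI)
  show "trans (lpa_rel E)"
    using lpa_ideal.add by (fastforce simp: lpa_rel_def intro: transI)
qed

lemma lpa_class_eq_iff:
  "\<lbrakk>x \<in> free_alg E; y \<in> free_alg E\<rbrakk> \<Longrightarrow> lpa_class E x = lpa_class E y \<longleftrightarrow> x - y \<in> lpa_ideal E"
  by (simp add: lpa_class_def eq_equiv_class_iff[OF equiv_lpa_rel]) (simp add: lpa_rel_def)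

lemma lpa_add_class:
  fixes x y :: "('v, 'e, 'r::{comm_ring, comm_monoid_mult}) falg"
  assumes "x \<in> free_alg E" "y \<in> free_alg E"
  shows "lpa_add E (lpa_class E x) (lpa_class E y) = lpa_class E (x + y)"
proof -
  have "lpa_class E (x + y) = lpa_class E (x' + y')"
    if "(x, x') \<in> lpa_rel E" "(y, y') \<in> lpa_rel E"
    for x x' y y' :: "('v, 'e, 'r) falg"
    using that by (simp add: lpa_rel_def lpa_class_eq_iff free_alg_add add_diff_add lpa_ideal.add)
  then have "(\<lambda>x y :: ('v, 'e, 'r) falg. lpa_class E (x + y)) respects2 lpa_rel E"
    by (intro congruent2I')
  from UN_equiv_class2[OF equiv_lpa_rel equiv_lpa_rel this assms] show ?thesis
    by (simp add: lpa_add_def lpa_class_def)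
qed

lemma lpa_mult_class:
  fixes x y :: "('v, 'e, 'r::{comm_ring, comm_monoid_mult}) falg"
  assumes "x \<in> free_alg E" "y \<in> free_alg E"
  shows "lpa_mult E (lpa_class E x) (lpa_class E y) = lpa_class E (x * y)"
proof -
  have "lpa_class E (x * y) = lpa_class E (x' * y')"
    if "(x, x') \<in> lpa_rel E" "(y, y') \<in> lpa_rel E"
    for x x' y y' :: "('v, 'e, 'r) falg"
  proof -
    have "x * y - x' * y' = x * (y - y') + (x - x') * y'"
      by (simp add: algebra_simps)
    moreover have "x * (y - y') + (x - x') * y' \<in> lpa_ideal E"
      using that by (intro lpa_ideal.intros(3,5,6)) (auto simp: lpa_rel_def)
    ultimately show ?thesis
      using that by (simp add: lpa_rel_def lpa_class_eq_iff free_alg_mult)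
  qed
  then have "(\<lambda>x y :: ('v, 'e, 'r) falg. lpa_class E (x * y)) respects2 lpa_rel E"
    by (intro congruent2I')
  from UN_equiv_class2[OF equiv_lpa_rel equiv_lpa_rel this assms] show ?thesis
    by (simp add: lpa_mult_def lpa_class_def)
qed

lemma lpa_scale_class:
  assumes "x \<in> free_alg E"
  shows "lpa_scale E r (lpa_class E x) = lpa_class E (Poly_Mapping.map ((*) r) x)"
proof -
  have "(\<lambda>x. lpa_class E (Poly_Mapping.map ((*) r) x)) respects lpa_rel E"
    using lpa_ideal.scale[of _ E r]
    by (intro congruentI)
      (auto simp: lpa_rel_def lpa_class_eq_iff free_alg_scale simp flip: map_mult_diff)
  from UN_equiv_class[OF equiv_lpa_rel this assms] show ?thesis
    by (simp add: lpa_scale_def lpa_class_def)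
qed

lemma lpa_star_class:
  assumes "wf_digraph E" "x \<in> free_alg E"
  shows "lpa_star E (lpa_class E x) = lpa_class E (falg_star x)"
proof -
  have "(\<lambda>x. lpa_class E (falg_star x)) respects lpa_rel E"
    using lpa_ideal_star[OF assms(1)]
    by (intro congruentI)
      (auto simp: lpa_rel_def lpa_class_eq_iff free_alg_star simp flip: falg_star_diff)
  from UN_equiv_class[OF equiv_lpa_rel this assms(2)] show ?thesis
    by (simp add: lpa_star_def lpa_class_def)
qed

subsection \<open>The commutative core\<close>

definition lpa_path :: "('v, 'e) pre_digraph \<Rightarrow> 'v \<times> 'e list \<Rightarrow>
    ('v, 'e, 'r::{comm_ring, comm_monoid_mult}) falg set" where
  "lpa_path E \<mu> = lpa_class E
    (monom_of (if snd \<mu> = [] then [Vertex (fst \<mu>)] else map Edge (snd \<mu>)))"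

definition lpa_ghost_path :: "('v, 'e) pre_digraph \<Rightarrow> 'v \<times> 'e list \<Rightarrow>
    ('v, 'e, 'r::{comm_ring, comm_monoid_mult}) falg set" where
  "lpa_ghost_path E \<mu> = lpa_class E
    (monom_of (if snd \<mu> = [] then [Vertex (fst \<mu>)] else map Ghost (rev (snd \<mu>))))"

lemma lpa_star_path_ghost_path:
  fixes E :: "('v, 'e) pre_digraph"
  assumes "wf_digraph E" and "\<mu> \<in> paths E" and "\<nu> \<in> paths E"
  shows "lpa_star E (lpa_mult E (lpa_path E \<mu>) (lpa_ghost_path E \<nu>))
    = (lpa_mult E (lpa_path E \<nu>) (lpa_ghost_path E \<mu>)
        :: ('v, 'e, 'r::{comm_ring, comm_monoid_mult}) falg set)"
proof -
  define p where "p \<mu> = (if snd \<mu> = [] then [Vertex (fst \<mu>)] else map Edge (snd \<mu>))"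
    for \<mu> :: "'v \<times> 'e list"
  define q where "q \<mu> = (if snd \<mu> = [] then [Vertex (fst \<mu>)] else map Ghost (rev (snd \<mu>)))"
    for \<mu> :: "'v \<times> 'e list"
  have "(monom_of (p \<mu>) :: ('v, 'e, 'r) falg) \<in> free_alg E"
    "(monom_of (q \<mu>) :: ('v, 'e, 'r) falg) \<in> free_alg E" if "\<mu> \<in> paths E" for \<mu>
    using that by (auto simp: p_def q_def paths_def pre_digraph.awalk_def lpa_gens_def
        intro!: free_alg_monom_of) blast+
  moreover have "rev (map gen_star (p \<mu>)) = q \<mu>" "rev (map gen_star (q \<mu>)) = p \<mu>" for \<mu>
    by (simp_all add: p_def q_def rev_map comp_def)
  ultimately show ?thesis
    unfolding lpa_path_def lpa_ghost_path_def p_def[symmetric] q_def[symmetric]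
    using assms by (simp add: lpa_mult_class lpa_star_class free_alg_mult falg_star_mult
        falg_star_monom_of)
qed

definition lpa_G :: "('v, 'e) pre_digraph \<Rightarrow>
    ('v, 'e, 'r::{comm_ring, comm_monoid_mult}) falg set set" where
  "lpa_G E = {lpa_mult E (lpa_path E \<mu>) (lpa_ghost_path E \<nu>) | \<mu> \<nu>.
    \<mu> \<in> paths E \<and> \<nu> \<in> paths E \<and> path_range E \<mu> = path_range E \<nu>}"

definition lpa_normal :: "('v, 'e) pre_digraph \<Rightarrow>
    ('v, 'e, 'r::{comm_ring, comm_monoid_mult}) falg set \<Rightarrow> bool" where
  "lpa_normal E X \<longleftrightarrow> lpa_mult E X (lpa_star E X) = lpa_mult E (lpa_star E X) X"

inductive_set lpa_subalg :: "('v, 'e) pre_digraph \<Rightarrow>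
    ('v, 'e, 'r::{comm_ring, comm_monoid_mult}) falg set set \<Rightarrow> ('v, 'e, 'r) falg set set"
  for E :: "('v, 'e) pre_digraph" and S :: "('v, 'e, 'r) falg set set" where
  base: "X \<in> S \<Longrightarrow> X \<in> lpa_subalg E S"
| zero: "lpa_zero E \<in> lpa_subalg E S"
| add: "\<lbrakk>X \<in> lpa_subalg E S; Y \<in> lpa_subalg E S\<rbrakk> \<Longrightarrow> lpa_add E X Y \<in> lpa_subalg E S"
| mult: "\<lbrakk>X \<in> lpa_subalg E S; Y \<in> lpa_subalg E S\<rbrakk> \<Longrightarrow> lpa_mult E X Y \<in> lpa_subalg E S"
| scale: "X \<in> lpa_subalg E S \<Longrightarrow> lpa_scale E r X \<in> lpa_subalg E S"

definition comm_core :: "('v, 'e) pre_digraph \<Rightarrow>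
    ('v, 'e, 'r::{comm_ring, comm_monoid_mult}) falg set set" where
  "comm_core E = lpa_subalg E {X \<in> lpa_G E. lpa_normal E X}"

subsection \<open>The star-subalgebras attached to distinguished paths\<close>

definition omega :: "('v, 'e) pre_digraph \<Rightarrow> 'v \<times> 'e list \<Rightarrow>
    ('v, 'e, 'r::{comm_ring, comm_monoid_mult}) falg set" where
  "omega E \<alpha> = lpa_mult E
    (lpa_mult E (lpa_path E \<alpha>) (lpa_path E (path_range E \<alpha>, lambda_cycle E \<alpha>)))
    (lpa_ghost_path E \<alpha>)"

inductive_set lpa_star_subalg :: "('v, 'e) pre_digraph \<Rightarrow>
    ('v, 'e, 'r::{comm_ring, comm_monoid_mult}) falg set set \<Rightarrow> ('v, 'e, 'r) falg set set"
  for E :: "('v, 'e) pre_digraph" and S :: "('v, 'e, 'r) falg set set" where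
  base: "X \<in> S \<Longrightarrow> X \<in> lpa_star_subalg E S"
| zero: "lpa_zero E \<in> lpa_star_subalg E S"
| add: "\<lbrakk>X \<in> lpa_star_subalg E S; Y \<in> lpa_star_subalg E S\<rbrakk> \<Longrightarrow>
    lpa_add E X Y \<in> lpa_star_subalg E S"
| mult: "\<lbrakk>X \<in> lpa_star_subalg E S; Y \<in> lpa_star_subalg E S\<rbrakk> \<Longrightarrow>
    lpa_mult E X Y \<in> lpa_star_subalg E S"
| scale: "X \<in> lpa_star_subalg E S \<Longrightarrow> lpa_scale E r X \<in> lpa_star_subalg E S"
| star: "X \<in> lpa_star_subalg E S \<Longrightarrow> lpa_star E X \<in> lpa_star_subalg E S"

subsection \<open>Ring homomorphisms and star-isomorphisms with Laurent polynomials\<close>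

definition lpa_ring_hom :: "('v, 'e) pre_digraph \<Rightarrow>
    (('v, 'e, 'r::{comm_ring, comm_monoid_mult}) falg set \<Rightarrow> 'a::ring) \<Rightarrow> bool" where
  "lpa_ring_hom E \<Phi> \<longleftrightarrow> (\<forall>X\<in>lpa E. \<forall>Y\<in>lpa E.
    \<Phi> (lpa_add E X Y) = \<Phi> X + \<Phi> Y \<and> \<Phi> (lpa_mult E X Y) = \<Phi> X * \<Phi> Y)"

text \<open>
  The Laurent polynomial ring \<open>R[x, x\<^sup>-\<^sup>1]\<close> is the convolution algebra \<open>int \<Rightarrow>\<^sub>0 'r\<close>, where \<open>x\<close> is
  \<open>Poly_Mapping.single 1 1\<close>; its involution sends \<open>x\<^sup>n\<close> to \<open>x\<^sup>-\<^sup>n\<close>.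
\<close>

definition laurent_star :: "(int \<Rightarrow>\<^sub>0 'r::zero) \<Rightarrow> (int \<Rightarrow>\<^sub>0 'r)" where
  "laurent_star f = Poly_Mapping.map_key uminus f"

text \<open>
  For a star-subalgebra \<open>S\<close> of the Leavitt path algebra, the image \<open>\<Phi> ` S\<close> has the scalar action
  \<open>r \<cdot> \<Phi> y = \<Phi> (r y)\<close> and the involution \<open>(\<Phi> y)\<^sup>* = \<Phi> (y\<^sup>*)\<close>. The first two conjuncts say that these
  operations are well defined, the remaining ones that \<open>\<theta>\<close> is an isomorphism.
\<close>

definition image_star_iso_laurent :: "('v, 'e) pre_digraph \<Rightarrow>
    (('v, 'e, 'r::{comm_ring, comm_monoid_mult}) falg set \<Rightarrow> 'a::ring) \<Rightarrow>
    ('v, 'e, 'r) falg set set \<Rightarrow> bool" where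
  "image_star_iso_laurent E \<Phi> S \<longleftrightarrow>
    (\<forall>X\<in>S. \<forall>Y\<in>S. \<Phi> X = \<Phi> Y \<longrightarrow> (\<forall>r. \<Phi> (lpa_scale E r X) = \<Phi> (lpa_scale E r Y))) \<and>
    (\<forall>X\<in>S. \<forall>Y\<in>S. \<Phi> X = \<Phi> Y \<longrightarrow> \<Phi> (lpa_star E X) = \<Phi> (lpa_star E Y)) \<and>
    (\<exists>\<theta> :: 'a \<Rightarrow> (int \<Rightarrow>\<^sub>0 'r). bij_betw \<theta> (\<Phi> ` S) UNIV \<and>
      (\<forall>a\<in>\<Phi> ` S. \<forall>b\<in>\<Phi> ` S. \<theta> (a + b) = \<theta> a + \<theta> b \<and> \<theta> (a * b) = \<theta> a * \<theta> b) \<and>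
      (\<forall>X\<in>S. \<forall>r. \<theta> (\<Phi> (lpa_scale E r X)) = Poly_Mapping.map ((*) r) (\<theta> (\<Phi> X))) \<and>
      (\<forall>X\<in>S. \<theta> (\<Phi> (lpa_star E X)) = laurent_star (\<theta> (\<Phi> X))))"

end

theory Submission
  imports Defs
begin

text \<open>
  Let \<open>x\<close> be a nonzero element of the Leavitt path algebra. Multiplication by a suitable path on the
  right turns \<open>x\<close> into a combination of real paths, and then the ghost of a path of minimal length on
  the left turns it into a combination \<open>z\<close> of closed walks at a vertex \<open>w\<close> in which \<open>w\<close> has a
  nonzero coefficient \<open>r\<close>. If one of these closed walks has an exit, let \<open>\<tau>\<close> run around it sufficiently
  often and leave through the exit: then \<open>\<tau>\<^sup>* z \<tau> = r v\<close>, where \<open>v\<close> is the range of \<open>\<tau>\<close>.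
  Otherwise all of them are powers of one cycle without exits, and \<open>z\<close> is a nonzero polynomial in this
  cycle. So the kernel of \<open>\<Phi>\<close>, if nonzero, contains an element of one of these two kinds. Condition (a)
  excludes the first kind. For the second kind, (b) yields a surjective star-endomorphism
  \<open>R[x, x\<^sup>-\<^sup>1] \<rightarrow> \<langle>\<omega>\<^sub>\<alpha>\<rangle> \<rightarrow> \<langle>\<Phi>(\<omega>\<^sub>\<alpha>)\<rangle> \<cong> R[x, x\<^sup>-\<^sup>1]\<close>, and such endomorphisms are injective over every
  commutative ring. Real paths are linearly independent because they act independently on functions
  on the boundary of the graph.
\<close>

section \<open>Linear extension\<close>

text \<open>The isomorphism in (b) need not send \<open>\<Phi> (omega E \<alpha>)\<close> to the
  variable \<open>x\<close>. Besides surjectivity, little is known about the resulting endomorphism: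
  the image \<open>u\<close> of \<open>x\<close> times its adjoint is 1. Over a reduced connected
  ring \<open>u\<close> would be a unit times a power of \<open>x\<close>; in general nilpotent and
  idempotent coefficients interfere. Instead of passing to quotients or localizations, a supposed
  kernel element is multiplied by scalars that annihilate the unwanted products of coefficients of
  \<open>u\<close> but not the element itself.

  A second obstacle is that a vertex may emit infinitely many edges. Then it is not the sum of its
  \<open>e e\<^sup>*\<close>, and \<open>x v = 0\<close> cannot be read off from
  \<open>x e = 0\<close> for all edges \<open>e\<close> at \<open>v\<close>; the finite differences
  \<open>v - \<Sum>\<^sub>F e e\<^sup>*\<close> replace the missing relation.

  Since \<open>\<Phi>\<close> is only a ring homomorphism, all reductions are two-sided
  multiplications by elements of the algebra. From (ii) to (iii), the point is that the core
  contains every vertex, every \<open>omega E \<alpha>\<close> and its adjoint, hence all of the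
  algebra that (b) speaks of.\<close>

definition lin :: "('k \<Rightarrow> 'r::comm_ring \<Rightarrow> 'b::ab_group_add) \<Rightarrow> ('k \<Rightarrow>\<^sub>0 'r) \<Rightarrow> 'b" where
  "lin f x = (\<Sum>k\<in>Poly_Mapping.keys x. f k (Poly_Mapping.lookup x k))"

lemma lin_superset:
  assumes "\<And>k. f k 0 = 0" "finite A" "Poly_Mapping.keys x \<subseteq> A"
  shows "lin f x = (\<Sum>k\<in>A. f k (Poly_Mapping.lookup x k))"
  unfolding lin_def using assms by (intro sum.mono_neutral_left) (auto simp: in_keys_iff)

lemma lin_0 [simp]: "lin f 0 = 0"
  by (simp add: lin_def)

text \<open>Additivity in the coefficient already gives \<open>f k 0 = 0\<close>, so both sums may
  be taken over the union of the two supports. The coefficient is an argument of \<open>f\<close> in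
  order that the target needs no scalar action.\<close>

lemma lin_add:
  assumes "\<And>k r s. f k (r + s) = f k r + f k s"
  shows "lin f (x + y) = lin f x + lin f y"
proof -
  have z: "f k 0 = 0" for k using assms[of k 0 0] by simp
  let ?A = "Poly_Mapping.keys x \<union> Poly_Mapping.keys y"
  have "lin f z = (\<Sum>k\<in>?A. f k (Poly_Mapping.lookup z k))" if "Poly_Mapping.keys z \<subseteq> ?A" for z
    using z that by (intro lin_superset) auto
  then show ?thesis using keys_add[of x y]
    by (simp add: lookup_add assms sum.distrib)
qed

lemma lin_single:
  assumes "f k 0 = 0"
  shows "lin f (Poly_Mapping.single k r) = f k r"
  using assms by (cases "r = 0") (simp_all add: lin_def)

lemma lin_uminus:
  assumes "\<And>k r s. f k (r + s) = f k r + f k s"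
  shows "lin f (- x) = - lin f x"
  using lin_add[of f x "- x"] assms by (simp add: eq_neg_iff_add_eq_0 add.commute)

lemma lin_diff:
  assumes "\<And>k r s. f k (r + s) = f k r + f k s"
  shows "lin f (x - y) = lin f x - lin f y"
  using lin_add[of f x "- y"] lin_uminus[of f y] assms by simp

lemma lin_sum:
  assumes "\<And>k r s. f k (r + s) = f k r + f k s"
  shows "lin f (sum g A) = (\<Sum>a\<in>A. lin f (g a))"
  by (induction A rule: infinite_finite_induct) (simp_all add: lin_add assms)

text \<open>New keys stay inside the support of \<open>x0\<close>, so a condition on that support,
  such as membership in \<open>free_alg E\<close>, is available for every single term.\<close>

lemma poly_mapping_single_induct [case_names zero add]:
  fixes x0 :: "'k \<Rightarrow>\<^sub>0 'r::comm_monoid_add"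
  assumes "P 0" "\<And>k r x. k \<in> Poly_Mapping.keys x0 \<Longrightarrow> P x \<Longrightarrow> P (Poly_Mapping.single k r + x)"
  shows "P x0"
proof -
  have "P (\<Sum>w\<in>A. Poly_Mapping.single w (Poly_Mapping.lookup x0 w))"
    if "finite A" "A \<subseteq> Poly_Mapping.keys x0" for A
    using that by induction (auto intro: assms)
  from this[OF finite_keys order.refl] show ?thesis
    by (simp flip: falg_sum_singles)
qed

section \<open>Surjective star-endomorphisms of the Laurent polynomial ring\<close>

lemma lookup_single_times:
  fixes g :: "int \<Rightarrow>\<^sub>0 'r::comm_ring"
  shows "Poly_Mapping.lookup (Poly_Mapping.single i a * g) k = a * Poly_Mapping.lookup g (k - i)"
proof (induction g rule: poly_mapping_single_induct)
  case (add j r x)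
  then show ?case
    by (auto simp: distrib_left lookup_add mult_single lookup_single when_def)
qed simp

lemma lookup_times_int:
  fixes f g :: "int \<Rightarrow>\<^sub>0 'r::comm_ring"
  shows "Poly_Mapping.lookup (f * g) k =
    (\<Sum>i\<in>Poly_Mapping.keys f. Poly_Mapping.lookup f i * Poly_Mapping.lookup g (k - i))"
proof -
  have "f * g = (\<Sum>i\<in>Poly_Mapping.keys f. Poly_Mapping.single i (Poly_Mapping.lookup f i) * g)"
    by (subst falg_sum_singles[of f]) (simp add: sum_distrib_right)
  then show ?thesis by (simp add: lookup_sum lookup_single_times)
qed

lemma lookup_laurent_star [simp]:
  "Poly_Mapping.lookup (laurent_star f) k = Poly_Mapping.lookup f (- k)"
  by (simp add: laurent_star_def map_key.rep_eq)

lemma laurent_star_single: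
  "laurent_star (Poly_Mapping.single n r) = Poly_Mapping.single (- n) r"
  by (rule poly_mapping_eqI) (auto simp: lookup_single when_def)

lemma laurent_star_add:
  "laurent_star (f + g) = laurent_star f + laurent_star (g :: int \<Rightarrow>\<^sub>0 'r::comm_monoid_add)"
  by (rule poly_mapping_eqI) (auto simp: lookup_add)

lemma scale_single:
  fixes r :: "'r::comm_ring"
  shows "Poly_Mapping.map ((*) r) (Poly_Mapping.single k a) = Poly_Mapping.single k (r * a)"
  by (rule poly_mapping_eqI) (auto simp: lookup_single when_def)

lemma scale_scale:
  fixes r :: "'r::comm_ring"
  shows "Poly_Mapping.map ((*) r) (Poly_Mapping.map ((*) s) x) = Poly_Mapping.map ((*) (r * s)) x"
  by (rule poly_mapping_eqI) (simp add: mult.assoc)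

lemma scale_id [simp]: "Poly_Mapping.map (\<lambda>a. a) p = p"
  by (rule poly_mapping_eqI) (simp add: Poly_Mapping.map.rep_eq when_def)

text \<open>If \<open>f * s\<close> does not annihilate \<open>p\<close>, it replaces
  \<open>s\<close>, and \<open>f\<close> kills the new multiple because \<open>f * f\<close> kills
  \<open>p\<close>; otherwise \<open>s\<close> is kept. In this way nilpotent scalars can be treated
  as zero without leaving the ring.\<close>

lemma exists_multiple_killed:
  fixes p :: "int \<Rightarrow>\<^sub>0 'r::{comm_ring,comm_monoid_mult}"
  assumes "finite F" "p \<noteq> 0" "\<And>f. f \<in> F \<Longrightarrow> Poly_Mapping.map ((*) (f * f)) p = 0"
  shows "\<exists>s. Poly_Mapping.map ((*) s) p \<noteq> 0 \<and> (\<forall>f\<in>F. Poly_Mapping.map ((*) (f * s)) p = 0)"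
  using assms
proof (induction F)
  case empty
  then show ?case by (intro exI[of _ 1]) simp
next
  case (insert f F)
  then obtain s where s: "Poly_Mapping.map ((*) s) p \<noteq> 0"
    "\<forall>f\<in>F. Poly_Mapping.map ((*) (f * s)) p = 0" by auto
  have ff: "f * f * Poly_Mapping.lookup p k = 0" for k
    using insert.prems(2)[of f] by (simp add: poly_mapping_eq_iff fun_eq_iff)
  show ?case
  proof (cases "Poly_Mapping.map ((*) (f * s)) p = 0")
    case True
    with s show ?thesis by (intro exI[of _ s]) auto
  next
    case False
    have "f * (f * s) * Poly_Mapping.lookup p k = 0" for k
      using ff[of k] by (metis mult.assoc mult.commute mult_zero_right)
    moreover have "g * (f * s) * Poly_Mapping.lookup p k = 0" if "g \<in> F" for g k
    proof -
      have "g * s * Poly_Mapping.lookup p k = 0"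
        using s(2) that by (simp add: poly_mapping_eq_iff fun_eq_iff)
      then show ?thesis by (metis mult.assoc mult.commute mult_zero_right)
    qed
    ultimately show ?thesis using False
      by (intro exI[of _ "f * s"]) (auto simp: poly_mapping_eq_iff fun_eq_iff)
  qed
qed

text \<open>
  If \<open>u = \<Sum> u\<^sub>i x\<^sup>i\<close> satisfies \<open>u u\<^sup>* = 1\<close>, the products \<open>u\<^sub>i u\<^sub>j\<close> with \<open>i \<noteq> j\<close> are nilpotent. This is
  shown by descending induction on \<open>j - i\<close>: multiplying \<open>\<Sum>\<^sub>i u\<^sub>i u\<^sub>i\<^sub>+\<^sub>d = 0\<close> by \<open>u\<^sub>a u\<^sub>a\<^sub>+\<^sub>d\<close>
  leaves \<open>(u\<^sub>a u\<^sub>a\<^sub>+\<^sub>d)\<^sup>2\<close> and products with a larger difference of indices.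
\<close>

lemma exists_multiple_killed_by_products:
  fixes p f :: "int \<Rightarrow>\<^sub>0 'r::{comm_ring,comm_monoid_mult}"
  defines "u \<equiv> Poly_Mapping.lookup f"
  assumes uu: "\<And>k. k \<noteq> 0 \<Longrightarrow> (\<Sum>i\<in>Poly_Mapping.keys f. u i * u (i + k)) = 0"
    and p: "p \<noteq> 0"
  shows "\<exists>s. Poly_Mapping.map ((*) s) p \<noteq> 0 \<and>
    (\<forall>i j k. i \<noteq> j \<longrightarrow> u i * u j * (s * Poly_Mapping.lookup p k) = 0)"
proof -
  obtain D where D: "\<And>i. i \<in> Poly_Mapping.keys f \<Longrightarrow> \<bar>i\<bar> \<le> D"
  proof
    fix i assume "i \<in> Poly_Mapping.keys f"
    then show "\<bar>i\<bar> \<le> (\<Sum>i\<in>Poly_Mapping.keys f. \<bar>i\<bar>)"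
      by (intro member_le_sum) auto
  qed
  have u0: "u i = 0" if "\<bar>i\<bar> > D" for i
    using D[of i] that by (force simp: u_def in_keys_iff)
  \<comment> \<open>After \<open>t\<close> rounds, the products with index difference above
    \<open>2 * D - t\<close> kill the chosen multiple. At the start nothing is to be done, since
    \<open>D\<close> bounds the support; \<open>t = 2 * D\<close> reaches the difference 1.\<close>
  have "\<exists>s. Poly_Mapping.map ((*) s) p \<noteq> 0 \<and>
    (\<forall>i j k. 1 \<le> j - i \<and> 2 * D - int t < j - i \<longrightarrow> u i * u j * (s * Poly_Mapping.lookup p k) = 0)" for t
  proof (induction t)
    case 0
    have "u i * u j = 0" if "2 * D < j - i" for i j
      using u0[of i] u0[of j] that by (cases "\<bar>i\<bar> > D") auto
    then show ?case using p by (intro exI[of _ 1]) simp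
  next
    case (Suc t)
    then obtain s where s: "Poly_Mapping.map ((*) s) p \<noteq> 0"
      "\<And>i j k. 1 \<le> j - i \<Longrightarrow> 2 * D - int t < j - i \<Longrightarrow> u i * u j * (s * Poly_Mapping.lookup p k) = 0"
      by blast
    define d where "d = 2 * D - int t"
    show ?case
    proof (cases "d \<ge> 1")
      case False
      then show ?thesis using s by (intro exI[of _ s]) (auto simp: d_def)
    next
      case True
      let ?q = "Poly_Mapping.map ((*) s) p"
      let ?F = "(\<lambda>a. u a * u (a + d)) ` Poly_Mapping.keys f"
      have "Poly_Mapping.map ((*) (g * g)) ?q = 0" if gF: "g \<in> ?F" for g
      proof (rule poly_mapping_eqI)
        fix k
        obtain a where a: "a \<in> Poly_Mapping.keys f" "g = u a * u (a + d)" using gF by auto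
        let ?c = "s * Poly_Mapping.lookup p k"
        \<comment> \<open>The four factors are regrouped so that a product with index difference
          larger than \<open>d\<close> appears: \<open>u i * u (a + d)\<close> for
          \<open>i < a\<close>, and \<open>u a * u (i + d)\<close> for \<open>i > a\<close>.\<close>
        have 0: "g * (u i * u (i + d)) * ?c = 0" if "i \<noteq> a" for i
        proof (cases "i < a")
          case True
          then have *: "u i * u (a + d) * ?c = 0" using \<open>d \<ge> 1\<close> by (intro s(2)) (auto simp: d_def)
          have "g * (u i * u (i + d)) * ?c = u a * u (i + d) * (u i * u (a + d) * ?c)"
            by (simp add: a ac_simps)
          then show ?thesis by (simp add: *)
        next
          case False
          then have *: "u a * u (i + d) * ?c = 0"
            using \<open>d \<ge> 1\<close> that by (intro s(2)) (auto simp: d_def)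
          have "g * (u i * u (i + d)) * ?c = u i * u (a + d) * (u a * u (i + d) * ?c)"
            by (simp add: a ac_simps)
          then show ?thesis by (simp add: *)
        qed
        have "0 = g * (\<Sum>i\<in>Poly_Mapping.keys f. u i * u (i + d)) * ?c"
          using uu[of d] True by simp
        also have "\<dots> = (\<Sum>i\<in>Poly_Mapping.keys f. g * (u i * u (i + d)) * ?c)"
          by (simp add: sum_distrib_left sum_distrib_right)
        also have "\<dots> = g * (u a * u (a + d)) * ?c"
          using a(1) 0 by (subst sum.remove[of _ a]) auto
        finally show "Poly_Mapping.lookup (Poly_Mapping.map ((*) (g * g)) ?q) k
            = Poly_Mapping.lookup 0 k"
          by (simp add: a)
      qed
      with s(1) have "\<exists>s'. Poly_Mapping.map ((*) s') ?q \<noteq> 0 \<and>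
          (\<forall>g\<in>?F. Poly_Mapping.map ((*) (g * s')) ?q = 0)"
        by (intro exists_multiple_killed) simp_all
      then obtain s' where s': "Poly_Mapping.map ((*) s') ?q \<noteq> 0"
        "\<And>g. g \<in> ?F \<Longrightarrow> Poly_Mapping.map ((*) (g * s')) ?q = 0"
        by (elim exE conjE) (rule that, assumption, erule bspec)
      have "u i * u j * (s' * s * Poly_Mapping.lookup p k) = 0"
        if ij: "1 \<le> j - i" "2 * D - int (Suc t) < j - i" for i j k
      proof (cases "j - i = d")
        case True
        show ?thesis
        proof (cases "i \<in> Poly_Mapping.keys f")
          case True
          then have "u i * u (i + d) \<in> ?F" by blast
          from s'(2)[OF this] have "u i * u (i + d) * s' * (s * Poly_Mapping.lookup p k) = 0"
            by (simp add: poly_mapping_eq_iff fun_eq_iff)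
          moreover have "j = i + d" using \<open>j - i = d\<close> by simp
          ultimately show ?thesis by (simp add: mult.assoc)
        qed (simp add: u_def in_keys_iff)
      next
        case False
        then have "u i * u j * (s * Poly_Mapping.lookup p k) = 0"
          using ij by (intro s(2)) (auto simp: d_def)
        then have "s' * (u i * u j * (s * Poly_Mapping.lookup p k)) = 0" by simp
        then show ?thesis by (simp add: ac_simps)
      qed
      moreover have "Poly_Mapping.map ((*) (s' * s)) p \<noteq> 0"
        using s'(1) by (simp only: scale_scale not_False_eq_True)
      ultimately show ?thesis by blast
    qed
  qed
  from this[of "nat (2 * D)"] obtain s where s: "Poly_Mapping.map ((*) s) p \<noteq> 0"
    "\<And>i j k. 1 \<le> j - i \<Longrightarrow> u i * u j * (s * Poly_Mapping.lookup p k) = 0"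
    by (auto split: if_splits)
  have "u i * u j * (s * Poly_Mapping.lookup p k) = 0" if "i \<noteq> j" for i j k
    using s(2)[of j i k] s(2)[of i j k] that by (cases "i < j") (auto simp: ac_simps)
  with s(1) show ?thesis by blast
qed

text \<open>Let \<open>u\<close> be the image of \<open>x\<close> and \<open>P\<close> a nonzero
  multiple of \<open>p\<close> whose coefficients are killed by all \<open>u i * u j\<close> with
  \<open>i \<noteq> j\<close>. Against \<open>P\<close>, the power \<open>u ^ m\<close> is the sum
  of the \<open>u i ^ m x ^ (i m)\<close>, so the monomial \<open>x\<close> can only be reached
  through \<open>u 1\<close> and \<open>u (- 1)\<close>. Then \<open>u 1 ^ 2\<close> and
  \<open>u (- 1) ^ 2\<close> act as complementary orthogonal idempotents, and on the two parts
  \<open>\<psi>\<close> sends \<open>x\<close> to a unit multiple of \<open>x\<close> or of its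
  inverse.\<close>

theorem laurent_star_endo_inj:
  fixes \<psi> :: "(int \<Rightarrow>\<^sub>0 'r::{comm_ring,comm_monoid_mult}) \<Rightarrow> (int \<Rightarrow>\<^sub>0 'r)"
  assumes add: "\<And>f g. \<psi> (f + g) = \<psi> f + \<psi> g"
    and mult: "\<And>f g. \<psi> (f * g) = \<psi> f * \<psi> g"
    and scale: "\<And>r f. \<psi> (Poly_Mapping.map ((*) r) f) = Poly_Mapping.map ((*) r) (\<psi> f)"
    and star: "\<And>f. \<psi> (laurent_star f) = laurent_star (\<psi> f)"
    and surj: "surj \<psi>"
    and zero: "\<psi> p = 0"
  shows "p = 0"
proof (rule ccontr)
  assume "p \<noteq> 0"
  define U where "U n = \<psi> (Poly_Mapping.single n 1)" for n
  define u where "u = Poly_Mapping.lookup (U 1)"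
  let ?K = "Poly_Mapping.keys (U 1)"
  have uK: "u i = 0" if "i \<notin> ?K" for i using that by (simp add: u_def in_keys_iff)
  have U_mult: "U (m + n) = U m * U n" for m n
    by (simp add: U_def mult_single flip: mult)
  have U_minus: "Poly_Mapping.lookup (U (- n)) k = Poly_Mapping.lookup (U n) (- k)" for n k
    using star[of "Poly_Mapping.single n 1"] by (simp add: U_def laurent_star_single)
  have one: "Poly_Mapping.single 0 1 * f = f" for f :: "int \<Rightarrow>\<^sub>0 'r"
    by (rule poly_mapping_eqI) (simp add: lookup_single_times)
  \<comment> \<open>\<open>\<psi>\<close> is not assumed to be unital, but \<open>U 0\<close> is
    neutral for all values of \<open>\<psi>\<close>, hence equal to 1 by surjectivity.\<close>
  have U_0: "U 0 = Poly_Mapping.single 0 1"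
  proof -
    obtain q where q: "\<psi> q = Poly_Mapping.single 0 1" using surj by (metis surjD)
    have "\<psi> q = U 0 * \<psi> q" using mult[of "Poly_Mapping.single 0 1" q] by (simp add: U_def one)
    also have "\<dots> = U 0" using one[of "U 0"] by (simp add: q mult.commute)
    finally show ?thesis by (simp add: q)
  qed
  have \<psi>_expand: "\<psi> f = lin (\<lambda>n r. Poly_Mapping.map ((*) r) (U n)) f" for f
  proof (induction f rule: poly_mapping_single_induct)
    case zero
    show ?case using add[of 0 0] by simp
  next
    case (add n r f)
    have "\<psi> (Poly_Mapping.single n r) = Poly_Mapping.map ((*) r) (U n)"
      using scale[of r "Poly_Mapping.single n 1"] by (simp add: scale_single U_def)
    moreover have "lin (\<lambda>n r. Poly_Mapping.map ((*) r) (U n)) (Poly_Mapping.single n r)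
        = Poly_Mapping.map ((*) r) (U n)"
      by (rule lin_single) (simp add: poly_mapping_eq_iff fun_eq_iff)
    ultimately show ?case
      by (subst lin_add) (auto simp: assms(1) add poly_mapping_eq_iff fun_eq_iff lookup_add
          distrib_right)
  qed
  have lookup_\<psi>: "Poly_Mapping.lookup (\<psi> f) k =
      (\<Sum>n\<in>Poly_Mapping.keys f. Poly_Mapping.lookup f n * Poly_Mapping.lookup (U n) k)" for f k
    by (simp add: \<psi>_expand lin_def lookup_sum)
  have uu: "(\<Sum>i\<in>?K. u i * u (i + k)) = (if k = 0 then 1 else 0)" for k
  proof -
    have "(\<Sum>i\<in>?K. u i * u (i + k)) = Poly_Mapping.lookup (U 1 * U (- 1)) (- k)"
      by (simp add: lookup_times_int U_minus u_def algebra_simps)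
    also have "\<dots> = (if k = 0 then 1 else 0)"
      by (simp add: U_0 lookup_single when_def flip: U_mult)
    finally show ?thesis .
  qed
  obtain s where s: "Poly_Mapping.map ((*) s) p \<noteq> 0"
    "\<And>i j k. i \<noteq> j \<Longrightarrow> u i * u j * (s * Poly_Mapping.lookup p k) = 0"
    using exists_multiple_killed_by_products[of "U 1" p] uu \<open>p \<noteq> 0\<close>
    unfolding u_def by auto
  define P where "P = Poly_Mapping.map ((*) s) p"
  define c where "c = Poly_Mapping.lookup P"
  have cu: "c n * u i * u j = 0" if "i \<noteq> j" for n i j
    using s(2)[OF that, of n] by (simp add: c_def P_def ac_simps)
  \<comment> \<open>Only pure powers survive when the \<open>m\<close>-th power of
    \<open>U 1\<close> is expanded, because \<open>cu\<close> removes the mixed products; the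
    exponents are then multiples of \<open>m\<close>.\<close>
  have U_powers: "c n * Poly_Mapping.lookup (U (int m)) k =
      (if int m dvd k then c n * u (k div int m) ^ m else 0)" if "m > 0" for n m k
    using that
  proof (induction m arbitrary: k rule: nat_induct_non_zero)
    case 1
    show ?case by (simp add: u_def)
  next
    case (Suc m)
    define d where "d = int m"
    have "d > 0" using Suc.hyps by (simp add: d_def)
    have "c n * Poly_Mapping.lookup (U (int (Suc m))) k
        = (\<Sum>i\<in>?K. u i * (c n * Poly_Mapping.lookup (U d) (k - i)))"
      using U_mult[of 1 d]
      by (simp add: lookup_times_int d_def u_def sum_distrib_left ac_simps)
    also have "\<dots> = (\<Sum>i\<in>?K. if k = (1 + d) * i then c n * u i ^ Suc m else 0)"
    proof (rule sum.cong[OF refl])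
      fix i
      show "u i * (c n * Poly_Mapping.lookup (U d) (k - i))
        = (if k = (1 + d) * i then c n * u i ^ Suc m else 0)"
      proof (cases "d dvd k - i")
        case False
        then have "k \<noteq> (1 + d) * i" by (auto simp: algebra_simps)
        then show ?thesis using False Suc.IH[of "k - i"] by (simp add: d_def)
      next
        case True
        then obtain j where j: "k - i = d * j" by auto
        then have "u i * (c n * Poly_Mapping.lookup (U d) (k - i)) = c n * u i * u j ^ m"
          using Suc.IH[of "k - i"] \<open>d > 0\<close> by (simp add: d_def ac_simps)
        also have "\<dots> = (if i = j then c n * u i ^ Suc m else 0)"
          using cu[of i j n] Suc.hyps by (cases m) (auto simp: mult.assoc[symmetric])
        also have "i = j \<longleftrightarrow> k = (1 + d) * i"
          using j \<open>d > 0\<close> by (auto simp: algebra_simps)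
        finally show ?thesis .
      qed
    qed
    also have "\<dots> = (if 1 + d dvd k then c n * u (k div (1 + d)) ^ Suc m else 0)"
    proof (cases "1 + d dvd k")
      case True
      then obtain i where i: "k = (1 + d) * i" by auto
      have "(\<Sum>j\<in>?K. if k = (1 + d) * j then c n * u j ^ Suc m else 0)
          = (\<Sum>j\<in>?K. if i = j then c n * u i ^ Suc m else 0)"
        using \<open>d > 0\<close> by (intro sum.cong) (auto simp: i)
      also have "\<dots> = c n * u i ^ Suc m" using uK[of i] by auto
      finally show ?thesis using True i \<open>d > 0\<close> by simp
    qed (auto intro!: sum.neutral)
    finally show ?case by (simp add: d_def add.commute)
  qed
  \<comment> \<open>In \<open>\<psi> q = x\<close>, compare the coefficients of \<open>x\<close>: by
    \<open>U_powers\<close> only the exponents 1 and -1 of \<open>q\<close> contribute. So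
    \<open>c n\<close> is a combination of \<open>c n * u 1\<close> and
    \<open>c n * u (- 1)\<close>, every other \<open>c n * u j\<close> vanishes, and
    \<open>uu\<close> at 0 shrinks to two squares.\<close>
  have c_split: "c n = c n * u 1 * u 1 + c n * u (- 1) * u (- 1)" for n
  proof -
    obtain q where q: "\<psi> q = Poly_Mapping.single 1 1" using surj by (metis surjD)
    define e where "e = Poly_Mapping.lookup q"
    have trm: "c n * Poly_Mapping.lookup (U k) 1 * b = (if k = 1 then c n * u 1 * b
        else if k = - 1 then c n * u (- 1) * b else 0)" for k b
    proof -
      consider "k = 0" | "k > 0" | "k < 0" by linarith
      then show ?thesis
      proof cases
        case 1
        then show ?thesis by (simp add: U_0 lookup_single)
      next
        case 2
        then show ?thesis using U_powers[of "nat k" n 1] by auto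
      next
        case 3
        then show ?thesis using U_powers[of "nat (- k)" n "- 1"] U_minus[of "- k" 1] by auto
      qed
    qed
    have "c n = c n * Poly_Mapping.lookup (\<psi> q) 1" by (simp add: q)
    also have "\<dots> = (\<Sum>k\<in>Poly_Mapping.keys q. c n * Poly_Mapping.lookup (U k) 1 * e k)"
      by (simp add: lookup_\<psi> sum_distrib_left e_def ac_simps)
    also have "\<dots> = (\<Sum>k\<in>Poly_Mapping.keys q. (if k = 1 then c n * u 1 * e k else 0)
        + (if k = - 1 then c n * u (- 1) * e k else 0))"
      by (intro sum.cong refl) (simp add: trm)
    also have "\<dots> = c n * u 1 * e 1 + c n * u (- 1) * e (- 1)"
      by (auto simp: sum.distrib e_def in_keys_iff)
    finally have c: "c n = c n * u 1 * e 1 + c n * u (- 1) * e (- 1)" .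
    have other: "c n * u j = 0" if "j \<noteq> 1" "j \<noteq> - 1" for j
    proof -
      have "c n * u j = (c n * u 1 * e 1 + c n * u (- 1) * e (- 1)) * u j" using c by simp
      also have "\<dots> = c n * u 1 * u j * e 1 + c n * u (- 1) * u j * e (- 1)"
        by (simp add: algebra_simps)
      finally show ?thesis using cu that by simp
    qed
    have "c n = (\<Sum>i\<in>?K. c n * u i * u i)"
      using uu[of 0] by (simp add: sum_distrib_left[symmetric] mult.assoc)
    also have "\<dots> = (\<Sum>i\<in>?K. (if i = 1 then c n * u i * u i else 0)
        + (if i = - 1 then c n * u i * u i else 0))"
      by (intro sum.cong refl) (auto simp: other)
    also have "\<dots> = c n * u 1 * u 1 + c n * u (- 1) * u (- 1)"
      using uK by (auto simp: sum.distrib)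
    finally show ?thesis .
  qed
  have c_split_pow: "c n = c n * u 1 ^ m * u 1 ^ m + c n * u (- 1) ^ m * u (- 1) ^ m"
    if "m > 0" for n m
    using that
  proof (induction m rule: nat_induct_non_zero)
    case 1
    show ?case using c_split by simp
  next
    case (Suc m)
    have "c n * u 1 ^ m * u 1 ^ m = (c n * u 1 * u 1 + c n * u (- 1) * u (- 1)) * u 1 ^ m * u 1 ^ m"
      using c_split by simp
    also have "\<dots> = c n * u 1 ^ Suc m * u 1 ^ Suc m + (c n * u (- 1) * u 1 ^ m) * u (- 1) * u 1 ^ m"
      by (simp add: algebra_simps)
    also have "c n * u (- 1) * u 1 ^ m = 0"
      using cu[of "- 1" 1 n] Suc.hyps by (cases m) (auto simp: mult.assoc[symmetric])
    finally have 1: "c n * u 1 ^ m * u 1 ^ m = c n * u 1 ^ Suc m * u 1 ^ Suc m" by simp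
    have "c n * u (- 1) ^ m * u (- 1) ^ m
        = (c n * u 1 * u 1 + c n * u (- 1) * u (- 1)) * u (- 1) ^ m * u (- 1) ^ m"
      using c_split by simp
    also have "\<dots> = c n * u (- 1) ^ Suc m * u (- 1) ^ Suc m + (c n * u 1 * u (- 1) ^ m) * u 1 * u (- 1) ^ m"
      by (simp add: algebra_simps)
    also have "c n * u 1 * u (- 1) ^ m = 0"
      using cu[of 1 "- 1" n] Suc.hyps by (cases m) (auto simp: mult.assoc[symmetric])
    finally have "c n * u (- 1) ^ m * u (- 1) ^ m = c n * u (- 1) ^ Suc m * u (- 1) ^ Suc m" by simp
    with 1 Suc.IH show ?case by simp
  qed
  have trm: "c n * Poly_Mapping.lookup (U n) k =
      (if k = n then c n * u 1 ^ nat \<bar>n\<bar> else 0) + (if k = - n then c n * u (- 1) ^ nat \<bar>n\<bar> else 0)"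
    if "n \<noteq> 0" for n k
  proof -
    let ?m = "nat \<bar>n\<bar>"
    have other: "c n * u j ^ ?m = 0" if "j \<noteq> 1" "j \<noteq> - 1" for j
    proof -
      have "c n * u j = (c n * u 1 * u 1 + c n * u (- 1) * u (- 1)) * u j" using c_split by simp
      also have "\<dots> = c n * u 1 * u j * u 1 + c n * u (- 1) * u j * u (- 1)"
        by (simp add: algebra_simps)
      finally have "c n * u j = 0" using cu that by simp
      then show ?thesis using \<open>n \<noteq> 0\<close> by (cases ?m) (auto simp: mult.assoc[symmetric])
    qed
    have pos: "c n * Poly_Mapping.lookup (U (int ?m)) k =
      (if k = int ?m then c n * u 1 ^ ?m else 0) + (if k = - int ?m then c n * u (- 1) ^ ?m else 0)" for k
    proof (cases "int ?m dvd k")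
      case True
      then obtain j where j: "k = int ?m * j" by blast
      have "c n * Poly_Mapping.lookup (U (int ?m)) k = c n * u j ^ ?m"
        using U_powers[of ?m n k] that j by simp
      moreover have "k = int ?m * 1 \<longleftrightarrow> j = 1" "k = int ?m * - 1 \<longleftrightarrow> j = - 1"
        using that unfolding j mult_cancel_left by auto
      ultimately show ?thesis using other[of j] by auto
    next
      case False
      then have "k \<noteq> int ?m" "k \<noteq> - int ?m" by auto
      then show ?thesis using U_powers[of ?m n k] that False by simp
    qed
    show ?thesis
    proof (cases "n > 0")
      case True
      then show ?thesis using pos[of k] by simp
    next
      case False
      then show ?thesis using pos[of "- k"] U_minus[of "- n" k] that by (auto simp: add.commute)
    qed
  qed
  have "\<psi> P = 0" by (simp add: P_def scale zero poly_mapping_eq_iff fun_eq_iff)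
  have coeff: "(\<Sum>n\<in>Poly_Mapping.keys P. c n * Poly_Mapping.lookup (U n) k) = 0" for k
    using lookup_\<psi>[of P k] \<open>\<psi> P = 0\<close> by (simp add: c_def)
  have trm0: "c 0 * Poly_Mapping.lookup (U 0) k = (if k = 0 then c 0 else 0)" for k
    by (simp add: U_0 lookup_single when_def)
  have coeff0: "c 0 = 0"
  proof -
    have "(\<Sum>n\<in>Poly_Mapping.keys P. c n * Poly_Mapping.lookup (U n) 0)
        = (\<Sum>n\<in>Poly_Mapping.keys P. if n = 0 then c n else 0)"
      by (intro sum.cong refl) (auto simp: trm trm0)
    also have "\<dots> = c 0" by (auto simp: c_def in_keys_iff)
    finally show ?thesis using coeff[of 0] by simp
  qed
  have coeff_eq: "c k * u 1 ^ nat \<bar>k\<bar> + c (- k) * u (- 1) ^ nat \<bar>k\<bar> = 0" if "k \<noteq> 0" for k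
  proof -
    have "(\<Sum>n\<in>Poly_Mapping.keys P. c n * Poly_Mapping.lookup (U n) k)
        = (\<Sum>n\<in>Poly_Mapping.keys P. (if n = k then c n * u 1 ^ nat \<bar>k\<bar> else 0)
          + (if n = - k then c n * u (- 1) ^ nat \<bar>k\<bar> else 0))"
    proof (intro sum.cong refl)
      fix n
      show "c n * Poly_Mapping.lookup (U n) k = (if n = k then c n * u 1 ^ nat \<bar>k\<bar> else 0)
          + (if n = - k then c n * u (- 1) ^ nat \<bar>k\<bar> else 0)"
        using that trm[of n k] trm0[of k] by (cases "n = 0") auto
    qed
    also have "\<dots> = c k * u 1 ^ nat \<bar>k\<bar> + c (- k) * u (- 1) ^ nat \<bar>k\<bar>"
      by (auto simp: sum.distrib c_def in_keys_iff)
    finally show ?thesis using coeff[of k] by simp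
  qed
  have "c k = 0" for k
  proof (cases "k = 0")
    case False
    let ?m = "nat \<bar>k\<bar>"
    have kill: "c n * u 1 ^ ?m * u (- 1) ^ ?m = 0" for n
    proof -
      have "c n * u 1 ^ ?m * u (- 1) ^ ?m = c n * (u 1 * u (- 1)) ^ ?m"
        by (simp add: power_mult_distrib mult.assoc)
      then show ?thesis using cu[of 1 "- 1" n] False
        by (cases ?m) (auto simp: mult.assoc[symmetric])
    qed
    \<comment> \<open>Multiplying the equation at \<open>k\<close> by \<open>u 1 ^ ?m\<close>
      isolates one half of \<open>c k\<close>, multiplying the one at \<open>- k\<close> by
      \<open>u (- 1) ^ ?m\<close> the other half; \<open>c_split_pow\<close> adds them up.\<close>
    have "0 = (c k * u 1 ^ ?m + c (- k) * u (- 1) ^ ?m) * u 1 ^ ?m"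
      using coeff_eq[OF False] by simp
    also have "\<dots> = c k * u 1 ^ ?m * u 1 ^ ?m + c (- k) * u 1 ^ ?m * u (- 1) ^ ?m"
      by (simp add: algebra_simps)
    finally have 1: "c k * u 1 ^ ?m * u 1 ^ ?m = 0" using kill by simp
    have "0 = (c (- k) * u 1 ^ ?m + c k * u (- 1) ^ ?m) * u (- 1) ^ ?m"
      using coeff_eq[of "- k"] False by simp
    also have "\<dots> = c k * u (- 1) ^ ?m * u (- 1) ^ ?m + c (- k) * u 1 ^ ?m * u (- 1) ^ ?m"
      by (simp add: algebra_simps)
    finally have "c k * u (- 1) ^ ?m * u (- 1) ^ ?m = 0" using kill by simp
    with 1 show ?thesis using c_split_pow[of ?m k] False by simp
  qed (simp add: coeff0)
  then have "P = 0" by (simp add: c_def poly_mapping_eq_iff fun_eq_iff)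
  with s(1) show False by (simp add: P_def)
qed

section \<open>Linear independence of real paths\<close>

text \<open>The boundary path space: infinite paths, and finite paths that end at a sink or an
  infinite emitter, padded with \<open>None\<close>. Stopping only there is what makes the relation
  at regular vertices hold in the action below.\<close>

coinductive boundary :: "('v, 'e) pre_digraph \<Rightarrow> 'v \<Rightarrow> (nat \<Rightarrow> 'e option) \<Rightarrow> bool"
  for E where
  stop: "\<lbrakk>v \<in> verts E; \<not> regular_vertex E v\<rbrakk> \<Longrightarrow> boundary E v (\<lambda>_. None)"
| step: "\<lbrakk>e \<in> arcs E; boundary E (head E e) z\<rbrakk> \<Longrightarrow> boundary E (tail E e) (case_nat (Some e) z)"

lemma case_nat_Suc: "case_nat (z 0) (\<lambda>n. z (Suc n)) = z"
  by (auto simp: fun_eq_iff split: nat.split)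

lemma boundary_first:
  assumes "boundary E v z" "z 0 = Some e"
  shows "e \<in> arcs E" "tail E e = v" "boundary E (head E e) (\<lambda>n. z (Suc n))"
    "case_nat (Some e) (\<lambda>n. z (Suc n)) = z"
  using assms case_nat_Suc[of z] by (auto elim: boundary.cases)

lemma boundary_regular:
  assumes "boundary E v z" "regular_vertex E v"
  shows "\<exists>e. z 0 = Some e"
  using assms by (auto elim: boundary.cases)

definition out_edge :: "('v, 'e) pre_digraph \<Rightarrow> 'v \<Rightarrow> 'e" where
  "out_edge E v = (SOME e. e \<in> arcs E \<and> tail E e = v)"

primrec follow :: "('v, 'e) pre_digraph \<Rightarrow> nat \<Rightarrow> 'v \<Rightarrow> 'e option" where
  "follow E 0 v = (if regular_vertex E v then Some (out_edge E v) else None)"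
| "follow E (Suc n) v = (if regular_vertex E v then follow E n (head E (out_edge E v)) else None)"

text \<open>Leaving every regular vertex through a chosen edge gives a walk that runs forever or
  stops at the first vertex that is not regular. This supplies a test point beyond the end of every
  real path.\<close>

lemma (in wf_digraph) boundary_exists:
  assumes "v \<in> verts G"
  shows "\<exists>z. boundary G v z"
proof -
  have "boundary G v (\<lambda>n. follow G n v)"
    using assms
  proof (coinduction arbitrary: v)
    case boundary
    show ?case
    proof (cases "regular_vertex G v")
      case False
      have "follow G n v = None" for n using False by (cases n) auto
      then show ?thesis using False boundary by auto
    next
      case True
      define e where "e = out_edge G v"
      have "\<exists>e. e \<in> arcs G \<and> tail G e = v" using True by (auto simp: regular_vertex_def)
      then have e: "e \<in> arcs G \<and> tail G e = v" unfolding e_def out_edge_def by (rule someI_ex)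
      have "follow G n v = case_nat (Some e) (\<lambda>n. follow G n (head G e)) n" for n
        using True by (cases n) (auto simp: e_def)
      then show ?thesis using e by (intro disjI2 exI[of _ e] exI[of _ "\<lambda>n. follow G n (head G e)"]) auto
    qed
  qed
  then show ?thesis by blast
qed

text \<open>
  The integer component of a boundary point records the degree. It separates real paths of different
  length that agree on a periodic infinite path.
\<close>

fun gen_act :: "('v, 'e) pre_digraph \<Rightarrow> ('v, 'e) lpa_gen \<Rightarrow>
    ('v \<times> (nat \<Rightarrow> 'e option) \<times> int \<Rightarrow> 'r::comm_ring) \<Rightarrow>
    'v \<times> (nat \<Rightarrow> 'e option) \<times> int \<Rightarrow> 'r" where
  "gen_act E (Vertex v) f (u, z, n) = (if boundary E u z \<and> u = v then f (u, z, n) else 0)"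
| "gen_act E (Edge e) f (u, z, n) =
    (if boundary E u z \<and> z 0 = Some e then f (head E e, \<lambda>n. z (Suc n), n - 1) else 0)"
| "gen_act E (Ghost e) f (u, z, n) =
    (if boundary E u z \<and> u = head E e then f (tail E e, case_nat (Some e) z, n + 1) else 0)"

definition act :: "('v, 'e) pre_digraph \<Rightarrow> ('v, 'e, 'r::comm_ring) falg \<Rightarrow>
    ('v \<times> (nat \<Rightarrow> 'e option) \<times> int \<Rightarrow> 'r) \<Rightarrow> 'v \<times> (nat \<Rightarrow> 'e option) \<times> int \<Rightarrow> 'r" where
  "act E x f b = lin (\<lambda>w r. r * foldr (gen_act E) (letters w) f b) x"

lemma gen_act_linear: "gen_act E g (\<lambda>b. s * f b + h b) b = s * gen_act E g f b + gen_act E g h b"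
  by (cases g; cases b) auto

lemma foldr_gen_act_linear: "foldr (gen_act E) w (\<lambda>b. s * f b + h b)
    = (\<lambda>b. s * foldr (gen_act E) w f b + foldr (gen_act E) w h b)"
  by (induction w) (auto simp: gen_act_linear)

lemma foldr_gen_act_zero: "foldr (gen_act E) w (\<lambda>b. 0) = (\<lambda>b. 0)"
proof (induction w)
  case (Cons g w)
  have "gen_act E g (\<lambda>b. 0) = (\<lambda>b. 0)" by (cases g) (auto simp: fun_eq_iff)
  with Cons show ?case by simp
qed simp

lemma act_0 [simp]: "act E 0 f = (\<lambda>b. 0)"
  by (simp add: act_def fun_eq_iff)

lemma act_add: "act E (x + y) f b = act E x f b + act E y f b"
  unfolding act_def by (intro lin_add) (simp add: distrib_right)

lemma act_diff: "act E (x - y) f b = act E x f b - act E y f b"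
  unfolding act_def by (intro lin_diff) (simp add: distrib_right)

lemma act_sum: "act E (sum g A) f b = (\<Sum>a\<in>A. act E (g a) f b)"
  unfolding act_def by (intro lin_sum) (simp add: distrib_right)

lemma act_single: "act E (Poly_Mapping.single w r) f b = r * foldr (gen_act E) (letters w) f b"
  unfolding act_def by (intro lin_single) simp

lemma act_monom_of: "act E (monom_of w) f b = foldr (gen_act E) w f b"
  by (simp add: monom_of_def act_single)

lemma act_zero: "act E x (\<lambda>b. 0) = (\<lambda>b. 0)"
  by (simp add: act_def foldr_gen_act_zero lin_def fun_eq_iff)

lemma scale_zero [simp]: "Poly_Mapping.map ((*) r) 0 = 0" for r :: "'r::comm_ring"
  by (rule poly_mapping_eqI) simp

lemma act_scale: "act E (Poly_Mapping.map ((*) r) x) f b = r * act E x f b"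
proof (induction x rule: poly_mapping_single_induct)
  case (add k s x)
  then show ?case
    by (simp add: map_mult_add act_add act_single scale_single distrib_left mult.assoc)
qed simp

lemma act_mult: "act E (x * y) f b = act E x (act E y f) b"
proof (induction x rule: poly_mapping_single_induct)
  case (add v r x)
  have "act E (Poly_Mapping.single v r * y) f b = r * foldr (gen_act E) (letters v) (act E y f) b"
  proof (induction y rule: poly_mapping_single_induct)
    case zero
    then show ?case by (simp add: foldr_gen_act_zero)
  next
    case (add w s y)
    have "act E (Poly_Mapping.single w s + y) f
        = (\<lambda>b. s * foldr (gen_act E) (letters w) f b + act E y f b)"
      by (simp add: fun_eq_iff act_add act_single)
    then show ?case using add
      by (simp add: distrib_left act_add mult_single act_single plus_free_mon_def
          foldr_gen_act_linear mult.assoc)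
  qed
  then show ?case using add by (simp add: distrib_right act_add act_single)
qed simp

text \<open>At a regular vertex a boundary path has exactly one first edge, so exactly one
  \<open>e e\<^sup>*\<close> reproduces the value and the others give 0. The remaining relators are
  immediate, and thus the action factors through the Leavitt path algebra.\<close>

lemma act_ideal:
  assumes "wf_digraph E" "x \<in> lpa_ideal E"
  shows "act E x f = (\<lambda>b. 0)"
  using assms(2)
proof (induction arbitrary: f rule: lpa_ideal.induct)
  case (relator x)
  have "act E x f (u, z, n) = 0" for u z n
    using relator
  proof (cases rule: lpa_relators.cases)
    case (regular v)
    let ?A = "{e \<in> arcs E. tail E e = v}"
    have *: "gen_act E (Edge e) (gen_act E (Ghost e) f) (u, z, n)
        = (if boundary E u z \<and> z 0 = Some e then f (u, z, n) else 0)" for e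
      using boundary_first[of E u z e] by auto
    have "(\<Sum>e\<in>?A. gen_act E (Edge e) (gen_act E (Ghost e) f) (u, z, n))
        = gen_act E (Vertex v) f (u, z, n)"
    proof (cases "boundary E u z \<and> u = v")
      case True
      then obtain e where e: "z 0 = Some e" "e \<in> ?A"
        using boundary_regular[of E v z] boundary_first[of E v z] regular(2) by blast
      have "(\<Sum>e\<in>?A. gen_act E (Edge e) (gen_act E (Ghost e) f) (u, z, n))
          = (\<Sum>e'\<in>?A. if e' = e then f (u, z, n) else 0)"
        unfolding * using True e by (intro sum.cong) auto
      also have "\<dots> = gen_act E (Vertex v) f (u, z, n)"
        using True e regular(2) by (auto simp: regular_vertex_def)
      finally show ?thesis .
    next
      case False
      then have "(if boundary E u z \<and> z 0 = Some e then f (u, z, n) else 0) = 0" if "e \<in> ?A" for e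
        using boundary_first[of E u z e] that by auto
      then have "(\<Sum>e\<in>?A. gen_act E (Edge e) (gen_act E (Ghost e) f) (u, z, n)) = 0"
        unfolding * by (intro sum.neutral) blast
      then show ?thesis using False by auto
    qed
    then show ?thesis
      by (simp add: regular(1) act_diff act_sum act_monom_of del: gen_act.simps)
  qed (auto simp: act_diff act_monom_of boundary.step dest: boundary_first(2) boundary_first(3))
  then show ?case by auto
next
  case (mult_left a x)
  then show ?case by (intro ext) (simp add: act_mult act_zero)
next
  case (mult_right x a)
  then show ?case by (intro ext) (simp add: act_mult)
qed (auto simp: act_add act_scale fun_eq_iff)

definition prepend :: "'e list \<Rightarrow> (nat \<Rightarrow> 'e option) \<Rightarrow> nat \<Rightarrow> 'e option" where
  "prepend p z = foldr (\<lambda>e. case_nat (Some e)) p z"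

lemma prepend_simps [simp]: "prepend [] z = z" "prepend (e # p) z = case_nat (Some e) (prepend p z)"
  by (simp_all add: prepend_def)

context wf_digraph
begin

lemma boundary_prepend: "awalk u p w \<Longrightarrow> boundary G w z \<Longrightarrow> boundary G u (prepend p z)"
  by (induction p arbitrary: u) (auto simp: awalk_simps intro: boundary.step)

lemma gen_act_edges_prepend:
  assumes "awalk u p w" "boundary G w z"
  shows "foldr (gen_act G) (map Edge p) f (u, prepend p z, n) = f (w, z, n - int (length p))"
  using assms
proof (induction p arbitrary: u n)
  case (Cons e p)
  have "boundary G u (prepend (e # p) z)" using boundary_prepend[OF Cons.prems] .
  with Cons show ?case by (auto simp: awalk_simps algebra_simps)
qed (simp add: awalk_simps)

lemma gen_act_edges_neq:
  assumes "length p = length q" "p \<noteq> q"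
  shows "foldr (gen_act G) (map Edge q) f (u, prepend p z, n) = 0"
  using assms
proof (induction p arbitrary: u n q)
  case (Cons e p)
  then show ?case by (cases q) auto
qed simp

text \<open>Each edge lowers the degree by 1, so \<open>f\<close> is only ever read in degree
  \<open>n - length q\<close>, which is nonzero.\<close>

lemma gen_act_edges_degree:
  assumes "\<And>u z n. n \<noteq> 0 \<Longrightarrow> f (u, z, n) = 0" "n \<noteq> int (length q)"
  shows "foldr (gen_act G) (map Edge q) f (u, z, n) = 0"
  using assms(2)
proof (induction q arbitrary: u z n)
  case (Cons e q)
  then show ?case by simp
qed (simp add: assms(1))

end

section \<open>Calculating modulo the defining ideal\<close>

abbreviation mon :: "'r \<Rightarrow> ('v, 'e) lpa_gen list \<Rightarrow>
    ('v, 'e, 'r::{comm_ring, comm_monoid_mult}) falg" where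
  "mon r w \<equiv> Poly_Mapping.single (Word w) r"

text \<open>The source vertex stays in front so that the trivial path has a nonempty word and no
  case distinction is needed; \<open>lpa_path_eq\<close> shows that the class is that of the
  path.\<close>

definition path_word :: "'v \<Rightarrow> 'e list \<Rightarrow> ('v, 'e) lpa_gen list" where
  "path_word u p = Vertex u # map Edge p"

definition ghost_word :: "'v \<Rightarrow> 'e list \<Rightarrow> ('v, 'e) lpa_gen list" where
  "ghost_word u p = map Ghost (rev p) @ [Vertex u]"

lemma mon_mult: "mon r a * mon s b = mon (r * s) (a @ b)"
  by (simp add: mult_single plus_free_mon_def)

lemma mon_Nil_mult: "mon r [] * x = Poly_Mapping.map ((*) r) x"
proof (induction x rule: poly_mapping_single_induct)
  case (add w s x)
  then show ?case
    by (cases w) (simp add: distrib_left map_mult_add scale_single mult_single plus_free_mon_def)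
qed simp

lemma mult_mon_Nil: "x * mon r [] = Poly_Mapping.map ((*) r) x"
proof (induction x rule: poly_mapping_single_induct)
  case (add w s x)
  then show ?case
    by (cases w)
      (simp add: distrib_right map_mult_add scale_single mult_single plus_free_mon_def
        mult.commute[of s r])
qed simp

text \<open>The free algebra with the empty word added. Factors such as \<open>map Edge []\<close>
  occur when words are split, and the ideal absorbs them because it is closed under scalars.\<close>

definition ualg :: "('v, 'e) pre_digraph \<Rightarrow> ('v, 'e, 'r::zero) falg set" where
  "ualg E = {x. \<forall>w\<in>Poly_Mapping.keys x. set (letters w) \<subseteq> lpa_gens E}"

lemma free_alg_ualg: "x \<in> free_alg E \<Longrightarrow> x \<in> ualg E"
  by (auto simp: free_alg_def ualg_def)

lemma ualg_0 [simp]: "0 \<in> ualg E"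
  by (simp add: ualg_def)

lemma ualg_mon [simp]: "set w \<subseteq> lpa_gens E \<Longrightarrow> mon r w \<in> ualg E"
  by (auto simp: ualg_def)

lemma ualg_add: "\<lbrakk>x \<in> ualg E; y \<in> ualg E\<rbrakk> \<Longrightarrow> x + y \<in> ualg E"
  using keys_add[of x y] by (auto simp: ualg_def)

lemma ualg_uminus: "x \<in> ualg E \<Longrightarrow> - x \<in> ualg E"
  for x :: "('v, 'e, 'r::ab_group_add) falg"
  by (simp add: ualg_def in_keys_iff)

lemma ualg_diff: "\<lbrakk>x \<in> ualg E; y \<in> ualg E\<rbrakk> \<Longrightarrow> x - y \<in> ualg E"
  for x :: "('v, 'e, 'r::ab_group_add) falg"
  using ualg_add[of x E "- y"] by (simp add: ualg_uminus)

lemma ualg_sum: "(\<And>i. i \<in> A \<Longrightarrow> f i \<in> ualg E) \<Longrightarrow> sum f A \<in> ualg E"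
  for f :: "'i \<Rightarrow> ('v, 'e, 'r::comm_monoid_add) falg"
  by (induction A rule: infinite_finite_induct) (simp_all add: ualg_add)

lemma ualg_letters: "\<lbrakk>x \<in> ualg E; w \<in> Poly_Mapping.keys x\<rbrakk> \<Longrightarrow> set (letters w) \<subseteq> lpa_gens E"
  by (auto simp: ualg_def)

lemma free_alg_mon: "\<lbrakk>w \<noteq> []; set w \<subseteq> lpa_gens E\<rbrakk> \<Longrightarrow> mon r w \<in> free_alg E"
  by (auto simp: free_alg_def)

lemma
  assumes a: "a \<in> ualg E" and x: "x \<in> lpa_ideal E"
  shows ualg_mult_ideal: "a * x \<in> lpa_ideal E"
    and ideal_mult_ualg: "x * a \<in> lpa_ideal E"
proof -
  have "a * x \<in> lpa_ideal E \<and> x * a \<in> lpa_ideal E"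
  proof (induction a rule: poly_mapping_single_induct)
    case zero
    show ?case by (simp add: lpa_ideal.zero)
  next
    case (add w r b)
    have "Poly_Mapping.single w r * x \<in> lpa_ideal E \<and> x * Poly_Mapping.single w r \<in> lpa_ideal E"
    proof (cases "letters w = []")
      case True
      then have "w = Word []" by (cases w) simp
      then show ?thesis using x by (simp add: mon_Nil_mult mult_mon_Nil lpa_ideal.scale)
    next
      case False
      then have "Poly_Mapping.single w r \<in> free_alg E"
        using free_alg_mon[of "letters w" E r] ualg_letters[OF a add(1)] by simp
      then show ?thesis using x lpa_ideal.mult_left lpa_ideal.mult_right by blast
    qed
    with add show ?case by (simp add: distrib_left distrib_right lpa_ideal.add)
  qed
  then show "a * x \<in> lpa_ideal E" "x * a \<in> lpa_ideal E" by auto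
qed

lemma lpa_gens_simps [simp]:
  "Vertex v \<in> lpa_gens E \<longleftrightarrow> v \<in> verts E" "Edge e \<in> lpa_gens E \<longleftrightarrow> e \<in> arcs E"
  "Ghost e \<in> lpa_gens E \<longleftrightarrow> e \<in> arcs E" "Edge ` A \<subseteq> lpa_gens E \<longleftrightarrow> A \<subseteq> arcs E"
  "Ghost ` A \<subseteq> lpa_gens E \<longleftrightarrow> A \<subseteq> arcs E"
  by (auto simp: lpa_gens_def)

text \<open>As a parameter, \<open>I\<close> ties the coefficient type \<open>'r\<close> to the
  locale. Relations between bare words, such as \<open>weq\<close>, depend on the coefficients
  without showing them in their type.\<close>

locale leavitt = wf_digraph E for E :: "('v, 'e) pre_digraph" +
  fixes I :: "('v, 'e, 'r::{comm_ring, comm_monoid_mult}) falg set"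
  assumes I_eq: "I = lpa_ideal E"
begin

lemma ideal_0 [simp]: "0 \<in> I"
  by (simp add: I_eq lpa_ideal.zero)

lemma ideal_add: "\<lbrakk>x \<in> I; y \<in> I\<rbrakk> \<Longrightarrow> x + y \<in> I"
  by (simp add: I_eq lpa_ideal.add)

lemma ideal_uminus: "x \<in> I \<Longrightarrow> - x \<in> I"
  by (simp add: I_eq lpa_ideal_uminus)

lemma ideal_diff: "\<lbrakk>x \<in> I; y \<in> I\<rbrakk> \<Longrightarrow> x - y \<in> I"
  by (simp add: I_eq lpa_ideal_diff)

lemma ideal_scale: "x \<in> I \<Longrightarrow> Poly_Mapping.map ((*) r) x \<in> I"
  by (simp add: I_eq lpa_ideal.scale)

lemma ideal_relator: "x \<in> lpa_relators E \<Longrightarrow> x \<in> I"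
  by (simp add: I_eq lpa_ideal.relator)

lemma ideal_sum: "(\<And>i. i \<in> A \<Longrightarrow> f i \<in> I) \<Longrightarrow> sum f A \<in> I"
  by (induction A rule: infinite_finite_induct) (simp_all add: ideal_add)

lemma ideal_mult_left: "\<lbrakk>a \<in> ualg E; x \<in> I\<rbrakk> \<Longrightarrow> a * x \<in> I"
  by (simp add: I_eq ualg_mult_ideal)

lemma ideal_mult_right: "\<lbrakk>x \<in> I; a \<in> ualg E\<rbrakk> \<Longrightarrow> x * a \<in> I"
  by (simp add: I_eq ideal_mult_ualg)

definition eqv :: "('v, 'e, 'r) falg \<Rightarrow> ('v, 'e, 'r) falg \<Rightarrow> bool" (infix "\<approx>" 50) where
  "x \<approx> y \<longleftrightarrow> x - y \<in> I"

lemma eqv_refl [simp]: "x \<approx> x"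
  by (simp add: eqv_def)

lemma eqv_sym: "x \<approx> y \<Longrightarrow> y \<approx> x"
  using ideal_uminus[of "x - y"] by (simp add: eqv_def)

lemma eqv_trans [trans]: "\<lbrakk>x \<approx> y; y \<approx> z\<rbrakk> \<Longrightarrow> x \<approx> z"
  using ideal_add[of "x - y" "y - z"] by (simp add: eqv_def)

lemma eqv_0_iff: "x \<approx> 0 \<longleftrightarrow> x \<in> I"
  by (simp add: eqv_def)

lemma eqv_ideal_iff: "x \<approx> y \<Longrightarrow> x \<in> I \<longleftrightarrow> y \<in> I"
  using eqv_trans[of x y 0] eqv_trans[of y x 0] eqv_sym[of x y] by (auto simp: eqv_0_iff)

lemma eqv_add: "\<lbrakk>x \<approx> x'; y \<approx> y'\<rbrakk> \<Longrightarrow> x + y \<approx> x' + y'"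
  using ideal_add[of "x - x'" "y - y'"] by (simp add: eqv_def algebra_simps)

lemma eqv_diff: "\<lbrakk>x \<approx> x'; y \<approx> y'\<rbrakk> \<Longrightarrow> x - y \<approx> x' - y'"
  using ideal_diff[of "x - x'" "y - y'"] by (simp add: eqv_def algebra_simps)

lemma eqv_sum: "(\<And>i. i \<in> A \<Longrightarrow> f i \<approx> g i) \<Longrightarrow> sum f A \<approx> sum g A"
  using ideal_sum[of A "\<lambda>i. f i - g i"] by (simp add: eqv_def sum_subtractf)

lemma eqv_mult_left: "\<lbrakk>a \<in> ualg E; x \<approx> y\<rbrakk> \<Longrightarrow> a * x \<approx> a * y"
  using ideal_mult_left[of a "x - y"] by (simp add: eqv_def right_diff_distrib)

lemma eqv_mult_right: "\<lbrakk>x \<approx> y; a \<in> ualg E\<rbrakk> \<Longrightarrow> x * a \<approx> y * a"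
  using ideal_mult_right[of "x - y" a] by (simp add: eqv_def left_diff_distrib)

text \<open>Requiring letters from \<open>lpa_gens E\<close> on both sides makes this relation a
  congruence for concatenation, so that computations in the algebra become rewriting of
  words.\<close>

definition weq :: "('v, 'e) lpa_gen list \<Rightarrow> ('v, 'e) lpa_gen list \<Rightarrow> bool" where
  "weq s t \<longleftrightarrow> set s \<subseteq> lpa_gens E \<and> set t \<subseteq> lpa_gens E \<and> monom_of s \<approx> monom_of t"

definition wnull :: "('v, 'e) lpa_gen list \<Rightarrow> bool" where
  "wnull s \<longleftrightarrow> set s \<subseteq> lpa_gens E \<and> monom_of s \<in> I"

lemma weq_refl: "set s \<subseteq> lpa_gens E \<Longrightarrow> weq s s"
  by (simp add: weq_def)

lemma weq_sym: "weq s t \<Longrightarrow> weq t s"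
  by (simp add: weq_def eqv_sym)

lemma weq_trans [trans]: "\<lbrakk>weq s t; weq t w\<rbrakk> \<Longrightarrow> weq s w"
  by (auto simp: weq_def intro: eqv_trans)

lemma weq_wnull: "\<lbrakk>weq s t; wnull t\<rbrakk> \<Longrightarrow> wnull s"
  by (auto simp: weq_def wnull_def eqv_ideal_iff)

lemma weq_append:
  assumes "weq s s'" "weq t t'"
  shows "weq (s @ t) (s' @ t')"
proof -
  have *: "monom_of (a @ b) = monom_of a * (monom_of b :: ('v, 'e, 'r) falg)" for a b
    by (simp add: monom_of_def mon_mult)
  have "monom_of s * monom_of t \<approx> monom_of s * monom_of t'"
    using assms by (intro eqv_mult_left) (auto simp: weq_def monom_of_def)
  also have "monom_of s * monom_of t' \<approx> monom_of s' * monom_of t'"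
    using assms by (intro eqv_mult_right) (auto simp: weq_def monom_of_def)
  finally show ?thesis using assms by (simp add: weq_def *)
qed

lemma weq_Cons: "\<lbrakk>g \<in> lpa_gens E; weq t t'\<rbrakk> \<Longrightarrow> weq (g # t) (g # t')"
  using weq_append[of "[g]" "[g]" t t'] by (simp add: weq_refl)

lemma wnull_append:
  assumes "wnull s" "set a \<subseteq> lpa_gens E"
  shows "wnull (a @ s)" "wnull (s @ a)"
proof -
  have *: "monom_of (a @ b) = monom_of a * (monom_of b :: ('v, 'e, 'r) falg)" for a b
    by (simp add: monom_of_def mon_mult)
  have "(monom_of a :: ('v, 'e, 'r) falg) \<in> ualg E" using assms by (simp add: monom_of_def)
  then show "wnull (a @ s)" "wnull (s @ a)"
    using assms by (auto simp: wnull_def * ideal_mult_left ideal_mult_right)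
qed

lemma wnull_Cons: "\<lbrakk>wnull s; g \<in> lpa_gens E\<rbrakk> \<Longrightarrow> wnull (g # s)"
  using wnull_append(1)[of s "[g]"] by simp

lemma mon_eq_scaled: "mon r s = Poly_Mapping.map ((*) r) (monom_of s)"
  by (simp add: monom_of_def scale_single)

lemma mon_wnull: "wnull s \<Longrightarrow> mon r s \<in> I"
  by (simp add: wnull_def mon_eq_scaled ideal_scale)

lemma mon_weq: "weq s t \<Longrightarrow> mon r s \<approx> mon r t"
  unfolding weq_def mon_eq_scaled eqv_def map_mult_diff[symmetric]
  by (auto intro: ideal_scale)

lemma weq_relators:
  "v \<in> verts E \<Longrightarrow> weq [Vertex v, Vertex v] [Vertex v]"
  "e \<in> arcs E \<Longrightarrow> weq [Vertex (tail E e), Edge e] [Edge e]"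
  "e \<in> arcs E \<Longrightarrow> weq [Edge e, Vertex (head E e)] [Edge e]"
  "e \<in> arcs E \<Longrightarrow> weq [Vertex (head E e), Ghost e] [Ghost e]"
  "e \<in> arcs E \<Longrightarrow> weq [Ghost e, Vertex (tail E e)] [Ghost e]"
  "e \<in> arcs E \<Longrightarrow> weq [Ghost e, Edge e] [Vertex (head E e)]"
  by (auto simp: weq_def eqv_def intro: ideal_relator lpa_relators.intros)

lemma wnull_relators:
  "\<lbrakk>v \<in> verts E; w \<in> verts E; v \<noteq> w\<rbrakk> \<Longrightarrow> wnull [Vertex v, Vertex w]"
  "\<lbrakk>e \<in> arcs E; f \<in> arcs E; e \<noteq> f\<rbrakk> \<Longrightarrow> wnull [Ghost e, Edge f]"
  by (auto simp: wnull_def intro: ideal_relator lpa_relators.intros)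

lemma eqv_regular:
  "regular_vertex E v \<Longrightarrow>
    mon 1 [Vertex v] \<approx> (\<Sum>e\<in>{e \<in> arcs E. tail E e = v}. mon 1 [Edge e, Ghost e])"
  unfolding eqv_def monom_of_def[symmetric]
  by (intro ideal_relator lpa_relators.intros)

lemma wnull_vertex_edge:
  assumes "v \<in> verts E" "e \<in> arcs E" "v \<noteq> tail E e"
  shows "wnull [Vertex v, Edge e]"
proof (rule weq_wnull)
  show "weq [Vertex v, Edge e] ([Vertex v] @ [Vertex (tail E e), Edge e])"
    using assms weq_relators(2) by (simp add: weq_Cons weq_sym)
  show "wnull ([Vertex v] @ [Vertex (tail E e), Edge e])"
    using wnull_append(2)[OF wnull_relators(1)[of v "tail E e"], of "[Edge e]"] assms by simp
qed

lemma wnull_vertex_ghost: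
  assumes "v \<in> verts E" "e \<in> arcs E" "v \<noteq> head E e"
  shows "wnull [Vertex v, Ghost e]"
proof (rule weq_wnull)
  show "weq [Vertex v, Ghost e] ([Vertex v] @ [Vertex (head E e), Ghost e])"
    using assms weq_relators(4) by (simp add: weq_Cons weq_sym)
  show "wnull ([Vertex v] @ [Vertex (head E e), Ghost e])"
    using wnull_append(2)[OF wnull_relators(1)[of v "head E e"], of "[Ghost e]"] assms by simp
qed

section \<open>Cancellation of ghost paths against paths\<close>

lemma path_word_gens: "awalk u p v \<Longrightarrow> set (path_word u p) \<subseteq> lpa_gens E"
  by (auto simp: path_word_def awalk_def)

lemma ghost_word_gens: "awalk u p v \<Longrightarrow> set (ghost_word u p) \<subseteq> lpa_gens E"
  by (auto simp: ghost_word_def awalk_def)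

lemma arcs_gens: "awalk u p v \<Longrightarrow> set p \<subseteq> arcs E"
  by (auto simp: awalk_def)

lemma awalk_last: "awalk u (p @ [e]) v \<Longrightarrow> v = head E e"
  by (auto simp: awalk_simps)

lemma path_word_vertex:
  assumes "awalk u p v"
  shows "weq (path_word u p @ [Vertex v]) (path_word u p)"
proof (cases p rule: rev_cases)
  case Nil
  then show ?thesis using assms weq_relators(1)[of u] by (auto simp: path_word_def awalk_simps)
next
  case (snoc q e)
  then have "v = head E e" "e \<in> arcs E" using assms awalk_last by auto
  then have "weq (path_word u q @ [Edge e, Vertex v]) (path_word u q @ [Edge e])"
    using assms snoc by (intro weq_append weq_refl path_word_gens[of u q "tail E e"])
      (auto simp: weq_relators awalk_simps)
  then show ?thesis using snoc by (simp add: path_word_def)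
qed

lemma path_word_append:
  assumes "awalk u p v" "awalk v q w"
  shows "weq (path_word u p @ path_word v q) (path_word u (p @ q))"
  using weq_append[OF path_word_vertex[OF assms(1)] weq_refl[of "map Edge q"]] arcs_gens[OF assms(2)]
  by (simp add: path_word_def)

lemma wnull_path_word_vertex:
  assumes "awalk u p v" "w \<in> verts E" "w \<noteq> v"
  shows "wnull (path_word u p @ [Vertex w])"
proof (rule weq_wnull)
  show "weq (path_word u p @ [Vertex w]) (path_word u p @ [Vertex v, Vertex w])"
    using weq_append[OF path_word_vertex[OF assms(1)] weq_refl[of "[Vertex w]"]] assms(2)
    by (simp add: weq_sym)
  show "wnull (path_word u p @ [Vertex v, Vertex w])"
    using assms awalk_last_in_verts[OF assms(1)]
    by (intro wnull_append wnull_relators path_word_gens) auto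
qed

lemma vertex_ghost_word:
  assumes "awalk u p v"
  shows "weq (Vertex v # ghost_word u p) (ghost_word u p)"
proof (cases p rule: rev_cases)
  case Nil
  then show ?thesis using assms weq_relators(1)[of u] by (auto simp: ghost_word_def awalk_simps)
next
  case (snoc q e)
  then have "v = head E e" "e \<in> arcs E" using assms awalk_last by auto
  then have "weq ([Vertex v, Ghost e] @ ghost_word u q) ([Ghost e] @ ghost_word u q)"
    using assms snoc by (intro weq_append weq_refl ghost_word_gens[of u q "tail E e"])
      (auto simp: weq_relators awalk_simps)
  then show ?thesis using snoc by (simp add: ghost_word_def)
qed

lemma ghost_word_vertex:
  assumes "awalk u p v"
  shows "weq (ghost_word u p @ [Vertex u]) (ghost_word u p)"
  using weq_append[OF weq_refl[of "map Ghost (rev p)"] weq_relators(1)[of u]] assms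
  by (auto simp: ghost_word_def awalk_def)

lemma ghost_word_path_word_Cons:
  assumes "awalk u (e # p) v" "awalk u (e # q) w"
  shows "weq (ghost_word u (e # p) @ path_word u (e # q))
    (ghost_word (head E e) p @ path_word (head E e) q)"
proof -
  let ?h = "head E e"
  have e: "e \<in> arcs E" "tail E e = u" using assms by (auto simp: awalk_simps)
  have gens: "set (map Ghost (rev p)) \<subseteq> lpa_gens E" "set (map Edge q) \<subseteq> lpa_gens E"
    using assms by (auto simp: awalk_def)
  have "weq ([Ghost e, Vertex u] @ [Vertex u, Edge e]) ([Ghost e] @ [Edge e])"
    using e weq_relators by (intro weq_append) auto
  also have "weq ([Ghost e] @ [Edge e]) [Vertex ?h]" using e weq_relators by simp
  also have "weq [Vertex ?h] ([Vertex ?h, Vertex ?h])" using e weq_relators by (simp add: weq_sym)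
  finally have "weq (map Ghost (rev p) @ ([Ghost e, Vertex u] @ [Vertex u, Edge e]) @ map Edge q)
    (map Ghost (rev p) @ [Vertex ?h, Vertex ?h] @ map Edge q)"
    using gens by (intro weq_append weq_refl)
  then show ?thesis by (simp add: ghost_word_def path_word_def)
qed

lemma wnull_ghost_word_path_word_Cons:
  assumes "awalk u (e # p) v" "awalk u (f # q) w" "e \<noteq> f"
  shows "wnull (ghost_word u (e # p) @ path_word u (f # q))"
proof -
  have e: "e \<in> arcs E" "tail E e = u" "f \<in> arcs E" "tail E f = u"
    using assms by (auto simp: awalk_simps)
  have gens: "set (map Ghost (rev p)) \<subseteq> lpa_gens E" "set (map Edge q) \<subseteq> lpa_gens E"
    using assms by (auto simp: awalk_def)
  have "weq ([Ghost e, Vertex u] @ [Vertex u, Edge f]) ([Ghost e] @ [Edge f])"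
    using e weq_relators(5)[of e] weq_relators(2)[of f] by (intro weq_append) auto
  moreover have "wnull ([Ghost e] @ [Edge f])" using e assms(3) wnull_relators by simp
  ultimately have "wnull ([Ghost e, Vertex u] @ [Vertex u, Edge f])" by (rule weq_wnull)
  then have "wnull (map Ghost (rev p) @ ([Ghost e, Vertex u] @ [Vertex u, Edge f]) @ map Edge q)"
    using gens by (intro wnull_append(1)[OF wnull_append(2)])
  then show ?thesis by (simp add: ghost_word_def path_word_def)
qed

lemma ghost_word_path_word:
  assumes "awalk u p v" "awalk v q w"
  shows "weq (ghost_word u p @ path_word u (p @ q)) (path_word v q)"
  using assms
proof (induction p arbitrary: u)
  case Nil
  then have "u = v" "u \<in> verts E" by (auto simp: awalk_simps)
  then show ?case
    using weq_append[OF weq_relators(1)[of v] weq_refl[of "map Edge q"]] arcs_gens[OF assms(2)]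
    by (simp add: ghost_word_def path_word_def)
next
  case (Cons e p)
  have "weq (ghost_word u (e # p) @ path_word u (e # (p @ q)))
      (ghost_word (head E e) p @ path_word (head E e) (p @ q))"
    using Cons.prems by (intro ghost_word_path_word_Cons) (auto simp: awalk_simps)
  also have "weq (ghost_word (head E e) p @ path_word (head E e) (p @ q)) (path_word v q)"
    using Cons by (auto simp: awalk_simps)
  finally show ?case by simp
qed

text \<open>Different sources give orthogonal vertices. With equal sources, common first edges
  cancel until two different edges meet in \<open>e\<^sup>* f = 0\<close>; this happens before
  \<open>p\<close> is used up, because \<open>p\<close> is not a prefix of \<open>q\<close>.\<close>

lemma wnull_ghost_word_path_word:
  assumes "awalk u p v" "awalk u' q w" "length p \<le> length q"
    and "u \<noteq> u' \<or> take (length p) q \<noteq> p"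
  shows "wnull (ghost_word u p @ path_word u' q)"
proof (cases "u = u'")
  case False
  have "u \<in> verts E" "u' \<in> verts E" using assms(1,2) by auto
  then have "wnull (map Ghost (rev p) @ [Vertex u, Vertex u'] @ map Edge q)"
    using False arcs_gens[OF assms(1)] arcs_gens[OF assms(2)]
    by (intro wnull_append wnull_relators) auto
  then show ?thesis by (simp add: ghost_word_def path_word_def)
next
  case True
  then have "awalk u q w" "take (length p) q \<noteq> p" using assms by auto
  with assms(1,3) have "wnull (ghost_word u p @ path_word u q)"
  proof (induction p arbitrary: u q)
    case (Cons e p)
    then obtain f q' where q: "q = f # q'" by (cases q) auto
    show ?case
    proof (cases "e = f")
      case False
      then show ?thesis using Cons.prems q by (auto intro: wnull_ghost_word_path_word_Cons)
    next
      case True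
      show ?thesis unfolding q True
      proof (rule weq_wnull)
        show "weq (ghost_word u (f # p) @ path_word u (f # q'))
          (ghost_word (head E f) p @ path_word (head E f) q')"
          using Cons.prems True q by (intro ghost_word_path_word_Cons) auto
        show "wnull (ghost_word (head E f) p @ path_word (head E f) q')"
          using Cons True q by (auto simp: awalk_simps)
      qed
    qed
  qed simp
  with True show ?thesis by simp
qed

text \<open>The coefficient of \<open>p0\<close> is read off at the boundary path
  \<open>p0 z\<close> in degree \<open>length p0\<close>, with the indicator function of
  \<open>(w, z, 0)\<close> as argument. Any other path gives 0: a different length is detected by
  the degree, a different edge list by the initial segment, a different source by the first
  component.\<close>

lemma paths_independent:
  assumes "finite A" "\<And>u p. (u, p) \<in> A \<Longrightarrow> \<exists>v. awalk u p v"
    and "(\<Sum>\<alpha>\<in>A. mon (c \<alpha>) (path_word (fst \<alpha>) (snd \<alpha>))) \<in> I" and "\<alpha> \<in> A"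
  shows "c \<alpha> = 0"
proof -
  obtain u0 p0 where \<alpha>: "\<alpha> = (u0, p0)" by (cases \<alpha>)
  then obtain w where w: "awalk u0 p0 w" using assms by auto
  then obtain z where z: "boundary E w z" using boundary_exists by blast
  define f :: "'v \<times> (nat \<Rightarrow> 'e option) \<times> int \<Rightarrow> 'r"
    where "f = (\<lambda>(u, z', n). if (u, z', n) = (w, z, 0) then 1 else 0)"
  let ?b = "(u0, prepend p0 z, int (length p0))"
  have "act E (mon (c \<beta>) (path_word (fst \<beta>) (snd \<beta>))) f ?b = (if \<beta> = \<alpha> then c \<alpha> else 0)"
    if "\<beta> \<in> A" for \<beta>
  proof -
    obtain u p where \<beta>: "\<beta> = (u, p)" by (cases \<beta>)
    have "foldr (gen_act E) (map Edge p) f ?b = (if p = p0 then 1 else 0)"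
    proof (cases "length p = length p0")
      case True
      then show ?thesis using gen_act_edges_neq[of p0 p f u0 z] gen_act_edges_prepend[OF w z, of f]
        by (auto simp: f_def)
    next
      case False
      then show ?thesis using gen_act_edges_degree[of f "int (length p0)" p] by (auto simp: f_def)
    qed
    then show ?thesis using boundary_prepend[OF w z]
      by (auto simp: \<alpha> \<beta> act_single path_word_def)
  qed
  then have "(\<Sum>\<beta>\<in>A. act E (mon (c \<beta>) (path_word (fst \<beta>) (snd \<beta>))) f ?b) = c \<alpha>"
    using assms(1,4) by (simp cong: sum.cong)
  then show ?thesis
    using act_ideal[OF wf_digraph, of _ f] assms(3) by (auto simp: act_sum[symmetric] I_eq)
qed

end

section \<open>Reduction to real paths\<close>

context leavitt
begin

text \<open>Modulo \<open>I\<close>, a member is a sum of terms \<open>p q\<^sup>*\<close> with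
  \<open>length q \<le> d\<close>. Zero coefficients and repeated terms are allowed, so
  \<open>d\<close> is only an upper bound; it is the induction measure of
  \<open>reduce_to_real\<close>.\<close>

inductive_set ghost_deg :: "nat \<Rightarrow> ('v, 'e, 'r) falg set" for d where
  ideal: "x \<in> I \<Longrightarrow> x \<in> ghost_deg d"
| add: "\<lbrakk>awalk u p w; awalk v q w; length q \<le> d; x \<in> ghost_deg d\<rbrakk> \<Longrightarrow>
    mon r (path_word u p @ ghost_word v q) + x \<in> ghost_deg d"

lemma ghost_deg_add: "\<lbrakk>x \<in> ghost_deg d; y \<in> ghost_deg d\<rbrakk> \<Longrightarrow> x + y \<in> ghost_deg d"
proof (induction rule: ghost_deg.induct)
  case (ideal x)
  from ideal(2,1) show ?case
  proof (induction rule: ghost_deg.induct)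
    case (ideal y)
    then show ?case by (intro ghost_deg.ideal ideal_add)
  next
    case (add u p w v q y r)
    then have "mon r (path_word u p @ ghost_word v q) + (x + y) \<in> ghost_deg d"
      by (intro ghost_deg.add)
    then show ?case by (simp add: add_ac)
  qed
next
  case (add u p w v q x r)
  then show ?case using ghost_deg.add[of u p w v q d "x + y" r] by (simp add: add_ac)
qed

lemma ghost_deg_eqv: "\<lbrakk>x \<in> ghost_deg d; y \<approx> x\<rbrakk> \<Longrightarrow> y \<in> ghost_deg d"
  using ghost_deg_add[OF ghost_deg.ideal, of "y - x" x d] by (simp add: eqv_def)

lemma ghost_deg_mon:
  "\<lbrakk>awalk u p w; awalk v q w; length q \<le> d\<rbrakk> \<Longrightarrow> mon r (path_word u p @ ghost_word v q) \<in> ghost_deg d"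
  using ghost_deg.add[of u p w v q d 0 r] by (simp add: ghost_deg.ideal)

lemma ghost_deg_mono: "\<lbrakk>x \<in> ghost_deg d; d \<le> d'\<rbrakk> \<Longrightarrow> x \<in> ghost_deg d'"
  by (induction rule: ghost_deg.induct) (auto intro: ghost_deg.intros)

lemma ghost_deg_mult:
  assumes g: "g \<in> lpa_gens E"
    and mon: "\<And>u p w v q r. \<lbrakk>awalk u p w; awalk v q w; length q \<le> d\<rbrakk> \<Longrightarrow>
      mon r ((path_word u p @ ghost_word v q) @ [g]) \<in> ghost_deg d'"
    and x: "x \<in> ghost_deg d"
  shows "x * mon 1 [g] \<in> ghost_deg d'"
  using x
proof (induction rule: ghost_deg.induct)
  case (ideal x)
  then show ?case using g by (intro ghost_deg.ideal ideal_mult_right ualg_mon) auto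
next
  case (add u p w v q x r)
  then show ?case using mon[of u p w v q r]
    by (simp add: distrib_right mon_mult ghost_deg_add)
qed

lemma nf_word_gens:
  "\<lbrakk>awalk u p w; awalk v q w\<rbrakk> \<Longrightarrow> set (path_word u p @ ghost_word v q) \<subseteq> lpa_gens E"
  using path_word_gens ghost_word_gens by simp

lemma path_word_ghost_word_Nil:
  "awalk u p w \<Longrightarrow> weq (path_word u p @ ghost_word w []) (path_word u p)"
  using path_word_vertex[of u p w] by (simp add: ghost_word_def)

lemma wnull_ghost_word_vertex:
  assumes "awalk v q w" "x \<in> verts E" "x \<noteq> v"
  shows "wnull (ghost_word v q @ [Vertex x])"
proof -
  have "wnull (map Ghost (rev q) @ [Vertex v, Vertex x])"
    using assms by (intro wnull_append(1) wnull_relators) (auto simp: awalk_def)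
  then show ?thesis by (simp add: ghost_word_def)
qed

lemma ghost_deg_mult_vertex:
  assumes "x \<in> ghost_deg d" "v \<in> verts E"
  shows "x * mon 1 [Vertex v] \<in> ghost_deg d"
proof (rule ghost_deg_mult[OF _ _ assms(1)])
  fix u p w v' q r assume *: "awalk u p w" "awalk v' q w" "length q \<le> d"
  show "mon r ((path_word u p @ ghost_word v' q) @ [Vertex v]) \<in> ghost_deg d"
  proof (cases "v = v'")
    case True
    have "weq ((path_word u p @ ghost_word v' q) @ [Vertex v]) (path_word u p @ ghost_word v' q)"
      using * True weq_append[OF weq_refl[OF path_word_gens[OF *(1)]] ghost_word_vertex[OF *(2)]]
      by simp
    then show ?thesis using ghost_deg_eqv[OF ghost_deg_mon[OF *] mon_weq] by blast
  next
    case False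
    then have "wnull (path_word u p @ (ghost_word v' q @ [Vertex v]))"
      using * assms path_word_gens by (intro wnull_append(1) wnull_ghost_word_vertex)
    then show ?thesis by (simp add: ghost_deg.ideal mon_wnull)
  qed
qed (simp add: assms)

lemma ghost_deg_mult_ghost:
  assumes "x \<in> ghost_deg d" "e \<in> arcs E"
  shows "x * mon 1 [Ghost e] \<in> ghost_deg (Suc d)"
proof (rule ghost_deg_mult[OF _ _ assms(1)])
  fix u p w v q r assume *: "awalk u p w" "awalk v q w" "length q \<le> d"
  have v: "v \<in> verts E" and q: "set (map Ghost (rev q)) \<subseteq> lpa_gens E"
    using *(2) by (auto simp: awalk_def)
  show "mon r ((path_word u p @ ghost_word v q) @ [Ghost e]) \<in> ghost_deg (Suc d)"
  proof (cases "v = head E e")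
    case True
    have "weq [Vertex v, Ghost e] [Ghost e]" using weq_relators(4) assms True by simp
    also have "weq [Ghost e] [Ghost e, Vertex (tail E e)]" using weq_relators(5) assms weq_sym by simp
    finally have "weq (path_word u p @ map Ghost (rev q) @ [Vertex v, Ghost e])
      (path_word u p @ map Ghost (rev q) @ [Ghost e, Vertex (tail E e)])"
      using path_word_gens[OF *(1)] q by (intro weq_append weq_refl)
    then have "weq ((path_word u p @ ghost_word v q) @ [Ghost e])
      (path_word u p @ ghost_word (tail E e) (e # q))" by (simp add: ghost_word_def)
    moreover have "awalk (tail E e) (e # q) w" using * True assms by (simp add: awalk_simps)
    ultimately show ?thesis using ghost_deg_eqv[OF ghost_deg_mon mon_weq] * by force
  next
    case False
    then have "wnull ((path_word u p @ map Ghost (rev q)) @ [Vertex v, Ghost e])"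
      using path_word_gens[OF *(1)] q v assms by (intro wnull_append(1) wnull_vertex_ghost) auto
    then show ?thesis by (simp add: ghost_deg.ideal mon_wnull ghost_word_def)
  qed
qed (simp add: assms)

text \<open>The last ghost letter of \<open>q\<^sup>*\<close> belongs to the first edge of
  \<open>q\<close>: it cancels against \<open>e\<close> or annihilates it. For empty
  \<open>q\<close> the edge prolongs \<open>p\<close> or is annihilated, which fits the truncated
  difference \<open>0 - 1 = 0\<close>.\<close>

lemma ghost_deg_mult_edge:
  assumes "x \<in> ghost_deg d" "e \<in> arcs E"
  shows "x * mon 1 [Edge e] \<in> ghost_deg (d - 1)"
proof (rule ghost_deg_mult[OF _ _ assms(1)])
  fix u p w v q r assume *: "awalk u p w" "awalk v q w" "length q \<le> d"
  have v: "v \<in> verts E" and q: "set (map Ghost (rev q)) \<subseteq> lpa_gens E"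
    using *(2) by (auto simp: awalk_def)
  have p: "set (path_word u p) \<subseteq> lpa_gens E" using path_word_gens[OF *(1)] .
  show "mon r ((path_word u p @ ghost_word v q) @ [Edge e]) \<in> ghost_deg (d - 1)"
  proof (cases q)
    case Nil
    then have w: "w = v" using * by (simp add: awalk_simps)
    show ?thesis
    proof (cases "tail E e = v")
      case True
      have walk: "awalk u (p @ [e]) (head E e)" using * w assms True by (auto simp: awalk_simps)
      have "weq (path_word u p @ [Vertex v, Edge e]) (path_word u p @ [Edge e])"
        using p assms True weq_relators(2)[of e] by (intro weq_append weq_refl) auto
      also have "path_word u p @ [Edge e] = path_word u (p @ [e])" by (simp add: path_word_def)
      also have "weq (path_word u (p @ [e])) (path_word u (p @ [e]) @ ghost_word (head E e) [])"
        using path_word_ghost_word_Nil[OF walk] by (rule weq_sym)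
      finally have "weq ((path_word u p @ ghost_word v q) @ [Edge e])
        (path_word u (p @ [e]) @ ghost_word (head E e) [])" by (simp add: Nil ghost_word_def)
      then show ?thesis
        using ghost_deg_eqv[OF ghost_deg_mon[OF walk, of "head E e" "[]"] mon_weq] assms
        by (force simp: awalk_simps)
    next
      case False
      then have "wnull (path_word u p @ [Vertex v, Edge e])"
        using p v assms by (intro wnull_append(1) wnull_vertex_edge) auto
      then show ?thesis by (simp add: ghost_deg.ideal mon_wnull ghost_word_def Nil)
    qed
  next
    case (Cons f q')
    have f: "f \<in> arcs E" "tail E f = v" "awalk (head E f) q' w"
      using * Cons by (auto simp: awalk_simps)
    have q': "set (map Ghost (rev q')) \<subseteq> lpa_gens E" using q Cons by auto
    have fe: "weq [Ghost f, Vertex v, Edge e] [Ghost f, Edge e]"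
      using weq_append[OF weq_relators(5)[of f] weq_refl[of "[Edge e]"]] f assms by simp
    show ?thesis
    proof (cases "e = f")
      case True
      have "weq [Ghost f, Vertex v, Edge e] [Vertex (head E f)]"
        using weq_trans[OF fe] weq_relators(6) f True by simp
      then have "weq (path_word u p @ map Ghost (rev q') @ [Ghost f, Vertex v, Edge e])
          (path_word u p @ map Ghost (rev q') @ [Vertex (head E f)])"
        using p q' by (intro weq_append weq_refl)
      then have "weq ((path_word u p @ ghost_word v q) @ [Edge e])
          (path_word u p @ ghost_word (head E f) q')"
        by (simp add: ghost_word_def Cons)
      moreover have "length q' \<le> d - 1" using *(3) Cons by simp
      ultimately show ?thesis using ghost_deg_eqv[OF ghost_deg_mon mon_weq] *(1) f(3) by blast
    next
      case False
      have "wnull [Ghost f, Vertex v, Edge e]"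
        using weq_wnull[OF fe] wnull_relators(2) f assms False by simp
      then have "wnull ((path_word u p @ map Ghost (rev q')) @ [Ghost f, Vertex v, Edge e])"
        using p q' by (intro wnull_append(1)) auto
      then show ?thesis by (simp add: ghost_deg.ideal mon_wnull ghost_word_def Cons)
    qed
  qed
qed (simp add: assms)

lemma word_ghost_deg:
  assumes "w \<noteq> []" "set w \<subseteq> lpa_gens E"
  shows "\<exists>d. mon r w \<in> ghost_deg d"
  using assms
proof (induction w rule: rev_nonempty_induct)
  case (single g)
  \<comment> \<open>A vertex is put in front of the single letter, since the multiplication lemmas
    need an element of known ghost degree to start from.\<close>
  obtain v where v: "v \<in> verts E" "weq [g] [Vertex v, g]"
  proof (cases g)
    case (Vertex v)
    then show ?thesis using that[of v] single weq_relators(1)[of v] weq_sym by simp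
  next
    case (Edge e)
    then show ?thesis using that[of "tail E e"] single weq_relators(2)[of e] weq_sym by simp
  next
    case (Ghost e)
    then show ?thesis using that[of "head E e"] single weq_relators(4)[of e] weq_sym by simp
  qed
  have "weq [Vertex v] (path_word v [] @ ghost_word v [])"
    using weq_relators(1) v weq_sym by (simp add: path_word_def ghost_word_def)
  then have base: "mon r [Vertex v] \<in> ghost_deg 0"
    using v ghost_deg_eqv[OF ghost_deg_mon mon_weq, of v "[]" v v "[]" 0]
    by (auto simp: awalk_simps)
  have "mon r [Vertex v] * mon 1 [g] \<in> ghost_deg 1"
  proof (cases g)
    case (Vertex v)
    then show ?thesis using single ghost_deg_mult_vertex[OF base] ghost_deg_mono by fastforce
  next
    case (Edge e)
    then show ?thesis using single ghost_deg_mult_edge[OF base] ghost_deg_mono by fastforce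
  next
    case (Ghost e)
    then show ?thesis using single ghost_deg_mult_ghost[OF base] by simp
  qed
  then have "mon r [Vertex v, g] \<in> ghost_deg 1" by (simp add: mon_mult)
  then show ?case using ghost_deg_eqv[OF _ mon_weq[OF v(2)]] by blast
next
  case (snoc g w)
  then obtain d where d: "mon r w \<in> ghost_deg d" by auto
  have "mon r w * mon 1 [g] \<in> ghost_deg (Suc d)"
  proof (cases g)
    case (Vertex v)
    then show ?thesis using snoc ghost_deg_mult_vertex[OF d] ghost_deg_mono[of _ d "Suc d"] by simp
  next
    case (Edge e)
    then show ?thesis using snoc ghost_deg_mult_edge[OF d] ghost_deg_mono[of _ "d - 1" "Suc d"] by simp
  next
    case (Ghost e)
    then show ?thesis using snoc ghost_deg_mult_ghost[OF d] by simp
  qed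
  then show ?case by (auto simp: mon_mult)
qed

lemma free_alg_ghost_deg:
  assumes "x \<in> free_alg E"
  shows "\<exists>d. x \<in> ghost_deg d"
proof (induction x rule: poly_mapping_single_induct)
  case zero
  show ?case using ghost_deg.ideal by auto
next
  case (add w r y)
  have "letters w \<noteq> []" "set (letters w) \<subseteq> lpa_gens E"
    using assms add(1) by (auto simp: free_alg_def)
  then obtain d1 d2 where "Poly_Mapping.single w r \<in> ghost_deg d1" "y \<in> ghost_deg d2"
    using word_ghost_deg[of "letters w" r] add by auto
  then have "Poly_Mapping.single w r \<in> ghost_deg (max d1 d2)" "y \<in> ghost_deg (max d1 d2)"
    by (auto elim!: ghost_deg_mono)
  then show ?case using ghost_deg_add by blast
qed

lemma ghost_deg_0_real:
  assumes "x \<in> ghost_deg 0"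
  shows "\<exists>c. Poly_Mapping.keys c \<subseteq> paths E \<and>
    x \<approx> lin (\<lambda>\<alpha> r. mon r (path_word (fst \<alpha>) (snd \<alpha>))) c"
  using assms
proof (induction rule: ghost_deg.induct)
  case (ideal x)
  then show ?case by (intro exI[of _ 0]) (auto simp: eqv_0_iff)
next
  case (add u p w v q x r)
  let ?L = "lin (\<lambda>\<alpha> r. mon r (path_word (fst \<alpha>) (snd \<alpha>)))"
  obtain c where c: "Poly_Mapping.keys c \<subseteq> paths E" "x \<approx> ?L c"
    using add by blast
  have q: "q = []" "v = w" using add by (auto simp: awalk_simps)
  have "?L (Poly_Mapping.single (u, p) r + c) = mon r (path_word u p) + ?L c"
    by (simp add: lin_add single_add lin_single)
  moreover have "mon r (path_word u p @ ghost_word v q) + x \<approx> mon r (path_word u p) + ?L c"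
    using add c q by (intro eqv_add mon_weq) (auto intro: path_word_ghost_word_Nil)
  moreover have "Poly_Mapping.keys (Poly_Mapping.single (u, p) r + c) \<subseteq> paths E"
    using c add keys_add[of "Poly_Mapping.single (u, p) r" c]
    by (auto simp: paths_def split: if_splits)
  ultimately show ?case by auto
qed

end

lemma (in wf_digraph) path_range_awalk: "awalk u p v \<Longrightarrow> path_range G (u, p) = v"
  by (auto simp: path_range_def awalk_def intro: cas_head_last)

section \<open>Cancelling an edge, truncated vertex relations, removal of ghost edges\<close>

context leavitt
begin

abbreviation real_part :: "('v \<times> 'e list \<Rightarrow>\<^sub>0 'r) \<Rightarrow> ('v, 'e, 'r) falg" where
  "real_part \<equiv> lin (\<lambda>\<alpha> r. mon r (path_word (fst \<alpha>) (snd \<alpha>)))"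

lemma real_part_mult:
  "real_part c * mon 1 w = (\<Sum>\<alpha>\<in>Poly_Mapping.keys c.
    mon (Poly_Mapping.lookup c \<alpha>) (path_word (fst \<alpha>) (snd \<alpha>) @ w))"
  by (simp add: lin_def sum_distrib_right mon_mult)

text \<open>Appending \<open>e\<close> is injective on real paths, so by
  \<open>paths_independent\<close> no path in a representation of \<open>y\<close> by real paths
  ends at the source of \<open>e\<close>.\<close>

lemma real_mult_edge_cancel:
  assumes y: "y \<in> ghost_deg 0" and e: "e \<in> arcs E" and ye: "y * mon 1 [Edge e] \<in> I"
  shows "y * mon 1 [Vertex (tail E e)] \<in> I"
proof -
  let ?v = "tail E e"
  obtain c where c: "Poly_Mapping.keys c \<subseteq> paths E" "y \<approx> real_part c"
    using ghost_deg_0_real[OF y] by blast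
  let ?K = "Poly_Mapping.keys c" and ?c = "Poly_Mapping.lookup c"
  define A where "A = {\<alpha> \<in> ?K. path_range E \<alpha> = ?v}"
  have walk: "awalk (fst \<alpha>) (snd \<alpha>) (path_range E \<alpha>)" if "\<alpha> \<in> ?K" for \<alpha>
    using c(1) that path_range_awalk by (cases \<alpha>) (fastforce simp: paths_def)
  have null: "wnull (path_word (fst \<alpha>) (snd \<alpha>) @ [Vertex ?v])" if "\<alpha> \<in> ?K - A" for \<alpha>
    using that e by (intro wnull_path_word_vertex[OF walk]) (auto simp: A_def)
  have "real_part c * mon 1 [Edge e] \<approx> (\<Sum>\<alpha>\<in>A. mon (?c \<alpha>) (path_word (fst \<alpha>) (snd \<alpha> @ [e])))"
  proof -
    have "(\<Sum>\<alpha>\<in>?K - A. mon (?c \<alpha>) (path_word (fst \<alpha>) (snd \<alpha>) @ [Edge e])) \<in> I"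
    proof (intro ideal_sum mon_wnull)
      fix \<alpha> assume \<alpha>: "\<alpha> \<in> ?K - A"
      have "weq (path_word (fst \<alpha>) (snd \<alpha>) @ [Edge e])
        (path_word (fst \<alpha>) (snd \<alpha>) @ [Vertex ?v, Edge e])"
        using \<alpha> path_word_gens[OF walk] weq_sym[OF weq_relators(2)[OF e]]
        by (intro weq_append weq_refl) auto
      moreover have "wnull ((path_word (fst \<alpha>) (snd \<alpha>) @ [Vertex ?v]) @ [Edge e])"
        by (rule wnull_append(2)[OF null[OF \<alpha>]]) (simp add: e)
      ultimately show "wnull (path_word (fst \<alpha>) (snd \<alpha>) @ [Edge e])"
        by (simp add: weq_wnull)
    qed
    moreover have "real_part c * mon 1 [Edge e]
      = (\<Sum>\<alpha>\<in>?K - A. mon (?c \<alpha>) (path_word (fst \<alpha>) (snd \<alpha>) @ [Edge e]))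
      + (\<Sum>\<alpha>\<in>A. mon (?c \<alpha>) (path_word (fst \<alpha>) (snd \<alpha> @ [e])))"
      unfolding real_part_mult by (subst sum.subset_diff[of A]) (auto simp: A_def path_word_def)
    ultimately show ?thesis by (simp add: eqv_def)
  qed
  moreover have "y * mon 1 [Edge e] \<approx> real_part c * mon 1 [Edge e]"
    using c e by (intro eqv_mult_right) auto
  ultimately have "(\<Sum>\<alpha>\<in>A. mon (?c \<alpha>) (path_word (fst \<alpha>) (snd \<alpha> @ [e]))) \<in> I"
    using ye eqv_ideal_iff by blast
  also have "(\<Sum>\<alpha>\<in>A. mon (?c \<alpha>) (path_word (fst \<alpha>) (snd \<alpha> @ [e])))
    = (\<Sum>\<alpha>\<in>(\<lambda>\<alpha>. (fst \<alpha>, snd \<alpha> @ [e])) ` A.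
        mon (?c (fst \<alpha>, butlast (snd \<alpha>))) (path_word (fst \<alpha>) (snd \<alpha>)))"
    by (subst sum.reindex) (auto simp: inj_on_def prod_eq_iff)
  finally have *: "?c (fst \<alpha>, butlast (snd \<alpha>)) = 0"
    if "\<alpha> \<in> (\<lambda>\<alpha>. (fst \<alpha>, snd \<alpha> @ [e])) ` A" for \<alpha>
  proof (rule paths_independent[OF _ _ _ that, rotated 2])
    show "finite ((\<lambda>\<alpha>. (fst \<alpha>, snd \<alpha> @ [e])) ` A)" by (simp add: A_def)
    fix u p assume "(u, p) \<in> (\<lambda>\<alpha>. (fst \<alpha>, snd \<alpha> @ [e])) ` A"
    then obtain \<alpha> where "\<alpha> \<in> A" "u = fst \<alpha>" "p = snd \<alpha> @ [e]" by auto
    moreover from this have "awalk (fst \<alpha>) (snd \<alpha>) ?v" using walk[of \<alpha>] by (simp add: A_def)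
    moreover have "awalk ?v [e] (head E e)" using e by (simp add: awalk_simps)
    ultimately show "\<exists>v. awalk u p v" using awalk_appendI by blast
  qed
  have "\<alpha> \<notin> A" for \<alpha>
  proof
    assume \<alpha>: "\<alpha> \<in> A"
    then have "?c \<alpha> = 0" using *[of "(fst \<alpha>, snd \<alpha> @ [e])"] by simp
    then show False using \<alpha> by (simp add: A_def in_keys_iff)
  qed
  then have "A = {}" by blast
  then have "real_part c * mon 1 [Vertex ?v] \<in> I"
    unfolding real_part_mult using null by (intro ideal_sum mon_wnull) auto
  moreover have "y * mon 1 [Vertex ?v] \<approx> real_part c * mon 1 [Vertex ?v]"
    using c e by (intro eqv_mult_right) auto
  ultimately show ?thesis using eqv_ideal_iff by blast
qed

lemma ideal_ualg: "x \<in> I \<Longrightarrow> x \<in> ualg E"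
  by (auto simp: I_eq intro: free_alg_ualg lpa_ideal_free_alg)

lemma ghost_deg_ualg: "x \<in> ghost_deg d \<Longrightarrow> x \<in> ualg E"
proof (induction rule: ghost_deg.induct)
  case (add u p w v q x r)
  then show ?case using nf_word_gens by (intro ualg_add ualg_mon) auto
qed (rule ideal_ualg)

text \<open>A truncation of the relation at \<open>v\<close> to a finite part \<open>F\<close> of
  its edges. It also makes sense at an infinite emitter, where the full relation does not
  exist.\<close>

definition gap :: "'v \<Rightarrow> 'e set \<Rightarrow> ('v, 'e, 'r) falg" where
  "gap v F = mon 1 [Vertex v] - (\<Sum>e\<in>F. mon 1 [Edge e, Ghost e])"

lemma gap_ualg: "\<lbrakk>v \<in> verts E; F \<subseteq> arcs E\<rbrakk> \<Longrightarrow> gap v F \<in> ualg E"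
  unfolding gap_def by (intro ualg_diff ualg_sum ualg_mon) auto

text \<open>For \<open>f\<close> in \<open>F\<close> the product reduces to
  \<open>f\<^sup>* - f\<^sup>* f f\<^sup>* = 0\<close>; otherwise \<open>f\<close> does not start at
  \<open>v\<close> and every term vanishes.\<close>

lemma ghost_mult_gap:
  assumes f: "f \<in> arcs E" and v: "v \<in> verts E" and F: "finite F" "F \<subseteq> {e \<in> arcs E. tail E e = v}"
    and fF: "tail E f = v \<Longrightarrow> f \<in> F"
  shows "mon r [Ghost f] * gap v F \<in> I"
proof -
  have "mon r [Ghost f] * gap v F = mon r [Ghost f, Vertex v] - (\<Sum>e\<in>F. mon r [Ghost f, Edge e, Ghost e])"
    by (simp add: gap_def right_diff_distrib sum_distrib_left mon_mult)
  also have "\<dots> \<approx> (if f \<in> F then mon r [Ghost f] else 0) - (\<Sum>e\<in>F. if f = e then mon r [Ghost f] else 0)"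
  proof (intro eqv_diff eqv_sum)
    show "mon r [Ghost f, Vertex v] \<approx> (if f \<in> F then mon r [Ghost f] else 0)"
    proof (cases "tail E f = v")
      case True
      then show ?thesis using fF weq_relators(5)[OF f] by (simp add: mon_weq)
    next
      case False
      then have "f \<notin> F" using F by auto
      moreover have "wnull [Ghost f, Vertex v]"
      proof (rule weq_wnull)
        show "weq [Ghost f, Vertex v] ([Ghost f, Vertex (tail E f)] @ [Vertex v])"
          using weq_append[OF weq_sym[OF weq_relators(5)[OF f]] weq_refl[of "[Vertex v]"]] v by simp
        show "wnull ([Ghost f, Vertex (tail E f)] @ [Vertex v])"
          using wnull_Cons[OF wnull_relators(1)[of "tail E f" v]] f v False by simp
      qed
      ultimately show ?thesis by (simp add: mon_wnull eqv_0_iff)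
    qed
    fix e assume "e \<in> F"
    then have e: "e \<in> arcs E" using F by auto
    show "mon r [Ghost f, Edge e, Ghost e] \<approx> (if f = e then mon r [Ghost f] else 0)"
    proof (cases "f = e")
      case True
      have "weq ([Ghost f, Edge e] @ [Ghost e]) ([Vertex (head E f)] @ [Ghost e])"
        using True f weq_relators(6) by (intro weq_append weq_refl) auto
      also have "weq ([Vertex (head E f)] @ [Ghost e]) [Ghost f]" using True f weq_relators(4) by simp
      finally show ?thesis using True by (simp add: mon_weq)
    next
      case False
      then have "wnull ([Ghost f, Edge e] @ [Ghost e])"
        using f e by (intro wnull_append(2) wnull_relators) auto
      then show ?thesis using False by (simp add: mon_wnull eqv_0_iff)
    qed
  qed
  also have "\<dots> = 0" using F by simp
  finally show ?thesis by (simp add: eqv_0_iff)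
qed

text \<open>As soon as \<open>F\<close> contains those first edges of the \<open>q\<close> in the
  terms \<open>p q\<^sup>*\<close> that start at \<open>v\<close>, the gap kills all terms with
  nonempty \<open>q\<close>, and \<open>y\<close> collects the rest. Quantifying over all larger
  \<open>F'\<close> lets the induction enlarge \<open>F\<close> term by term.\<close>

lemma ghost_deg_gap:
  assumes "x \<in> ghost_deg d" and v: "v \<in> verts E"
  shows "\<exists>F y. finite F \<and> F \<subseteq> {e \<in> arcs E. tail E e = v} \<and> y \<in> ghost_deg 0 \<and>
    (\<forall>F'. finite F' \<and> F \<subseteq> F' \<and> F' \<subseteq> {e \<in> arcs E. tail E e = v} \<longrightarrow> x * gap v F' \<approx> y * gap v F')"
  using assms(1)
proof (induction rule: ghost_deg.induct)
  case (ideal x)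
  have "x * gap v F' \<approx> 0 * gap v F'" if "F' \<subseteq> {e \<in> arcs E. tail E e = v}" for F'
    using ideal that v by (simp add: eqv_0_iff) (intro ideal_mult_right gap_ualg, auto)
  then show ?case by (intro exI[of _ "{}"] exI[of _ 0]) (simp add: ghost_deg.ideal)
next
  case (add u p w v' q x r)
  from add.IH obtain F y where F: "finite F" "F \<subseteq> {e \<in> arcs E. tail E e = v}" "y \<in> ghost_deg 0"
    and y': "\<forall>F'. finite F' \<and> F \<subseteq> F' \<and> F' \<subseteq> {e \<in> arcs E. tail E e = v} \<longrightarrow>
      x * gap v F' \<approx> y * gap v F'"
    by (elim exE conjE) (rule that)
  have y: "x * gap v F' \<approx> y * gap v F'"
    if "finite F'" "F \<subseteq> F'" "F' \<subseteq> {e \<in> arcs E. tail E e = v}" for F'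
    using y' that by simp
  let ?m = "mon r (path_word u p @ ghost_word v' q)"
  show ?case
  proof (cases q)
    case Nil
    have "?m + y \<in> ghost_deg 0" using add Nil F(3) by (intro ghost_deg.add) auto
    moreover have "(?m + x) * gap v F' \<approx> (?m + y) * gap v F'"
      if "finite F'" "F \<subseteq> F'" "F' \<subseteq> {e \<in> arcs E. tail E e = v}" for F'
      using y[OF that] by (simp add: distrib_right eqv_add)
    ultimately show ?thesis using F(1,2)
      by (intro exI[of _ F] exI[of _ "?m + y"] conjI allI impI) auto
  next
    case (Cons f q')
    have f: "f \<in> arcs E" "tail E f = v'" and gens: "set (map Ghost (rev q')) \<subseteq> lpa_gens E"
      using add(2) Cons arcs_gens[OF add(2)] by (auto simp: awalk_simps)
    let ?F = "F \<union> {e. e = f \<and> tail E f = v}"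
    have "(?m + x) * gap v F' \<approx> y * gap v F'"
      if F': "finite F'" "?F \<subseteq> F'" "F' \<subseteq> {e \<in> arcs E. tail E e = v}" for F'
    proof -
      let ?w = "path_word u p @ map Ghost (rev q')"
      have w: "set ?w \<subseteq> lpa_gens E" using path_word_gens[OF add(1)] gens by simp
      have gap: "gap v F' \<in> ualg E" using F' v by (intro gap_ualg) auto
      have "weq (?w @ [Ghost f, Vertex v']) (?w @ [Ghost f])"
        using w f weq_relators(5)[of f] by (intro weq_append weq_refl) auto
      then have "?m \<approx> mon r (?w @ [Ghost f])"
        using mon_weq by (simp add: Cons ghost_word_def)
      then have "?m * gap v F' \<approx> mon r (?w @ [Ghost f]) * gap v F'"
        using gap by (intro eqv_mult_right)
      also have "mon r (?w @ [Ghost f]) * gap v F' = mon r ?w * (mon 1 [Ghost f] * gap v F')"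
        by (simp add: mult.assoc[symmetric] mon_mult)
      finally have "?m * gap v F' \<approx> mon r ?w * (mon 1 [Ghost f] * gap v F')" .
      moreover have "mon r ?w * (mon 1 [Ghost f] * gap v F') \<in> I"
        using w f v F' by (intro ideal_mult_left ghost_mult_gap) auto
      ultimately have "?m * gap v F' \<approx> 0" using eqv_ideal_iff eqv_0_iff by blast
      moreover have "x * gap v F' \<approx> y * gap v F'" using F' by (intro y) auto
      ultimately show ?thesis using eqv_add[of "?m * gap v F'" 0] by (simp add: distrib_right)
    qed
    moreover have "finite ?F" "?F \<subseteq> {e \<in> arcs E. tail E e = v}" using F f by auto
    ultimately show ?thesis using F(3)
      by (intro exI[of _ ?F] exI[of _ y] conjI allI impI) auto
  qed
qed

text \<open>
  If \<open>x v \<notin> I\<close> but \<open>x e \<in> I\<close> for all edges \<open>e\<close> starting at \<open>v\<close>, then \<open>x v\<close> agrees with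
  \<open>x (v - \<Sum>\<^sub>F e e\<^sup>*)\<close>, which depends only on the real part of \<open>x\<close> once \<open>F\<close> is large enough.
\<close>

lemma stuck_at_vertex:
  assumes x: "x \<in> ghost_deg d" and v: "v \<in> verts E" and xv: "x * mon 1 [Vertex v] \<notin> I"
    and xe: "\<And>e. e \<in> arcs E \<Longrightarrow> tail E e = v \<Longrightarrow> x * mon 1 [Edge e] \<in> I"
  shows "x * mon 1 [Vertex v] \<in> ghost_deg 0"
proof -
  let ?out = "{e \<in> arcs E. tail E e = v}"
  obtain F y where F: "finite F" "F \<subseteq> ?out" and y: "y \<in> ghost_deg 0"
    and xy: "x * gap v F \<approx> y * gap v F"
    using ghost_deg_gap[OF x v] by (elim exE conjE) (rule that, assumption+, simp)
  have "x * (mon 1 [Edge e] * mon 1 [Ghost e]) \<in> I" if "e \<in> ?out" for e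
    using ideal_mult_right[OF xe[of e], of "mon 1 [Ghost e]"] that by (simp add: mult.assoc)
  then have sum: "(\<Sum>e\<in>A. x * mon 1 [Edge e, Ghost e]) \<in> I" if "A \<subseteq> ?out" for A
    using that by (intro ideal_sum) (auto simp: mon_mult)
  then have x_gap: "x * mon 1 [Vertex v] \<approx> x * gap v F"
    using F by (simp add: gap_def right_diff_distrib sum_distrib_left eqv_def)
  \<comment> \<open>If all edges at \<open>v\<close> lie in the finite set \<open>F\<close>, then
    \<open>v\<close> is a sink or regular. An edge \<open>e\<close> outside \<open>F\<close>
    satisfies \<open>gap v F * e = e\<close>, so \<open>y e\<close> agrees with \<open>x e\<close>
    and vanishes; then \<open>y v\<close> and finally \<open>x v\<close> vanish, against
    \<open>xv\<close>.\<close>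
  consider "?out = {}" | "regular_vertex E v" | e where "e \<in> ?out" "e \<notin> F"
  proof -
    have "regular_vertex E v" if "?out \<noteq> {}" "?out \<subseteq> F"
      using that F v finite_subset by (auto simp: regular_vertex_def)
    then show ?thesis using that by blast
  qed
  then show ?thesis
  proof cases
    case 1
    then have "F = {}" using F(2) by blast
    then have "gap v F = mon 1 [Vertex v]" by (simp add: gap_def)
    then have "x * mon 1 [Vertex v] \<approx> y * mon 1 [Vertex v]" using xy by simp
    then show ?thesis using ghost_deg_eqv[OF ghost_deg_mult_vertex[OF y v]] by blast
  next
    case 2
    have "x * mon 1 [Vertex v] \<approx> x * (\<Sum>e\<in>?out. mon 1 [Edge e, Ghost e])"
      using ghost_deg_ualg[OF x] eqv_regular[OF 2] by (rule eqv_mult_left)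
    then have "x * mon 1 [Vertex v] \<in> I"
      using sum[of ?out] eqv_ideal_iff by (simp add: sum_distrib_left)
    with xv show ?thesis by simp
  next
    case 3
    have e: "e \<in> arcs E" "tail E e = v" using 3 by auto
    have y_ualg: "y \<in> ualg E" using ghost_deg_ualg[OF y] .
    have gap: "gap v F \<in> ualg E" using F v by (intro gap_ualg) auto
    have gap_e: "gap v F * mon 1 [Edge e] \<approx> mon 1 [Edge e]"
    proof -
      have "(\<Sum>f\<in>F. mon 1 [Edge f, Ghost f] * mon 1 [Edge e]) \<in> I"
      proof (intro ideal_sum)
        fix f assume "f \<in> F"
        then have "wnull ([Edge f] @ [Ghost f, Edge e])"
          using F e 3 by (intro wnull_append(1) wnull_relators) auto
        then show "mon 1 [Edge f, Ghost f] * mon 1 [Edge e] \<in> I" by (simp add: mon_mult mon_wnull)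
      qed
      moreover have "mon 1 [Vertex v] * mon 1 [Edge e] \<approx> mon 1 [Edge e]"
        using mon_weq[OF weq_relators(2)[OF e(1)], of 1] e by (simp add: mon_mult)
      ultimately have "mon 1 [Vertex v] * mon 1 [Edge e]
          - (\<Sum>f\<in>F. mon 1 [Edge f, Ghost f] * mon 1 [Edge e]) \<approx> mon 1 [Edge e] - 0"
        by (intro eqv_diff) (simp_all add: eqv_0_iff)
      then show ?thesis by (simp add: gap_def left_diff_distrib sum_distrib_right)
    qed
    have "y * mon 1 [Edge e] \<approx> y * (gap v F * mon 1 [Edge e])"
      using eqv_sym[OF gap_e] by (rule eqv_mult_left[OF y_ualg])
    also have "\<dots> = y * gap v F * mon 1 [Edge e]" by (simp add: mult.assoc)
    also have "\<dots> \<approx> x * gap v F * mon 1 [Edge e]"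
      by (rule eqv_mult_right[OF eqv_sym[OF xy]]) (simp add: e)
    also have "\<dots> = x * (gap v F * mon 1 [Edge e])" by (simp add: mult.assoc)
    also have "\<dots> \<approx> x * mon 1 [Edge e]"
      using gap_e by (rule eqv_mult_left[OF ghost_deg_ualg[OF x]])
    finally have "y * mon 1 [Edge e] \<in> I" using xe[OF e] eqv_ideal_iff by blast
    then have "y * mon 1 [Vertex v] \<in> I" using real_mult_edge_cancel[OF y e(1)] e by simp
    then have "y * mon 1 [Vertex v] * gap v F \<in> I" using gap by (rule ideal_mult_right)
    moreover have "mon 1 [Vertex v] * gap v F \<approx> gap v F"
      unfolding gap_def right_diff_distrib sum_distrib_left
    proof (intro eqv_diff eqv_sum)
      show "mon 1 [Vertex v] * mon 1 [Vertex v] \<approx> mon 1 [Vertex v]"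
        using mon_weq[OF weq_relators(1)[OF v], of 1] by (simp add: mon_mult)
      fix f assume "f \<in> F"
      then have f: "f \<in> arcs E" "tail E f = v" using F by auto
      have "weq ([Vertex v, Edge f] @ [Ghost f]) ([Edge f] @ [Ghost f])"
        using f weq_relators(2)[of f] by (intro weq_append weq_refl) auto
      then show "mon 1 [Vertex v] * mon 1 [Edge f, Ghost f] \<approx> mon 1 [Edge f, Ghost f]"
        using mon_weq by (simp add: mon_mult)
    qed
    then have "y * (mon 1 [Vertex v] * gap v F) \<approx> y * gap v F" by (rule eqv_mult_left[OF y_ualg])
    ultimately have "y * gap v F \<in> I" using eqv_ideal_iff by (simp add: mult.assoc)
    then have "x * mon 1 [Vertex v] \<in> I" using eqv_ideal_iff[OF eqv_trans[OF x_gap xy]] by simp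
    with xv show ?thesis by simp
  qed
qed

text \<open>An edge at \<open>v\<close> with \<open>x e \<notin> I\<close> lowers the ghost degree,
  and the induction continues at its range. If there is none, \<open>x v\<close> is already real by
  \<open>stuck_at_vertex\<close>.\<close>

lemma reduce_to_real:
  assumes "x \<in> ghost_deg d" "v \<in> verts E" "x * mon 1 [Vertex v] \<notin> I"
  shows "\<exists>p w. awalk v p w \<and> x * mon 1 (path_word v p) \<in> ghost_deg 0 - I"
  using assms
proof (induction d arbitrary: x v)
  case 0
  then have "x * mon 1 (path_word v []) \<in> ghost_deg 0 - I"
    using ghost_deg_mult_vertex by (simp add: path_word_def)
  moreover have "awalk v [] v" using 0 by (simp add: awalk_simps)
  ultimately show ?case by blast
next
  case (Suc d)
  show ?case
  proof (cases "\<exists>e\<in>arcs E. tail E e = v \<and> x * mon 1 [Edge e] \<notin> I")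
    case False
    then have "x * mon 1 (path_word v []) \<in> ghost_deg 0 - I"
      using stuck_at_vertex[OF Suc.prems] Suc.prems by (simp add: path_word_def)
    moreover have "awalk v [] v" using Suc by (simp add: awalk_simps)
    ultimately show ?thesis by blast
  next
    case True
    then obtain e where e: "e \<in> arcs E" "tail E e = v" "x * mon 1 [Edge e] \<notin> I" by blast
    have x: "x \<in> ualg E" using ghost_deg_ualg Suc.prems by blast
    have "x * mon 1 [Edge e, Vertex (head E e)] \<approx> x * mon 1 [Edge e]"
      using weq_relators(3)[OF e(1)] by (intro eqv_mult_left[OF x] mon_weq)
    then have "x * mon 1 [Edge e] * mon 1 [Vertex (head E e)] \<notin> I"
      using e(3) eqv_ideal_iff by (simp add: mult.assoc mon_mult)
    moreover have "x * mon 1 [Edge e] \<in> ghost_deg d"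
      using ghost_deg_mult_edge[OF Suc.prems(1) e(1)] by simp
    ultimately obtain p w where p: "awalk (head E e) p w"
      "x * mon 1 [Edge e] * mon 1 (path_word (head E e) p) \<in> ghost_deg 0 - I"
      using Suc.IH[of "x * mon 1 [Edge e]" "head E e"] e(1) by auto
    have walk: "awalk v (e # p) w" using p e by (simp add: awalk_simps)
    have "weq ([Vertex v, Edge e] @ map Edge p) ([Edge e] @ map Edge p)"
      using e weq_relators(2)[of e] arcs_gens[OF p(1)] by (intro weq_append weq_refl) auto
    also have "weq ([Edge e] @ map Edge p) ([Edge e, Vertex (head E e)] @ map Edge p)"
      using weq_sym[OF weq_relators(3)[OF e(1)]] arcs_gens[OF p(1)] by (intro weq_append weq_refl) auto
    finally have "weq (path_word v (e # p)) ([Edge e] @ path_word (head E e) p)"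
      by (simp add: path_word_def)
    then have "x * mon 1 (path_word v (e # p)) \<approx> x * mon 1 ([Edge e] @ path_word (head E e) p)"
      by (intro eqv_mult_left[OF x] mon_weq)
    also have "\<dots> = x * mon 1 [Edge e] * mon 1 (path_word (head E e) p)"
      by (simp add: mult.assoc mon_mult)
    finally have "x * mon 1 (path_word v (e # p)) \<in> ghost_deg 0 - I"
      using p(2) ghost_deg_eqv eqv_ideal_iff by blast
    with walk show ?thesis by blast
  qed
qed

text \<open>The ghost of a path of minimal length in the support is multiplied from the left.\<close>

lemma reduce_to_closed:
  assumes c: "Poly_Mapping.keys c \<subseteq> paths E" and nz: "real_part c \<notin> I"
  shows "\<exists>u p w B d. awalk u p w \<and> finite B \<and> [] \<in> B \<and> d [] \<noteq> 0 \<and> (\<forall>q\<in>B. awalk w q w) \<and>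
    mon 1 (ghost_word u p) * real_part c * mon 1 [Vertex w] \<approx> (\<Sum>q\<in>B. mon (d q) (path_word w q))"
proof -
  let ?K = "Poly_Mapping.keys c" and ?c = "Poly_Mapping.lookup c"
  have "?K \<noteq> {}" using nz by (auto simp: lin_def)
  then obtain \<alpha> where \<alpha>: "\<alpha> \<in> ?K" and min: "\<And>\<beta>. \<beta> \<in> ?K \<Longrightarrow> length (snd \<alpha>) \<le> length (snd \<beta>)"
    using ex_min_if_finite[of "(\<lambda>\<beta>. length (snd \<beta>)) ` ?K"] by fastforce
  obtain u p where up: "\<alpha> = (u, p)" by (cases \<alpha>)
  then obtain w where w: "awalk u p w" using \<alpha> c by (auto simp: paths_def)
  \<comment> \<open>The ghost of \<open>p\<close> strips the prefix \<open>p\<close> and kills the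
    paths without it; this uses that no path of the support is shorter than \<open>p\<close>. The
    vertex \<open>w\<close> on the right keeps only the paths that end at \<open>w\<close>, so
    closed walks remain.\<close>
  define B where "B = {q. (u, p @ q) \<in> ?K \<and> awalk w q w}"
  have "(\<lambda>q. (u, p @ q)) ` B \<subseteq> ?K" by (auto simp: B_def)
  then have fin: "finite B"
    by (rule finite_imageD[OF finite_subset]) (auto simp: inj_on_def)
  have Nil: "[] \<in> B" using \<alpha> up w by (auto simp: B_def awalk_simps)
  define A where "A = (\<lambda>q. (u, p @ q)) ` B"
  have A: "A \<subseteq> ?K" by (auto simp: A_def B_def)
  let ?t = "\<lambda>\<beta>. ghost_word u p @ path_word (fst \<beta>) (snd \<beta>) @ [Vertex w]"
  have null: "wnull (?t \<beta>)" if \<beta>: "\<beta> \<in> ?K - A" for \<beta>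
  proof -
    obtain u' p' w' where \<beta>': "\<beta> = (u', p')" "awalk u' p' w'"
      using c \<beta> by (cases \<beta>) (auto simp: paths_def)
    have len: "length p \<le> length p'" using min[of \<beta>] \<beta> \<beta>' up by simp
    show ?thesis
    proof (cases "w = w'")
      case False
      then have "wnull (path_word u' p' @ [Vertex w])"
        using w by (intro wnull_path_word_vertex[OF \<beta>'(2)]) auto
      then show ?thesis using ghost_word_gens[OF w] \<beta>' by (simp add: wnull_append(1))
    next
      case True
      have "u \<noteq> u' \<or> take (length p) p' \<noteq> p"
      proof (rule ccontr)
        assume "\<not> ?thesis"
        then have u': "u' = u" and p': "p' = p @ drop (length p) p'"
          by (auto, metis append_take_drop_id)
        moreover have "awalk w (drop (length p) p') w"
          using \<beta>'(2) w True u' p' by (metis awalk_append_iff awalk_ends)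
        ultimately have "drop (length p) p' \<in> B" using \<beta> \<beta>' by (auto simp: B_def)
        then have "\<beta> \<in> A" unfolding A_def \<beta>'(1) u' using p' by blast
        then show False using \<beta> by simp
      qed
      then have "wnull ((ghost_word u p @ path_word u' p') @ [Vertex w])"
        using w len by (intro wnull_append(2)[OF wnull_ghost_word_path_word[OF w \<beta>'(2)]]) auto
      then show ?thesis using \<beta>' by simp
    qed
  qed
  have eq: "weq (?t (u, p @ q)) (path_word w q)" if "q \<in> B" for q
  proof -
    have q: "awalk w q w" using that by (simp add: B_def)
    have "weq (path_word u (p @ q) @ [Vertex w]) (path_word u (p @ q))"
      using w q by (intro path_word_vertex) auto
    then have "weq (?t (u, p @ q)) (ghost_word u p @ path_word u (p @ q))"
      using ghost_word_gens[OF w] by (simp add: weq_append weq_refl)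
    also have "weq \<dots> (path_word w q)" using ghost_word_path_word[OF w q] .
    finally show ?thesis .
  qed
  have "mon 1 (ghost_word u p) * real_part c * mon 1 [Vertex w] = (\<Sum>\<beta>\<in>?K. mon (?c \<beta>) (?t \<beta>))"
    by (simp add: lin_def sum_distrib_left sum_distrib_right mon_mult mult.assoc)
  also have "\<dots> = (\<Sum>\<beta>\<in>?K - A. mon (?c \<beta>) (?t \<beta>)) + (\<Sum>\<beta>\<in>A. mon (?c \<beta>) (?t \<beta>))"
    by (intro sum.subset_diff A) simp
  also have "\<dots> \<approx> 0 + (\<Sum>\<beta>\<in>A. mon (?c \<beta>) (?t \<beta>))"
  proof (rule eqv_add[OF _ eqv_refl])
    show "(\<Sum>\<beta>\<in>?K - A. mon (?c \<beta>) (?t \<beta>)) \<approx> 0"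
      unfolding eqv_0_iff using null by (intro ideal_sum mon_wnull)
  qed
  also have "0 + (\<Sum>\<beta>\<in>A. mon (?c \<beta>) (?t \<beta>)) = (\<Sum>q\<in>B. mon (?c (u, p @ q)) (?t (u, p @ q)))"
    unfolding A_def by (subst sum.reindex) (auto simp: inj_on_def)
  also have "\<dots> \<approx> (\<Sum>q\<in>B. mon (?c (u, p @ q)) (path_word w q))"
    using eq by (intro eqv_sum mon_weq)
  finally show ?thesis using w fin Nil \<alpha> up
    by (intro exI[of _ u] exI[of _ p] exI[of _ w] exI[of _ B] exI[of _ "\<lambda>q. ?c (u, p @ q)"])
      (auto simp: B_def in_keys_iff)
qed

end

section \<open>Reduction to a vertex or to a cycle without exits\<close>

abbreviation list_pow :: "nat \<Rightarrow> 'e list \<Rightarrow> 'e list" where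
  "list_pow n q \<equiv> concat (replicate n q)"

lemma list_pow_Suc_right: "list_pow (Suc n) q = list_pow n q @ q"
  using replicate_add[of n 1 q] by simp

lemma length_list_pow: "length (list_pow n q) = n * length q"
  by (induction n) auto

lemma inj_list_pow: "q \<noteq> [] \<Longrightarrow> inj (\<lambda>k. list_pow k q)"
  by (intro injI) (metis length_list_pow length_greater_0_conv mult_cancel2 not_gr_zero)

text \<open>
  Suppose \<open>t = q\<^sub>0\<^sup>n q\<^sub>1 e\<close> were a prefix of \<open>q t\<close>. Then \<open>t\<close> has period \<open>b = |q|\<close> and, up to its last
  letter at position \<open>N\<close>, also the period \<open>a = |q\<^sub>0|\<close>, whence
  \<open>e = t\<^sub>N = t\<^sub>N\<^sub>-\<^sub>b = t\<^sub>N\<^sub>-\<^sub>b\<^sub>-\<^sub>a = t\<^sub>N\<^sub>-\<^sub>a = f\<close>.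
\<close>

lemma exit_breaks_periodicity:
  fixes q q0 q1 q2 :: "'e list"
  assumes q0: "q0 = q1 @ f # q2" and ef: "e \<noteq> f" and q: "q \<noteq> []" "length q < n"
  defines "t \<equiv> list_pow n q0 @ q1 @ [e]"
  shows "take (length t) (q @ t) \<noteq> t"
proof
  assume eq: "take (length t) (q @ t) = t"
  define a b N where "a = length q0" and "b = length q" and "N = length t - 1"
  obtain m where n: "n = Suc m" using q by (cases n) auto
  have lt: "length t = Suc N" "N = m * a + a + length q1"
    by (simp_all add: N_def t_def length_list_pow a_def n)
  have pos: "0 < a" "0 < b" "b \<le> m" using q0 q n by (auto simp: a_def b_def)
  then have "b * 1 \<le> m * a" by (intro mult_le_mono) auto
  then have N: "a + b \<le> N" using lt by simp
  have per_b: "t ! i = t ! (i - b)" if "b \<le> i" "i \<le> N" for i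
  proof -
    have "t ! i = take (length t) (q @ t) ! i" using eq by simp
    also have "\<dots> = t ! (i - b)" using that lt by (simp add: nth_append b_def)
    finally show ?thesis .
  qed
  \<comment> \<open>\<open>X\<close> is \<open>t\<close> without its first block \<open>q0\<close>
    and its last letter, and it is also an initial segment of \<open>t\<close>, followed there by
    \<open>f\<close>. Comparing both readings gives the period \<open>a\<close> below position
    \<open>N\<close>.\<close>
  define X where "X = list_pow m q0 @ q1"
  have X1: "t = q0 @ X @ [e]" by (simp add: t_def X_def n)
  have X2: "t = X @ f # q2 @ q1 @ [e]"
    using list_pow_Suc_right[of m q0] by (simp add: t_def X_def n q0)
  have lX: "length X = N - a" using lt by (simp add: X_def length_list_pow a_def)
  have per_a: "t ! i = t ! (i - a)" if "a \<le> i" "i < N" for i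
  proof -
    have l: "i - a < length X" using that lX by simp
    then have "t ! i = X ! (i - a)" using that by (simp add: X1 nth_append a_def)
    also have "\<dots> = t ! (i - a)" using l by (simp add: X2 nth_append)
    finally show ?thesis .
  qed
  have "e = t ! N" using lX N by (simp add: X1 nth_append a_def)
  also have "\<dots> = t ! (N - b)" using N by (intro per_b) auto
  also have "\<dots> = t ! (N - b - a)" using N pos by (intro per_a) auto
  also have "\<dots> = t ! (N - a - b)" by (simp add: add.commute)
  also have "\<dots> = t ! (N - a)" using N by (intro per_b[symmetric]) auto
  also have "\<dots> = f" using lX by (simp add: X2 nth_append)
  finally show False using ef by simp
qed

context wf_digraph
begin

lemma awalk_list_pow: "awalk w q w \<Longrightarrow> awalk w (list_pow n q) w"
  by (induction n) (auto simp: awalk_Nil_iff)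

text \<open>Cutting at a repeated source leaves a shorter closed walk over a subset of the edges; it
  is nonempty because the second of the two edges is kept.\<close>

lemma exitless_cycle_exists:
  assumes "awalk w q w" "q \<noteq> []"
    and "\<And>e f. \<lbrakk>e \<in> arcs G; f \<in> set q; tail G e = tail G f\<rbrakk> \<Longrightarrow> e = f"
  shows "\<exists>c. exitless_cycle G c \<and> awalk w c w"
  using assms
proof (induction "length q" arbitrary: q rule: less_induct)
  case less
  show ?case
  proof (cases "distinct (map (tail G) q)")
    case True
    then have "exitless_cycle G q"
      using less.prems unfolding exitless_cycle_def
      by (auto simp: cycle_iff_distinct_sources[OF less.prems(1)])
    then show ?thesis using less.prems by blast
  next
    case False
    then obtain xs y ys zs where "map (tail G) q = xs @ [y] @ ys @ [y] @ zs"
      using not_distinct_decomp by blast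
    then obtain p1 e1 p2 e2 p3 where q: "q = p1 @ e1 # p2 @ e2 # p3" "tail G e1 = y" "tail G e2 = y"
      by (auto simp: map_eq_append_conv map_eq_Cons_conv append_eq_map_conv Cons_eq_map_conv)
    let ?q = "p1 @ e2 # p3"
    have "awalk w ?q w" using less.prems(1) q by (auto simp: awalk_simps)
    then show ?thesis using less.hyps[of ?q] less.prems(3) q by auto
  qed
qed

text \<open>Without exits a walk along the cycle is determined by its start and length, so one of
  \<open>q\<close> and \<open>c\<close> is a prefix of the other. A copy of \<open>c\<close> is
  split off from a longer \<open>q\<close>; a shorter nonempty \<open>q\<close> would let
  \<open>c\<close> return to \<open>w\<close> too early, against its distinct sources.\<close>

lemma closed_walk_power:
  assumes c: "exitless_cycle G c" "awalk w c w" and "awalk w q w"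
  shows "\<exists>k. q = list_pow k c"
  using assms(3)
proof (induction "length q" arbitrary: q rule: less_induct)
  case less
  have exitless: "e = f" if "e \<in> arcs G" "f \<in> set c" "tail G e = tail G f" for e f
    using c(1) that by (auto simp: exitless_cycle_def)
  have ne: "c \<noteq> []" and dist: "distinct (map (tail G) c)"
    using c cycle_iff_distinct_sources[OF c(2)] by (auto simp: exitless_cycle_def)
  show ?case
  proof (cases "q = []")
    case True
    then show ?thesis by (intro exI[of _ 0]) simp
  next
    case False
    show ?thesis
    proof (cases "length c \<le> length q")
      case True
      have "\<exists>d. q = c @ d"
        using c(2) less.prems exitless True by (intro exitless_cycle_prefix[of G w c w q w])
          (auto simp: awalk_def)
      then obtain d where d: "q = c @ d" by blast
      then have "awalk w d w" using less.prems c(2) by (auto dest: awalk_ends)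
      then obtain k where "d = list_pow k c" using less.hyps[of d] d ne by auto
      then show ?thesis using d by (intro exI[of _ "Suc k"]) simp
    next
      case len: False
      have "\<exists>d. c = q @ d"
        using c(2) less.prems len exitless by (intro exitless_cycle_prefix[of G w q w c w])
          (auto simp: awalk_def, metis subsetD)
      then obtain d where d: "c = q @ d" by blast
      then have "awalk w d w" using less.prems c(2) by (auto dest: awalk_ends)
      moreover have "d \<noteq> []" using d len by auto
      ultimately have "tail G (hd d) = w" by (cases d) (auto simp: awalk_simps)
      moreover have "tail G (hd q) = w" using less.prems False by (cases q) (auto simp: awalk_simps)
      ultimately show ?thesis using dist d \<open>d \<noteq> []\<close> False by (cases d; cases q) auto
    qed
  qed
qed

end

context leavitt
begin

text \<open>\<open>t\<^sup>* q t\<close> vanishes unless \<open>t\<close> is a prefix of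
  \<open>q t\<close>, and the trivial walk leaves \<open>t\<^sup>* t = v\<close>.\<close>

lemma sandwich_closed_walks:
  assumes B: "finite B" "[] \<in> B" "\<And>q. q \<in> B \<Longrightarrow> awalk w q w" and t: "awalk w t v"
    and null: "\<And>q. \<lbrakk>q \<in> B; q \<noteq> []\<rbrakk> \<Longrightarrow> take (length t) (q @ t) \<noteq> t"
  shows "mon 1 (ghost_word w t) * (\<Sum>q\<in>B. mon (d q) (path_word w q)) * mon 1 (path_word w t)
    \<approx> mon (d []) [Vertex v]"
proof -
  have "mon 1 (ghost_word w t) * (\<Sum>q\<in>B. mon (d q) (path_word w q)) * mon 1 (path_word w t)
    = (\<Sum>q\<in>B. mon (d q) (ghost_word w t @ path_word w q @ path_word w t))"
    by (simp add: sum_distrib_left sum_distrib_right mon_mult)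
  also have "\<dots> \<approx> (\<Sum>q\<in>B. if q = [] then mon (d q) [Vertex v] else 0)"
  proof (rule eqv_sum)
    fix q assume q: "q \<in> B"
    have walk: "awalk w (q @ t) v" using B(3)[OF q] t by auto
    have "weq (ghost_word w t @ path_word w q @ path_word w t) (ghost_word w t @ path_word w (q @ t))"
      using path_word_append[OF B(3)[OF q] t] ghost_word_gens[OF t] by (intro weq_append weq_refl)
    then have eq: "mon (d q) (ghost_word w t @ path_word w q @ path_word w t)
      \<approx> mon (d q) (ghost_word w t @ path_word w (q @ t))" by (rule mon_weq)
    show "mon (d q) (ghost_word w t @ path_word w q @ path_word w t)
      \<approx> (if q = [] then mon (d q) [Vertex v] else 0)"
    proof (cases "q = []")
      case True
      have "weq (ghost_word w t @ path_word w t) [Vertex v]"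
        using ghost_word_path_word[OF t, of "[]" v] t awalk_last_in_verts[OF t]
        by (simp add: path_word_def awalk_simps)
      then show ?thesis using True eqv_trans[OF eq] mon_weq by simp
    next
      case False
      have "wnull (ghost_word w t @ path_word w (q @ t))"
        using null[OF q False] by (intro wnull_ghost_word_path_word[OF t walk]) auto
      then have "mon (d q) (ghost_word w t @ path_word w (q @ t)) \<approx> 0"
        by (simp add: eqv_0_iff mon_wnull)
      then show ?thesis using eqv_trans[OF eq] False by simp
    qed
  qed
  also have "(\<Sum>q\<in>B. if q = [] then mon (d q) [Vertex v] else 0) = mon (d []) [Vertex v]"
    using B(1,2) by (simp add: sum.delta')
  finally show ?thesis .
qed

lemma reduce_exit:
  assumes B: "finite B" "[] \<in> B" "\<And>q. q \<in> B \<Longrightarrow> awalk w q w"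
    and exit: "q0 \<in> B" "f \<in> set q0" "e \<in> arcs E" "tail E e = tail E f" "e \<noteq> f"
  shows "\<exists>t v. awalk w t v \<and>
    mon 1 (ghost_word w t) * (\<Sum>q\<in>B. mon (d q) (path_word w q)) * mon 1 (path_word w t)
    \<approx> mon (d []) [Vertex v]"
proof -
  obtain q1 q2 where q0: "q0 = q1 @ f # q2" using exit(2) split_list by metis
  \<comment> \<open>Strictly larger than the length of every \<open>q\<close> in \<open>B\<close>,
    as \<open>exit_breaks_periodicity\<close> requires.\<close>
  define n where "n = Suc (\<Sum>q\<in>B. length q)"
  define t where "t = list_pow n q0 @ q1 @ [e]"
  have "awalk w q1 (tail E f)" using B(3)[OF exit(1)] q0 by (auto simp: awalk_simps)
  then have t: "awalk w t (head E e)"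
    unfolding t_def using exit awalk_list_pow[OF B(3)[OF exit(1)], of n]
    by (auto simp: awalk_simps intro!: awalk_appendI)
  have "take (length t) (q @ t) \<noteq> t" if "q \<in> B" "q \<noteq> []" for q
  proof -
    have "length q < n" using member_le_sum[OF that(1), of length] B(1) by (simp add: n_def)
    then show ?thesis using exit_breaks_periodicity[OF q0 exit(5) that(2)] by (simp add: t_def)
  qed
  then show ?thesis using sandwich_closed_walks[OF B t] t by blast
qed

lemma right_local_unit:
  assumes "x \<in> ghost_deg d"
  shows "\<exists>S. finite S \<and> S \<subseteq> verts E \<and>
    (\<forall>S'. finite S' \<and> S \<subseteq> S' \<and> S' \<subseteq> verts E \<longrightarrow> x * (\<Sum>v\<in>S'. mon 1 [Vertex v]) \<approx> x)"
  using assms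
proof (induction rule: ghost_deg.induct)
  case (ideal x)
  have "x * (\<Sum>v\<in>S'. mon 1 [Vertex v]) \<approx> x" if "S' \<subseteq> verts E" for S'
    unfolding eqv_def using ideal that
    by (intro ideal_diff ideal_mult_right ualg_sum ualg_mon) auto
  then show ?case by (intro exI[of _ "{}"]) simp
next
  case (add u p w v q x r)
  from add.IH obtain S where S: "finite S" "S \<subseteq> verts E"
    and xS: "\<forall>S'. finite S' \<and> S \<subseteq> S' \<and> S' \<subseteq> verts E \<longrightarrow> x * (\<Sum>v\<in>S'. mon 1 [Vertex v]) \<approx> x"
    by (elim exE conjE) (rule that)
  let ?w = "path_word u p @ ghost_word v q"
  have v: "v \<in> verts E" using add(2) by auto
  have "(mon r ?w + x) * (\<Sum>v\<in>S'. mon 1 [Vertex v]) \<approx> mon r ?w + x"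
    if S': "finite S'" "insert v S \<subseteq> S'" "S' \<subseteq> verts E" for S'
  proof -
    have "mon r ?w * (\<Sum>v\<in>S'. mon 1 [Vertex v]) = (\<Sum>v\<in>S'. mon r (?w @ [Vertex v]))"
      by (simp add: sum_distrib_left mon_mult)
    also have "\<dots> \<approx> (\<Sum>v'\<in>S'. if v' = v then mon r ?w else 0)"
    proof (rule eqv_sum)
      fix v' assume v': "v' \<in> S'"
      show "mon r (?w @ [Vertex v']) \<approx> (if v' = v then mon r ?w else 0)"
      proof (cases "v' = v")
        case True
        have "weq (?w @ [Vertex v]) ?w"
          using weq_append[OF weq_refl[OF path_word_gens[OF add(1)]] ghost_word_vertex[OF add(2)]]
          by simp
        then show ?thesis using True by (simp add: mon_weq)
      next
        case False
        then have "wnull (path_word u p @ (ghost_word v q @ [Vertex v']))"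
          using path_word_gens[OF add(1)] v' S' add(2)
          by (intro wnull_append(1)[OF wnull_ghost_word_vertex]) auto
        then show ?thesis using False by (simp add: eqv_0_iff mon_wnull)
      qed
    qed
    also have "\<dots> = mon r ?w" using S' by simp
    finally show ?thesis using xS S' by (simp add: distrib_right eqv_add)
  qed
  then show ?case using S v
    by (intro exI[of _ "insert v S"] conjI allI impI) auto
qed

lemma exists_right_vertex:
  assumes "x \<in> ghost_deg d" "x \<notin> I"
  shows "\<exists>v\<in>verts E. x * mon 1 [Vertex v] \<notin> I"
proof (rule ccontr)
  assume *: "\<not> ?thesis"
  from right_local_unit[OF assms(1)] obtain S where S: "S \<subseteq> verts E"
    and xS: "x * (\<Sum>v\<in>S. mon 1 [Vertex v]) \<approx> x" by (elim exE conjE) (rule that, assumption, simp)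
  have "x * (\<Sum>v\<in>S. mon 1 [Vertex v]) \<in> I"
    using * S by (auto simp: sum_distrib_left intro!: ideal_sum)
  then show False using xS assms(2) eqv_ideal_iff by blast
qed

lemma free_alg_word:
  assumes "awalk u p v"
  shows "mon r (path_word u p) \<in> free_alg E" "mon r (ghost_word u p) \<in> free_alg E"
  by (rule free_alg_mon[OF _ path_word_gens[OF assms]] free_alg_mon[OF _ ghost_word_gens[OF assms]],
      simp add: path_word_def ghost_word_def)+

text \<open>\<open>0 \<in> K\<close> and \<open>d 0 \<noteq> 0\<close> record that the polynomial in
  the cycle is nonzero; \<open>d 0\<close> is the coefficient of the path that
  \<open>reduce_to_closed\<close> shrinks to a vertex. Both multipliers lie in the algebra itself,
  so that \<open>\<Phi>\<close> can be applied to them.\<close>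

theorem reduction:
  assumes x: "x \<in> free_alg E" "x \<notin> I"
  shows "\<exists>a\<in>free_alg E. \<exists>b\<in>free_alg E. \<exists>v\<in>verts E.
    (\<exists>r. r \<noteq> 0 \<and> a * x * b \<approx> mon r [Vertex v]) \<or>
    (\<exists>c K d. exitless_cycle E c \<and> awalk v c v \<and> finite K \<and> (0 :: nat) \<in> K \<and> d 0 \<noteq> 0 \<and>
      a * x * b \<approx> (\<Sum>k\<in>K. mon (d k) (path_word v (list_pow k c))))"
proof -
  obtain n where n: "x \<in> ghost_deg n" using free_alg_ghost_deg[OF x(1)] by blast
  obtain v1 where v1: "v1 \<in> verts E" "x * mon 1 [Vertex v1] \<notin> I"
    using exists_right_vertex[OF n x(2)] by blast
  obtain p1 w1 where p1: "awalk v1 p1 w1" "x * mon 1 (path_word v1 p1) \<in> ghost_deg 0"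
    "x * mon 1 (path_word v1 p1) \<notin> I"
    using reduce_to_real[OF n v1] by blast
  let ?b1 = "mon 1 (path_word v1 p1)"
  obtain c where c: "Poly_Mapping.keys c \<subseteq> paths E" "x * ?b1 \<approx> real_part c"
    using ghost_deg_0_real[OF p1(2)] by blast
  then have "real_part c \<notin> I" using p1(3) eqv_ideal_iff by blast
  from reduce_to_closed[OF c(1) this] obtain u p w B d where up: "awalk u p w" and B: "finite B" "[] \<in> B"
    and d: "d [] \<noteq> 0" and Bw: "\<forall>q\<in>B. awalk w q w"
    and eq: "mon 1 (ghost_word u p) * real_part c * mon 1 [Vertex w] \<approx> (\<Sum>q\<in>B. mon (d q) (path_word w q))"
    by (elim exE conjE) (rule that)
  let ?a1 = "mon 1 (ghost_word u p)" and ?z = "\<Sum>q\<in>B. mon (d q) (path_word w q)"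
  let ?b2 = "?b1 * mon 1 [Vertex w]"
  have w: "w \<in> verts E" using up by auto
  have a1: "?a1 \<in> free_alg E" using free_alg_word(2)[OF up] .
  have b2: "?b2 \<in> free_alg E"
    using free_alg_word(1)[OF p1(1)] w by (intro free_alg_mult free_alg_mon[of "[Vertex w]"]) auto
  have "?a1 * (x * ?b1) * mon 1 [Vertex w] \<approx> ?a1 * real_part c * mon 1 [Vertex w]"
    using c(2) a1 w by (intro eqv_mult_right eqv_mult_left) (auto intro: free_alg_ualg)
  then have z: "?a1 * x * ?b2 \<approx> ?z" using eqv_trans[OF _ eq] by (simp add: mult.assoc)
  show ?thesis
  proof (cases "\<exists>q0\<in>B. \<exists>f\<in>set q0. \<exists>e\<in>arcs E. tail E e = tail E f \<and> e \<noteq> f")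
    case True
    then obtain t v where t: "awalk w t v"
      "mon 1 (ghost_word w t) * ?z * mon 1 (path_word w t) \<approx> mon (d []) [Vertex v]"
      using reduce_exit[OF B] Bw by blast
    let ?a = "mon 1 (ghost_word w t) * ?a1" and ?b = "?b2 * mon 1 (path_word w t)"
    have "?a * x * ?b = mon 1 (ghost_word w t) * (?a1 * x * ?b2) * mon 1 (path_word w t)"
      by (simp only: mult.assoc)
    also have "\<dots> \<approx> mon 1 (ghost_word w t) * ?z * mon 1 (path_word w t)"
      using free_alg_word[OF t(1)] z by (intro eqv_mult_right eqv_mult_left free_alg_ualg)
    also note t(2)
    finally have "?a * x * ?b \<approx> mon (d []) [Vertex v]" .
    moreover have "?a \<in> free_alg E" "?b \<in> free_alg E"
      using free_alg_word[OF t(1)] a1 b2 by (auto intro: free_alg_mult)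
    moreover have "v \<in> verts E" using t(1) by auto
    ultimately show ?thesis using d by blast
  next
    case noexit: False
    show ?thesis
    \<comment> \<open>The trivial walk alone gives a multiple of the vertex \<open>w\<close>, so
      this case belongs to the first kind although there is no exit.\<close>
    proof (cases "B = {[]}")
      case True
      then have "?a1 * x * ?b2 \<approx> mon (d []) [Vertex w]" using z by (simp add: path_word_def)
      then show ?thesis using a1 b2 d w by blast
    next
      case False
      then obtain q0 where q0: "q0 \<in> B" "q0 \<noteq> []" using B by blast
      have "\<exists>c. exitless_cycle E c \<and> awalk w c w"
        using noexit q0 Bw by (intro exitless_cycle_exists[of w q0]) auto
      then obtain c where c: "exitless_cycle E c" "awalk w c w" by blast
      have "c \<noteq> []" using c by (auto simp: exitless_cycle_def cycle_def)
      then have inj: "inj (\<lambda>k. list_pow k c)" by (rule inj_list_pow)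
      \<comment> \<open>The exponents that occur. Powers of \<open>c\<close> are pairwise different,
        so \<open>K\<close> inherits finiteness from \<open>B\<close> and the sum can be
        reindexed.\<close>
      define K where "K = (\<lambda>k. list_pow k c) -` B"
      have "B \<subseteq> range (\<lambda>k. list_pow k c)" using closed_walk_power[OF c] Bw by blast
      then have KB: "(\<lambda>k. list_pow k c) ` K = B" by (auto simp: K_def)
      have "finite K" unfolding K_def using B(1) inj by (rule finite_vimageI)
      moreover have "0 \<in> K" using B(2) by (simp add: K_def)
      moreover have "?z = (\<Sum>k\<in>K. mon (d (list_pow k c)) (path_word w (list_pow k c)))"
        unfolding KB[symmetric] by (subst sum.reindex) (auto intro: inj_on_subset[OF inj])
      then have "?a1 * x * ?b2 \<approx> (\<Sum>k\<in>K. mon (d (list_pow k c)) (path_word w (list_pow k c)))"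
        using z by simp
      moreover have "d (list_pow 0 c) \<noteq> 0" using d by simp
      ultimately show ?thesis using a1 b2 w c
        by (intro bexI[of _ ?a1] bexI[of _ ?b2] bexI[of _ w] disjI2 exI[of _ c] exI[of _ K]
            exI[of _ "\<lambda>k. d (list_pow k c)"]) auto
    qed
  qed
qed

end

section \<open>Star-subalgebras generated by a unitary element\<close>

lemma rev_list_pow: "rev (list_pow k q) = list_pow k (rev q)"
proof (induction k)
  case (Suc k)
  have "rev (list_pow (Suc k) q) = list_pow k (rev q) @ rev q" using Suc by simp
  then show ?case by (simp only: list_pow_Suc_right)
qed simp

lemma map_list_pow: "map f (list_pow k q) = list_pow k (map f q)"
  by (induction k) simp_all

lemma lpa_eq: "lpa E = lpa_class E ` free_alg E"
  by (auto simp: lpa_def lpa_class_def quotient_def)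

lemma set_list_pow_subset: "set q \<subseteq> A \<Longrightarrow> set (list_pow k q) \<subseteq> A"
  by (induction k) auto

text \<open>\<open>e\<close>, \<open>a\<close>, \<open>b\<close> stand for \<open>\<alpha>\<alpha>\<^sup>*\<close>, \<open>\<omega>\<^sub>\<alpha>\<close> and \<open>\<omega>\<^sub>\<alpha>\<^sup>*\<close>.\<close>

locale unitary_word = leavitt E I for E :: "('v, 'e) pre_digraph"
    and I :: "('v, 'e, 'r::{comm_ring, comm_monoid_mult}) falg set" +
  fixes e a b :: "('v, 'e) lpa_gen list"
  assumes rels: "weq (e @ e) e" "weq (e @ a) a" "weq (a @ e) a" "weq (e @ b) b" "weq (b @ e) b"
    "weq (a @ b) e" "weq (b @ a) e"
    and nonempty: "e \<noteq> []" "a \<noteq> []" "b \<noteq> []"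
    and star: "rev (map gen_star a) = b" "rev (map gen_star e) = e"
begin

lemma gens: "set e \<subseteq> lpa_gens E" "set a \<subseteq> lpa_gens E" "set b \<subseteq> lpa_gens E"
  using rels(1,3,5) by (auto simp: weq_def)

text \<open>The \<open>n\<close>-th power of \<open>a\<close>, with powers of \<open>b\<close> for
  negative exponents; one of the two powers is always empty. The final \<open>e\<close> makes
  \<open>W 0\<close> the unit of the subalgebra instead of the empty word.\<close>

definition W :: "int \<Rightarrow> ('v, 'e) lpa_gen list" where
  "W n = list_pow (nat n) a @ list_pow (nat (- n)) b @ e"

lemma W_of_nat: "W (int k) = list_pow k a @ e" "W (- int k) = list_pow k b @ e"
  by (simp_all add: W_def)

lemma W_gens: "set (W n) \<subseteq> lpa_gens E"
  using gens by (auto simp: W_def)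

lemma W_nonempty: "W n \<noteq> []"
  using nonempty by (simp add: W_def)

lemma W_cases: obtains k where "n = int k" | k where "n = - int (Suc k)"
  by (metis int_cases)

lemma e_W: "weq (e @ W n) (W n)"
proof -
  have *: "weq (e @ (list_pow k q @ e)) (list_pow k q @ e)"
    if "weq (e @ q) q" "set q \<subseteq> lpa_gens E" for q k
  proof (cases k)
    case (Suc l)
    have "weq ((e @ q) @ (list_pow l q @ e)) (q @ (list_pow l q @ e))"
      using that gens(1) set_list_pow_subset[OF that(2)] by (intro weq_append[OF _ weq_refl]) auto
    then show ?thesis using Suc by simp
  qed (simp add: rels)
  show ?thesis
    by (cases n rule: W_cases) (use *[OF rels(2) gens(2)] *[OF rels(4) gens(3)] in \<open>simp_all only: W_of_nat\<close>)
qed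

lemma a_W: "weq (a @ W n) (W (n + 1))" and b_W: "weq (b @ W n) (W (n - 1))"
proof -
  have absorb: "weq (x @ (y @ W m)) (W m)" if "weq (x @ y) e" for x y m
  proof -
    have "weq ((x @ y) @ W m) (e @ W m)" using that W_gens by (intro weq_append weq_refl)
    also note e_W
    finally show ?thesis by simp
  qed
  show "weq (a @ W n) (W (n + 1))"
  proof (cases n rule: W_cases)
    case (1 k)
    then have "n + 1 = int (Suc k)" by simp
    then show ?thesis using W_gens[of "n + 1"] 1 by (simp only: W_of_nat) (simp add: weq_refl)
  next
    case (2 k)
    then have "n + 1 = - int k" by simp
    then show ?thesis using absorb[OF rels(6), of "- int k"] 2 by (simp only: W_of_nat) simp
  qed
  show "weq (b @ W n) (W (n - 1))"
  proof (cases "n > 0")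
    case True
    then obtain k where "n = int (Suc k)" "n - 1 = int k" by (metis zero_less_imp_eq_int int_ops(4)
          add_diff_cancel_right' Suc_pred of_nat_Suc)
    then show ?thesis using absorb[OF rels(7), of "int k"] by (simp only: W_of_nat) simp
  next
    case False
    then obtain k where "n = - int k" "n - 1 = - int (Suc k)"
      by (intro that[of "nat (- n)"]) auto
    then show ?thesis using W_gens[of "n - 1"] by (simp only: W_of_nat) (simp add: weq_refl)
  qed
qed

lemma W_mult: "weq (W m @ W n) (W (m + n))"
proof -
  have pa: "weq (list_pow k a @ W n) (W (int k + n))" for k n
  proof (induction k)
    case (Suc k)
    have "weq (a @ (list_pow k a @ W n)) (a @ W (int k + n))"
      using Suc gens by (intro weq_append weq_refl)
    also note a_W
    finally show ?case by (simp add: algebra_simps)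
  qed (simp add: weq_refl W_gens)
  have pb: "weq (list_pow k b @ W n) (W (n - int k))" for k n
  proof (induction k)
    case (Suc k)
    have "weq (b @ (list_pow k b @ W n)) (b @ W (n - int k))"
      using Suc gens by (intro weq_append weq_refl)
    also note b_W
    finally show ?case by (simp add: algebra_simps)
  qed (simp add: weq_refl W_gens)
  have ga: "set (list_pow (nat m) a) \<subseteq> lpa_gens E" "set (list_pow (nat (- m)) b) \<subseteq> lpa_gens E"
    using gens set_list_pow_subset by blast+
  have "weq (list_pow (nat m) a @ list_pow (nat (- m)) b @ (e @ W n))
      (list_pow (nat m) a @ list_pow (nat (- m)) b @ W n)"
    using e_W ga by (intro weq_append weq_refl)
  also have "weq (list_pow (nat m) a @ (list_pow (nat (- m)) b @ W n))
      (list_pow (nat m) a @ W (n - int (nat (- m))))"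
    using pb ga by (intro weq_append[OF weq_refl])
  also note pa
  also have "int (nat m) + (n - int (nat (- m))) = m + n" by simp
  finally show ?thesis by (simp add: W_def)
qed

text \<open>The involution moves the unit \<open>e\<close> to the front; modulo the relations it
  commutes with the powers of \<open>a\<close> and \<open>b\<close> and is moved back.\<close>

lemma W_star: "weq (rev (map gen_star (W n))) (W (- n))"
proof -
  have *: "weq (e @ list_pow k q) (list_pow k q @ e)"
    if "weq (e @ q) q" "weq (q @ e) q" "set q \<subseteq> lpa_gens E" for q k
  proof (cases k)
    case (Suc l)
    have g: "set (list_pow l q) \<subseteq> lpa_gens E" using that set_list_pow_subset by blast
    have "weq ((e @ q) @ list_pow l q) (q @ list_pow l q)"
      using that g by (intro weq_append[OF _ weq_refl])
    also have "q @ list_pow l q = list_pow l q @ q"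
      using list_pow_Suc_right[of l q] by simp
    also have "weq (list_pow l q @ q) (list_pow l q @ (q @ e))"
      using weq_sym[OF that(2)] g by (intro weq_append[OF weq_refl])
    finally show ?thesis using Suc list_pow_Suc_right[of l q] by simp
  qed (simp add: weq_refl gens)
  have b: "rev (map gen_star b) = a"
    by (simp add: star(1)[symmetric] rev_map comp_def)
  have pa: "weq (e @ list_pow k a) (list_pow k a @ e)" "weq (e @ list_pow k b) (list_pow k b @ e)" for k
    using * rels gens by blast+
  show ?thesis
  proof (cases n rule: W_cases)
    case (1 k)
    have "rev (map gen_star (W (int k))) = e @ list_pow k b"
      by (simp only: W_of_nat) (simp add: map_list_pow rev_list_pow star)
    then show ?thesis using 1 pa by (simp only: W_of_nat)
  next
    case (2 k)
    have "rev (map gen_star (W (- int (Suc k)))) = e @ list_pow (Suc k) a"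
      by (simp only: W_of_nat map_append rev_append map_list_pow rev_list_pow star b)
    then show ?thesis using 2 pa(1)[of "Suc k"] by (simp only: W_of_nat minus_minus)
  qed
qed

text \<open>Substitution of \<open>a\<close> for \<open>x\<close>, on representatives. It is linear
  on the nose, but multiplicative and compatible with the involutions only modulo
  \<open>I\<close>.\<close>

definition \<iota> :: "(int \<Rightarrow>\<^sub>0 'r) \<Rightarrow> ('v, 'e, 'r) falg" where
  "\<iota> = lin (\<lambda>n r. mon r (W n))"

lemma \<iota>_add: "\<iota> (f + g) = \<iota> f + \<iota> g"
  unfolding \<iota>_def by (rule lin_add) (simp add: single_add)

lemma \<iota>_single: "\<iota> (Poly_Mapping.single n r) = mon r (W n)"
  unfolding \<iota>_def by (rule lin_single) simp

lemma \<iota>_0 [simp]: "\<iota> 0 = 0"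
  by (simp add: \<iota>_def)

lemma \<iota>_free_alg: "\<iota> f \<in> free_alg E"
  unfolding \<iota>_def lin_def using W_gens W_nonempty by (intro free_alg_sum free_alg_mon)

lemma \<iota>_scale: "\<iota> (Poly_Mapping.map ((*) r) f) = Poly_Mapping.map ((*) r) (\<iota> f)"
  by (induction f rule: poly_mapping_single_induct)
    (simp_all add: \<iota>_add map_mult_add scale_single \<iota>_single)

lemma \<iota>_mult: "\<iota> f * \<iota> g \<approx> \<iota> (f * g)"
proof (induction f rule: poly_mapping_single_induct)
  case (add m r f)
  have "mon r (W m) * \<iota> g \<approx> \<iota> (Poly_Mapping.single m r * g)"
  proof (induction g rule: poly_mapping_single_induct)
    case (add n s g)
    have "mon (r * s) (W m @ W n) \<approx> mon (r * s) (W (m + n))" using W_mult by (rule mon_weq)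
    then have "mon r (W m) * mon s (W n)
        \<approx> \<iota> (Poly_Mapping.single m r * Poly_Mapping.single n s)"
      unfolding mon_mult by (simp add: mult_single \<iota>_single)
    with add show ?case by (simp add: distrib_left \<iota>_add \<iota>_single eqv_add)
  qed simp
  with add show ?case by (simp add: distrib_right \<iota>_add \<iota>_single eqv_add)
qed simp

lemma \<iota>_star: "falg_star (\<iota> f) \<approx> \<iota> (laurent_star f)"
proof (induction f rule: poly_mapping_single_induct)
  case zero
  have "laurent_star 0 = (0 :: int \<Rightarrow>\<^sub>0 'r)" by (rule poly_mapping_eqI) simp
  then show ?case by simp
next
  case (add n r f)
  have "mon r (rev (map gen_star (W n))) \<approx> mon r (W (- n))" using W_star by (rule mon_weq)
  with add show ?case
    by (simp add: falg_star_add laurent_star_add laurent_star_single \<iota>_add \<iota>_single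
        falg_star_single word_star_def eqv_add)
qed

abbreviation cls :: "('v, 'e, 'r) falg \<Rightarrow> ('v, 'e, 'r) falg set" where
  "cls \<equiv> lpa_class E"

lemma cls_eq: "\<lbrakk>x \<approx> y; x \<in> free_alg E; y \<in> free_alg E\<rbrakk> \<Longrightarrow> cls x = cls y"
  by (metis lpa_class_eq_iff eqv_def I_eq)

lemma cls_mon_eq: "\<lbrakk>weq s t; s \<noteq> []; t \<noteq> []\<rbrakk> \<Longrightarrow> cls (mon r s) = cls (mon r t)"
  by (intro cls_eq mon_weq free_alg_mon) (auto simp: weq_def)

lemma cls_\<iota>:
  "lpa_add E (cls (\<iota> f)) (cls (\<iota> g)) = cls (\<iota> (f + g))"
  "lpa_mult E (cls (\<iota> f)) (cls (\<iota> g)) = cls (\<iota> (f * g))"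
  "lpa_scale E r (cls (\<iota> f)) = cls (\<iota> (Poly_Mapping.map ((*) r) f))"
  "lpa_star E (cls (\<iota> f)) = cls (\<iota> (laurent_star f))"
  using \<iota>_free_alg wf_digraph
  by (simp_all add: lpa_add_class lpa_mult_class lpa_scale_class lpa_star_class \<iota>_add \<iota>_scale
      cls_eq[OF \<iota>_mult] cls_eq[OF \<iota>_star] free_alg_mult free_alg_star)

text \<open>Formulated without closure under the involution, because it is applied to the
  commutative core as well as to the star-subalgebra generated by \<open>a\<close>; therefore
  \<open>b\<close> is demanded separately.\<close>

lemma cls_\<iota>_in_subalgebra:
  assumes "lpa_zero E \<in> T" and ab: "cls (mon 1 a) \<in> T" "cls (mon 1 b) \<in> T"
    and add: "\<And>X Y. \<lbrakk>X \<in> T; Y \<in> T\<rbrakk> \<Longrightarrow> lpa_add E X Y \<in> T"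
    and mult: "\<And>X Y. \<lbrakk>X \<in> T; Y \<in> T\<rbrakk> \<Longrightarrow> lpa_mult E X Y \<in> T"
    and scale: "\<And>X r. X \<in> T \<Longrightarrow> lpa_scale E r X \<in> T"
  shows "cls (\<iota> f) \<in> T"
proof -
  have cls_append: "cls (mon 1 (s @ t)) = lpa_mult E (cls (mon 1 s)) (cls (mon 1 t))"
    if "set s \<subseteq> lpa_gens E" "set t \<subseteq> lpa_gens E" "s \<noteq> []" "t \<noteq> []" for s t
    using that by (simp add: lpa_mult_class free_alg_mon mon_mult)
  have "cls (mon 1 e) = lpa_mult E (cls (mon 1 a)) (cls (mon 1 b))"
    using cls_mon_eq[OF rels(6)] cls_append[of a b] nonempty gens by simp
  then have e: "cls (mon 1 e) \<in> T" using ab mult by simp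
  have *: "cls (mon 1 (list_pow k q @ e)) \<in> T"
    if "cls (mon 1 q) \<in> T" "set q \<subseteq> lpa_gens E" "q \<noteq> []" for k q
  proof (induction k)
    case (Suc k)
    then show ?case
      using cls_append[of q "list_pow k q @ e"] that gens set_list_pow_subset[OF that(2)] nonempty mult
      by simp
  qed (simp add: e)
  have W: "cls (mon 1 (W n)) \<in> T" for n
    by (cases n rule: W_cases)
      (use *[OF ab(1) gens(2) nonempty(2)] *[OF ab(2) gens(3) nonempty(3)]
        in \<open>simp_all only: W_of_nat\<close>)
  show ?thesis
  proof (induction f rule: poly_mapping_single_induct)
    case zero
    then show ?case using assms(1) by (simp add: lpa_zero_def)
  next
    case (add n r f)
    have "cls (\<iota> (Poly_Mapping.single n r)) = lpa_scale E r (cls (mon 1 (W n)))"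
      using cls_\<iota>(3)[of r "Poly_Mapping.single n 1"] by (simp add: \<iota>_single scale_single)
    then show ?case using W[of n] scale add assms(4) by (simp flip: cls_\<iota>(1))
  qed
qed

lemma star_subalg_eq: "lpa_star_subalg E {cls (mon 1 a)} = range (\<lambda>f. cls (\<iota> f))"
proof (intro equalityI subsetI)
  fix X assume "X \<in> lpa_star_subalg E {cls (mon 1 a)}"
  then show "X \<in> range (\<lambda>f. cls (\<iota> f))"
  proof (induction rule: lpa_star_subalg.induct)
    case (base X)
    have "W 1 = a @ e" by (simp add: W_def)
    then have "cls (mon 1 a) = cls (\<iota> (Poly_Mapping.single 1 1))"
      using cls_mon_eq[OF rels(3)] nonempty by (simp add: \<iota>_single)
    then show ?case using base by simp
  next
    case zero
    have "lpa_zero E = cls (\<iota> 0)" by (simp add: lpa_zero_def)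
    then show ?case by blast
  qed (auto simp: cls_\<iota>)
next
  fix X assume "X \<in> range (\<lambda>f. cls (\<iota> f))"
  then obtain f where X: "X = cls (\<iota> f)" by blast
  have "lpa_star E (cls (mon 1 a)) = cls (mon 1 b)"
    using gens nonempty wf_digraph
    by (simp add: lpa_star_class free_alg_mon falg_star_single word_star_def star)
  then have "cls (mon 1 b) \<in> lpa_star_subalg E {cls (mon 1 a)}"
    by (metis lpa_star_subalg.base lpa_star_subalg.star singletonI)
  then show "X \<in> lpa_star_subalg E {cls (mon 1 a)}"
    unfolding X by (intro cls_\<iota>_in_subalgebra) (auto intro: lpa_star_subalg.intros)
qed

end

section \<open>Cycles without exits yield unitary words\<close>

context leavitt
begin

text \<open>Each source on the path emits a single edge, so it is regular and its relation reads
  \<open>v = e e\<^sup>*\<close>; these relations collapse the word from the inside. For a cycle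
  this is the half of unitarity that rests on the absence of exits.\<close>

lemma path_ghost_no_exit:
  assumes "awalk w c v" and "\<And>e f. \<lbrakk>e \<in> arcs E; f \<in> set c; tail E e = tail E f\<rbrakk> \<Longrightarrow> e = f"
  shows "weq (path_word w c @ ghost_word w c) [Vertex w]"
  using assms
proof (induction c arbitrary: w)
  case Nil
  then have "w \<in> verts E" by auto
  then show ?case using weq_relators(1) by (simp add: path_word_def ghost_word_def)
next
  case (Cons e c)
  let ?h = "head E e"
  have e: "e \<in> arcs E" "tail E e = w" and walk: "awalk ?h c v"
    using Cons.prems(1) by (auto simp: awalk_simps)
  have "e' = e" if "e' \<in> arcs E" "tail E e' = w" for e'
    using that e by (intro Cons.prems(2)) auto
  then have out: "{e' \<in> arcs E. tail E e' = w} = {e}" using e by blast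
  have "w \<in> verts E" using e by auto
  with out have reg: "regular_vertex E w" by (simp add: regular_vertex_def)
  have "mon 1 [Vertex w] \<approx> mon 1 [Edge e, Ghost e]"
    using eqv_regular[OF reg] by (simp add: out)
  then have CK2: "weq [Edge e, Ghost e] [Vertex w]"
    using e by (auto simp: weq_def monom_of_def eqv_sym)
  have IH: "weq (path_word ?h c @ ghost_word ?h c) [Vertex ?h]"
    using Cons.IH[OF walk] Cons.prems(2) by simp
  have gens: "set (map Edge c) \<subseteq> lpa_gens E" "set (map Ghost (rev c)) \<subseteq> lpa_gens E"
    "w \<in> verts E" "?h \<in> verts E"
    using arcs_gens[OF walk] e walk by auto
  have "weq ([Vertex w, Edge e] @ map Edge c @ map Ghost (rev c) @ [Ghost e, Vertex w])
      ([Edge e, Vertex ?h] @ map Edge c @ map Ghost (rev c) @ [Vertex ?h, Ghost e])"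
  proof (intro weq_append weq_refl gens)
    show "weq [Vertex w, Edge e] [Edge e, Vertex ?h]"
      using weq_trans[OF weq_relators(2)[OF e(1)] weq_sym[OF weq_relators(3)[OF e(1)]]] e(2) by simp
    show "weq [Ghost e, Vertex w] [Vertex ?h, Ghost e]"
      using weq_trans[OF weq_relators(5)[OF e(1)] weq_sym[OF weq_relators(4)[OF e(1)]]] e(2) by simp
  qed
  also have "[Edge e, Vertex ?h] @ map Edge c @ map Ghost (rev c) @ [Vertex ?h, Ghost e]
      = [Edge e] @ (path_word ?h c @ ghost_word ?h c) @ [Ghost e]"
    by (simp add: path_word_def ghost_word_def)
  also have "weq \<dots> ([Edge e] @ [Vertex ?h] @ [Ghost e])"
    using e by (intro weq_append[OF weq_refl] weq_append[OF IH weq_refl]) auto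
  also have "weq ([Edge e] @ [Vertex ?h] @ [Ghost e]) ([Edge e] @ [Ghost e])"
    using e weq_relators(4)[of e] by (intro weq_append[OF weq_refl]) auto
  also have "weq ([Edge e] @ [Ghost e]) [Vertex w]" using CK2 by simp
  finally show ?case by (simp add: path_word_def ghost_word_def)
qed

lemma rev_star_path_word: "rev (map gen_star (path_word u p)) = ghost_word u p"
  "rev (map gen_star (ghost_word u p)) = path_word u p"
  by (auto simp: path_word_def ghost_word_def rev_map)

end

text \<open>Used for a distinguished path \<open>p\<close> with its cycle, and with
  \<open>p = []\<close> for the cycle that \<open>reduction\<close> provides.\<close>

locale tail_cycle = leavitt E I for E :: "('v, 'e) pre_digraph"
    and I :: "('v, 'e, 'r::{comm_ring, comm_monoid_mult}) falg set" +
  fixes u p w c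
  assumes p: "awalk u p w" and c: "exitless_cycle E c" "awalk w c w"
begin

abbreviation "e_word \<equiv> path_word u p @ ghost_word u p"
abbreviation "a_word \<equiv> path_word u p @ path_word w c @ ghost_word u p"
abbreviation "b_word \<equiv> path_word u p @ ghost_word w c @ ghost_word u p"

lemma base_in_verts: "w \<in> verts E"
  using p by auto

lemma ghost_path_vertex: "weq (ghost_word u p @ path_word u p) [Vertex w]"
  using ghost_word_path_word[OF p, of "[]" w] base_in_verts by (simp add: path_word_def awalk_simps)

text \<open>Since \<open>p\<^sup>* p = w\<close>, the words \<open>p s p\<^sup>*\<close> multiply as
  the \<open>s\<close> do at \<open>w\<close>; this carries the relations of the cycle over to
  \<open>a_word\<close> and \<open>b_word\<close>.\<close>

lemma middle_mult:
  assumes "weq (s @ [Vertex w] @ t) r"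
    and "set s \<subseteq> lpa_gens E" "set t \<subseteq> lpa_gens E"
  shows "weq ((path_word u p @ s @ ghost_word u p) @ (path_word u p @ t @ ghost_word u p))
    (path_word u p @ r @ ghost_word u p)"
proof -
  have "weq (path_word u p @ (s @ (ghost_word u p @ path_word u p) @ t) @ ghost_word u p)
    (path_word u p @ (s @ [Vertex w] @ t) @ ghost_word u p)"
    using ghost_path_vertex path_word_gens[OF p] ghost_word_gens[OF p] assms(2,3) by (intro weq_append weq_refl)
  also have "weq \<dots> (path_word u p @ r @ ghost_word u p)"
    using path_word_gens[OF p] ghost_word_gens[OF p] assms(1) by (intro weq_append[OF weq_refl] weq_append[OF _ weq_refl])
  finally show ?thesis by simp
qed

lemma c_words:
  "weq (path_word w c @ [Vertex w]) (path_word w c)"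
  "weq ([Vertex w] @ path_word w c) (path_word w c)"
  "weq (ghost_word w c @ [Vertex w]) (ghost_word w c)"
  "weq ([Vertex w] @ ghost_word w c) (ghost_word w c)"
  "weq (path_word w c @ ghost_word w c) [Vertex w]"
  "weq (ghost_word w c @ path_word w c) [Vertex w]"
proof -
  show "weq (path_word w c @ [Vertex w]) (path_word w c)" using path_word_vertex[OF c(2)] .
  show "weq ([Vertex w] @ path_word w c) (path_word w c)"
    using path_word_append[of w "[]" w c w] c(2) base_in_verts by (simp add: awalk_simps path_word_def)
  show "weq (ghost_word w c @ [Vertex w]) (ghost_word w c)" using ghost_word_vertex[OF c(2)] .
  show "weq ([Vertex w] @ ghost_word w c) (ghost_word w c)" using vertex_ghost_word[OF c(2)] by simp
  show "weq (path_word w c @ ghost_word w c) [Vertex w]"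
    using c by (intro path_ghost_no_exit) (auto simp: exitless_cycle_def)
  show "weq (ghost_word w c @ path_word w c) [Vertex w]"
    using ghost_word_path_word[OF c(2), of "[]" w] base_in_verts by (simp add: path_word_def awalk_simps)
qed

lemma e_word_vertex: "weq (path_word u p @ [Vertex w] @ ghost_word u p) e_word"
  using weq_append[OF weq_refl[OF path_word_gens[OF p]] vertex_ghost_word[OF p]] by simp

sublocale unitary_word E I e_word a_word b_word
proof
  note g = path_word_gens[OF c(2)] ghost_word_gens[OF c(2)]
  have left: "weq (e_word @ (path_word u p @ s @ ghost_word u p)) (path_word u p @ s @ ghost_word u p)"
    if "weq ([Vertex w] @ s) s" "set s \<subseteq> lpa_gens E" for s
    using middle_mult[of "[]" s s] that by simp
  have right: "weq ((path_word u p @ s @ ghost_word u p) @ e_word) (path_word u p @ s @ ghost_word u p)"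
    if "weq (s @ [Vertex w]) s" "set s \<subseteq> lpa_gens E" for s
    using middle_mult[of s "[]" s] that by simp
  have vv: "weq [Vertex w] [Vertex w]" using base_in_verts by (simp add: weq_refl)
  show "weq (e_word @ e_word) e_word"
    using weq_trans[OF middle_mult[of "[]" "[]" "[Vertex w]"] e_word_vertex] vv by simp
  show "weq (e_word @ a_word) a_word" by (rule left[OF c_words(2) g(1)])
  show "weq (a_word @ e_word) a_word" by (rule right[OF c_words(1) g(1)])
  show "weq (e_word @ b_word) b_word" by (rule left[OF c_words(4) g(2)])
  show "weq (b_word @ e_word) b_word" by (rule right[OF c_words(3) g(2)])
  have absorb: "weq (s @ [Vertex w] @ t) [Vertex w]"
    if "weq (s @ [Vertex w]) s" "weq (s @ t) [Vertex w]" "set t \<subseteq> lpa_gens E" for s t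
    using weq_trans[OF weq_append[OF that(1) weq_refl[OF that(3)]] that(2)] by simp
  show "weq (a_word @ b_word) e_word"
    by (rule weq_trans[OF middle_mult[OF absorb[OF c_words(1,5)]] e_word_vertex]) (fact g)+
  show "weq (b_word @ a_word) e_word"
    by (rule weq_trans[OF middle_mult[OF absorb[OF c_words(3,6)]] e_word_vertex]) (fact g)+
qed (simp_all add: rev_star_path_word, simp_all add: path_word_def)

lemma W_path: "weq (W (int k)) (path_word u p @ path_word w (list_pow k c) @ ghost_word u p)"
proof (induction k)
  case 0
  have "W (int 0) = e_word" by (simp only: W_of_nat) simp
  moreover have "path_word w (list_pow 0 c) = [Vertex w]" by (simp add: path_word_def)
  ultimately show ?case using weq_sym[OF e_word_vertex] by (simp only:)
next
  case (Suc k)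
  have walk: "awalk w (list_pow k c) w" using awalk_list_pow[OF c(2)] .
  have "weq (W (int (Suc k))) (a_word @ W (int k))"
    using weq_sym[OF a_W[of "int k"]] by (simp add: add.commute)
  also have "weq \<dots> (a_word @ (path_word u p @ path_word w (list_pow k c) @ ghost_word u p))"
    using Suc gens(2) by (intro weq_append[OF weq_refl])
  also have "weq \<dots> (path_word u p @ path_word w (list_pow (Suc k) c) @ ghost_word u p)"
  proof (rule middle_mult)
    have "weq ((path_word w c @ [Vertex w]) @ path_word w (list_pow k c))
        (path_word w c @ path_word w (list_pow k c))"
      using c_words(1) path_word_gens[OF walk] by (intro weq_append[OF _ weq_refl])
    also have "weq \<dots> (path_word w (list_pow (Suc k) c))" using path_word_append[OF c(2) walk] by simp
    finally show "weq (path_word w c @ [Vertex w] @ path_word w (list_pow k c))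
      (path_word w (list_pow (Suc k) c))" by simp
  qed (use path_word_gens[OF walk] path_word_gens[OF c(2)] in blast)+
  finally show ?case .
qed

lemma W_sandwich:
  "weq (ghost_word u p @ W (int k) @ path_word u p) (path_word w (list_pow k c))"
proof -
  have walk: "awalk w (list_pow k c) w" using awalk_list_pow[OF c(2)] .
  have g: "set (path_word u p) \<subseteq> lpa_gens E" "set (ghost_word u p) \<subseteq> lpa_gens E"
    using path_word_gens[OF p] ghost_word_gens[OF p] .
  have "weq (ghost_word u p @ W (int k) @ path_word u p)
      (ghost_word u p @ (path_word u p @ path_word w (list_pow k c) @ ghost_word u p) @ path_word u p)"
    using W_path g by (intro weq_append weq_refl)
  also have "\<dots> = (ghost_word u p @ path_word u p) @ path_word w (list_pow k c) @ (ghost_word u p @ path_word u p)"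
    by simp
  also have "weq \<dots> ([Vertex w] @ path_word w (list_pow k c) @ [Vertex w])"
    using ghost_path_vertex path_word_gens[OF walk] by (intro weq_append weq_refl)
  also have "weq ([Vertex w] @ (path_word w (list_pow k c) @ [Vertex w])) ([Vertex w] @ path_word w (list_pow k c))"
    using path_word_vertex[OF walk] base_in_verts by (intro weq_append[OF weq_refl]) auto
  also have "weq ([Vertex w] @ path_word w (list_pow k c)) (path_word w (list_pow k c))"
    using path_word_append[of w "[]" w, OF _ walk] base_in_verts by (simp add: awalk_simps path_word_def)
  finally show ?thesis .
qed

text \<open>Multiplying by a high power of \<open>a\<close> and compressing by \<open>p\<close>
  turns \<open>\<iota> f\<close> into a combination of the real paths \<open>c ^ (n + N)\<close>,
  which are pairwise different and hence independent.\<close>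

lemma \<iota>_injective:
  assumes "\<iota> f \<in> I"
  shows "f = 0"
proof -
  let ?K = "Poly_Mapping.keys f" and ?f = "Poly_Mapping.lookup f"
  \<comment> \<open>A crude bound: the sum of the absolute exponents makes every
    \<open>n + N\<close> nonnegative.\<close>
  define N where "N = (\<Sum>n\<in>?K. \<bar>n\<bar>)"
  have N: "n + N \<ge> 0" if "n \<in> ?K" for n
    using member_le_sum[of n ?K "\<lambda>n. \<bar>n\<bar>"] that by (auto simp: N_def)
  define g where "g n = list_pow (nat (n + N)) c" for n
  let ?a = "mon 1 (ghost_word u p)" and ?b = "mon 1 (W N @ path_word u p)"
  have eq: "?a * \<iota> f * ?b = (\<Sum>n\<in>?K. mon (?f n) (ghost_word u p @ (W n @ W N) @ path_word u p))"
    by (simp add: \<iota>_def lin_def sum_distrib_left sum_distrib_right mon_mult)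
  have "?a * \<iota> f * ?b \<approx> (\<Sum>n\<in>?K. mon (?f n) (path_word w (g n)))"
    unfolding eq
  proof (intro eqv_sum mon_weq)
    fix n assume n: "n \<in> ?K"
    have "weq (ghost_word u p @ (W n @ W N) @ path_word u p) (ghost_word u p @ W (n + N) @ path_word u p)"
      using W_mult path_word_gens[OF p] ghost_word_gens[OF p] by (intro weq_append weq_refl)
    also have "weq (ghost_word u p @ W (n + N) @ path_word u p) (path_word w (g n))"
      using W_sandwich[of "nat (n + N)"] N[OF n] by (simp add: g_def)
    finally show "weq (ghost_word u p @ (W n @ W N) @ path_word u p) (path_word w (g n))" .
  qed
  moreover have "?a * \<iota> f * ?b \<in> I"
    using path_word_gens[OF p] ghost_word_gens[OF p] W_gens[of N]
    by (intro ideal_mult_right[OF ideal_mult_left[OF _ assms]] ualg_mon) simp_all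
  ultimately have sum: "(\<Sum>n\<in>?K. mon (?f n) (path_word w (g n))) \<in> I" using eqv_ideal_iff by blast
  have inj: "inj_on (\<lambda>n. (w, g n)) ?K"
  proof (rule inj_onI)
    fix m n assume mn: "m \<in> ?K" "n \<in> ?K" "(w, g m) = (w, g n)"
    moreover have "c \<noteq> []" using c by (auto simp: exitless_cycle_def cycle_def)
    ultimately have "nat (m + N) = nat (n + N)"
      using inj_list_pow[of c] by (auto simp: g_def dest: injD)
    then show "m = n" using N mn by (simp add: nat_eq_iff2)
  qed
  have "?f n = 0" if n: "n \<in> ?K" for n
  proof -
    \<comment> \<open>\<open>paths_independent\<close> wants coefficients indexed by paths, so they
      are transported along the injection \<open>inj\<close>.\<close>
    let ?h = "\<lambda>\<alpha>. ?f (the_inv_into ?K (\<lambda>n. (w, g n)) \<alpha>)"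
    have h: "?h (w, g n) = ?f n" if "n \<in> ?K" for n
      using the_inv_into_f_f[OF inj that] by simp
    have "(\<Sum>\<alpha>\<in>(\<lambda>n. (w, g n)) ` ?K. mon (?h \<alpha>) (path_word (fst \<alpha>) (snd \<alpha>)))
        = (\<Sum>n\<in>?K. mon (?f n) (path_word w (g n)))"
      by (subst sum.reindex[OF inj]) (simp add: h)
    then have "?h (w, g n) = 0"
      using sum n awalk_list_pow[OF c(2)]
      by (intro paths_independent[of "(\<lambda>n. (w, g n)) ` ?K"]) (auto simp: g_def)
    then show ?thesis using h[OF n] by simp
  qed
  then show ?thesis by (auto simp: poly_mapping_eq_iff fun_eq_iff in_keys_iff)
qed

end

section \<open>The uniqueness theorem\<close>

context leavitt
begin

lemma lpa_class_mon_eq: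
  assumes "weq s t" "s \<noteq> []" "t \<noteq> []"
  shows "lpa_class E (mon r s) = (lpa_class E (mon r t) :: ('v, 'e, 'r) falg set)"
proof -
  have "mon r s \<in> free_alg E" "mon r t \<in> free_alg E"
    using assms by (auto simp: weq_def intro!: free_alg_mon)
  moreover have "mon r s - mon r t \<in> I" using mon_weq[OF assms(1)] by (simp add: eqv_def)
  ultimately show ?thesis by (simp add: lpa_class_eq_iff I_eq)
qed

lemma lpa_path_eq:
  assumes "awalk u p v"
  shows "lpa_path E (u, p) = (lpa_class E (mon 1 (path_word u p)) :: ('v, 'e, 'r) falg set)"
proof (cases p)
  case (Cons e q)
  then have e: "e \<in> arcs E" "tail E e = u" using assms by (auto simp: awalk_simps)
  have "weq ([Vertex u, Edge e] @ map Edge q) ([Edge e] @ map Edge q)"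
    using weq_relators(2)[OF e(1)] e arcs_gens[OF assms] Cons by (intro weq_append weq_refl) auto
  then have "weq (path_word u p) (map Edge p)" using Cons by (simp add: path_word_def)
  then show ?thesis
    using lpa_class_mon_eq[of "path_word u p" "map Edge p" 1] Cons
    by (simp add: lpa_path_def monom_of_def path_word_def)
qed (simp add: lpa_path_def path_word_def monom_of_def)

lemma lpa_ghost_path_eq:
  assumes "awalk u p v"
  shows "lpa_ghost_path E (u, p) = (lpa_class E (mon 1 (ghost_word u p)) :: ('v, 'e, 'r) falg set)"
proof (cases p)
  case (Cons e q)
  then have e: "e \<in> arcs E" "tail E e = u" using assms by (auto simp: awalk_simps)
  have "weq (map Ghost (rev q) @ [Ghost e, Vertex u]) (map Ghost (rev q) @ [Ghost e])"
    using weq_relators(5)[OF e(1)] e arcs_gens[OF assms] Cons by (intro weq_append weq_refl) auto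
  then have "weq (ghost_word u p) (map Ghost (rev p))" using Cons by (simp add: ghost_word_def)
  then show ?thesis
    using lpa_class_mon_eq[of "ghost_word u p" "map Ghost (rev p)" 1] Cons
    by (simp add: lpa_ghost_path_def monom_of_def ghost_word_def)
qed (simp add: lpa_ghost_path_def ghost_word_def monom_of_def)

lemma lpa_path_ghost_path_eq:
  assumes "awalk u p w" "awalk v q w"
  shows "lpa_mult E (lpa_path E (u, p)) (lpa_ghost_path E (v, q))
    = (lpa_class E (mon 1 (path_word u p @ ghost_word v q)) :: ('v, 'e, 'r) falg set)"
  using lpa_mult_class[OF free_alg_word(1)[OF assms(1)] free_alg_word(2)[OF assms(2)], of 1 1]
  by (simp add: lpa_path_eq[OF assms(1)] lpa_ghost_path_eq[OF assms(2)] mon_mult)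

lemma comm_core_closed:
  "lpa_zero E \<in> comm_core E"
  "\<lbrakk>X \<in> comm_core E; Y \<in> comm_core E\<rbrakk> \<Longrightarrow> lpa_add E X Y \<in> comm_core E"
  "\<lbrakk>X \<in> comm_core E; Y \<in> comm_core E\<rbrakk> \<Longrightarrow> lpa_mult E X Y \<in> comm_core E"
  "X \<in> comm_core E \<Longrightarrow> lpa_scale E s X \<in> comm_core E"
  unfolding comm_core_def by (auto intro: lpa_subalg.intros)

text \<open>\<open>v = v v\<^sup>*\<close> lies in \<open>lpa_G E\<close>, and it is self-adjoint,
  hence normal.\<close>

lemma vertex_in_comm_core:
  assumes "v \<in> verts E"
  shows "(lpa_path E (v, []) :: ('v, 'e, 'r) falg set) \<in> comm_core E"
proof -
  have walk: "awalk v [] v" using assms by (simp add: awalk_simps)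
  let ?X = "lpa_path E (v, []) :: ('v, 'e, 'r) falg set"
  have "lpa_mult E ?X (lpa_ghost_path E (v, [])) = ?X"
    using lpa_path_ghost_path_eq[OF walk walk] lpa_path_eq[OF walk]
      lpa_class_mon_eq[OF path_word_ghost_word_Nil[OF walk], of 1] by (simp add: path_word_def)
  moreover have "(v, []) \<in> paths E" using walk by (auto simp: paths_def)
  ultimately have "?X \<in> lpa_G E" unfolding lpa_G_def by (auto intro!: exI[of _ v] exI[of _ "[]"])
  moreover have "lpa_star E ?X = ?X"
    using assms wf_digraph by (simp add: lpa_path_def lpa_star_class free_alg_monom_of falg_star_monom_of)
  ultimately show ?thesis unfolding comm_core_def
    by (intro lpa_subalg.base) (simp add: lpa_normal_def)
qed

lemma comm_core_subset: "(comm_core E :: ('v, 'e, 'r) falg set set) \<subseteq> lpa E"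
proof
  fix X :: "('v, 'e, 'r) falg set" assume "X \<in> comm_core E"
  then show "X \<in> lpa E" unfolding comm_core_def
  proof (induction rule: lpa_subalg.induct)
    case (base X)
    then obtain \<mu> \<nu> where X: "\<mu> \<in> paths E" "\<nu> \<in> paths E" "path_range E \<mu> = path_range E \<nu>"
      "X = lpa_mult E (lpa_path E \<mu>) (lpa_ghost_path E \<nu>)" by (auto simp: lpa_G_def)
    then obtain u p v q w where "\<mu> = (u, p)" "\<nu> = (v, q)" "awalk u p w" "awalk v q w"
      by (auto simp: paths_def path_range_awalk)
    then have "X = lpa_class E (mon 1 (path_word u p @ ghost_word v q))"
      using X(4) lpa_path_ghost_path_eq by simp
    moreover have "mon 1 (path_word u p @ ghost_word v q) \<in> (free_alg E :: ('v, 'e, 'r) falg set)"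
      using \<open>awalk u p w\<close> \<open>awalk v q w\<close>
      by (intro free_alg_mon nf_word_gens) (simp_all add: path_word_def)
    ultimately show ?case by (simp add: lpa_eq)
  next
    case zero
    then show ?case by (auto simp: lpa_zero_def lpa_eq)
  qed (auto simp: lpa_eq lpa_add_class lpa_mult_class lpa_scale_class
      intro!: imageI free_alg_add free_alg_mult free_alg_scale)
qed

lemma distinguished_tail_cycle:
  assumes "distinguished E (u, p)"
  shows "tail_cycle E I u p (path_range E (u, p)) (lambda_cycle E (u, p))"
proof -
  have "exitless_cycle E (lambda_cycle E (u, p)) \<and>
      awalk (path_range E (u, p)) (lambda_cycle E (u, p)) (path_range E (u, p))"
    unfolding lambda_cycle_def by (rule theI'[OF ex1_lambda_cycle[OF assms wf_digraph]])
  moreover have "awalk u p (path_range E (u, p))"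
    using assms path_range_awalk by (auto simp: distinguished_def paths_def)
  ultimately show ?thesis by unfold_locales auto
qed

text \<open>A trivial path has no edges that could touch the cycle, and uniqueness of the exitless
  cycle at \<open>v\<close> identifies \<open>lambda_cycle\<close>. Thus (b) speaks about the cycle
  found by \<open>reduction\<close>.\<close>

lemma cycle_distinguished:
  assumes "exitless_cycle E c" "awalk v c v"
  shows "distinguished E (v, [])" "lambda_cycle E (v, []) = c" "path_range E (v, []) = v"
proof -
  have v: "v \<in> verts E" using assms by auto
  have c: "c \<noteq> []" using assms by (auto simp: exitless_cycle_def cycle_def)
  have range: "path_range E (v, []) = v" by (simp add: path_range_def)
  have "tail E (hd c) = v" using assms(2) c by (cases c) (auto simp: awalk_simps)
  then have "v \<in> tail E ` set c" using c by (metis hd_in_set imageI)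
  then show d: "distinguished E (v, [])"
    using assms v range by (auto simp: distinguished_def paths_def awalk_simps)
  show "lambda_cycle E (v, []) = c"
    unfolding lambda_cycle_def using assms range
    by (intro the1_equality[OF ex1_lambda_cycle[OF d wf_digraph]]) auto
  show "path_range E (v, []) = v" by fact
qed

end

context tail_cycle
begin

text \<open>Reading \<open>a\<close> as \<open>(p c) p\<^sup>*\<close> and \<open>b\<close> as
  \<open>p (p c)\<^sup>*\<close> gives them the shape required by \<open>lpa_G\<close>; the two star
  equations turn normality into commutation of \<open>a\<close> and \<open>b\<close>.\<close>

lemma a_b_classes:
  "cls (mon 1 a_word) = lpa_mult E (lpa_path E (u, p @ c)) (lpa_ghost_path E (u, p))"
  "lpa_star E (cls (mon 1 a_word)) = cls (mon 1 b_word)"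
  "lpa_star E (cls (mon 1 b_word)) = cls (mon 1 a_word)"
  "cls (mon 1 b_word) = lpa_mult E (lpa_path E (u, p)) (lpa_ghost_path E (u, p @ c))"
proof -
  have pc: "awalk u (p @ c) w" using p c(2) by auto
  have "weq ((path_word u p @ path_word w c) @ ghost_word u p) (path_word u (p @ c) @ ghost_word u p)"
    using path_word_append[OF p c(2)] ghost_word_gens[OF p] by (intro weq_append[OF _ weq_refl])
  then have "weq a_word (path_word u (p @ c) @ ghost_word u p)" by simp
  then have "cls (mon 1 a_word) = cls (mon 1 (path_word u (p @ c) @ ghost_word u p))"
    by (rule cls_mon_eq) (simp_all add: path_word_def)
  then show 1: "cls (mon 1 a_word) = lpa_mult E (lpa_path E (u, p @ c)) (lpa_ghost_path E (u, p))"
    by (simp only: lpa_path_ghost_path_eq[OF pc p])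
  have star_eq: "lpa_star E (cls (mon 1 s)) = cls (mon 1 (rev (map gen_star s)))"
    if "s \<noteq> []" "set s \<subseteq> lpa_gens E" for s
    using that wf_digraph by (simp add: lpa_star_class free_alg_mon falg_star_single word_star_def)
  show 2: "lpa_star E (cls (mon 1 a_word)) = cls (mon 1 b_word)"
    using star_eq[OF nonempty(2) gens(2)] by (simp only: star)
  have "rev (map gen_star b_word) = a_word" by (simp add: rev_star_path_word)
  then show "lpa_star E (cls (mon 1 b_word)) = cls (mon 1 a_word)"
    using star_eq[OF nonempty(3) gens(3)] by (simp only:)
  have "(u, p @ c) \<in> paths E" "(u, p) \<in> paths E" using pc p by (auto simp: paths_def)
  then show "cls (mon 1 b_word) = lpa_mult E (lpa_path E (u, p)) (lpa_ghost_path E (u, p @ c))"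
    using lpa_star_path_ghost_path[OF wf_digraph] 1 2 by metis
qed

text \<open>Normality is the relation \<open>a b = e = b a\<close>.\<close>

lemma a_b_in_comm_core: "cls (mon 1 a_word) \<in> comm_core E" "cls (mon 1 b_word) \<in> comm_core E"
proof -
  have pc: "awalk u (p @ c) w" using p c(2) by auto
  have "(u, p @ c) \<in> paths E" "(u, p) \<in> paths E" "path_range E (u, p @ c) = path_range E (u, p)"
    using pc p by (auto simp: paths_def path_range_awalk)
  then have G: "cls (mon 1 a_word) \<in> lpa_G E" "cls (mon 1 b_word) \<in> lpa_G E"
    unfolding lpa_G_def a_b_classes(1,4) by force+
  have "cls (mon 1 (a_word @ b_word)) = cls (mon 1 (b_word @ a_word))"
    using weq_trans[OF rels(6) weq_sym[OF rels(7)]] nonempty by (intro cls_mon_eq) simp_all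
  then have
    "lpa_mult E (cls (mon 1 a_word)) (cls (mon 1 b_word))
      = lpa_mult E (cls (mon 1 b_word)) (cls (mon 1 a_word))"
    by (simp only: lpa_mult_class[OF free_alg_mon[OF nonempty(2) gens(2)] free_alg_mon[OF nonempty(3) gens(3)]]
        lpa_mult_class[OF free_alg_mon[OF nonempty(3) gens(3)] free_alg_mon[OF nonempty(2) gens(2)]]
        mon_mult mult_1_left)
  then have "lpa_normal E (cls (mon 1 a_word))" "lpa_normal E (cls (mon 1 b_word))"
    unfolding lpa_normal_def a_b_classes(2,3) by simp_all
  with G show "cls (mon 1 a_word) \<in> comm_core E" "cls (mon 1 b_word) \<in> comm_core E"
    unfolding comm_core_def by (intro lpa_subalg.base; simp)+
qed

lemma cls_\<iota>_comm_core: "cls (\<iota> f) \<in> comm_core E"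
  by (rule cls_\<iota>_in_subalgebra[OF comm_core_closed(1) a_b_in_comm_core comm_core_closed(2-4)])

lemma omega_eq:
  assumes "lambda_cycle E (u, p) = c"
  shows "omega E (u, p) = cls (mon 1 a_word)"
  unfolding omega_def assms path_range_awalk[OF p]
  lpa_path_eq[OF p] lpa_path_eq[OF c(2)] lpa_ghost_path_eq[OF p]
    lpa_mult_class[OF free_alg_word(1)[OF p] free_alg_word(1)[OF c(2)]]
    lpa_mult_class[OF free_alg_mult[OF free_alg_word(1)[OF p] free_alg_word(1)[OF c(2)]]
      free_alg_word(2)[OF p]]
  by (simp add: mon_mult)

end

section \<open>The implications between the three conditions\<close>

locale leavitt_hom = leavitt E I for E :: "('v, 'e) pre_digraph"
    and I :: "('v, 'e, 'r::{comm_ring, comm_monoid_mult}) falg set" +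
  fixes \<Phi> :: "('v, 'e, 'r) falg set \<Rightarrow> 'a::ring"
  assumes hom: "lpa_ring_hom E \<Phi>"
begin

lemma hom_class:
  assumes "x \<in> free_alg E" "y \<in> free_alg E"
  shows "\<Phi> (lpa_class E (x + y)) = \<Phi> (lpa_class E x) + \<Phi> (lpa_class E y)"
    "\<Phi> (lpa_class E (x * y)) = \<Phi> (lpa_class E x) * \<Phi> (lpa_class E y)"
  using hom assms unfolding lpa_ring_hom_def lpa_eq
  by (auto simp: lpa_add_class lpa_mult_class)

lemma hom_zero: "\<Phi> (lpa_class E 0) = 0"
  using hom_class(1)[of 0 0] by simp

lemma hom_eqv: "\<lbrakk>x \<approx> y; x \<in> free_alg E; y \<in> free_alg E\<rbrakk> \<Longrightarrow> \<Phi> (lpa_class E x) = \<Phi> (lpa_class E y)"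
  by (metis lpa_class_eq_iff eqv_def I_eq)

lemma class_zero_iff: "x \<in> free_alg E \<Longrightarrow> lpa_class E x = lpa_class E 0 \<longleftrightarrow> x \<in> I"
  by (simp add: lpa_class_eq_iff I_eq)

lemma scaled_vertex_eq:
  "v \<in> verts E \<Longrightarrow> lpa_scale E r (lpa_path E (v, [])) = (lpa_class E (mon r [Vertex v]) :: ('v, 'e, 'r) falg set)"
  by (simp add: lpa_path_def lpa_scale_class free_alg_mon monom_of_def scale_single)

text \<open>The multiple \<open>r v\<close> lies in the core and is nonzero, because the trivial
  path is linearly independent by itself.\<close>

lemma core_inj_vertices:
  assumes inj: "inj_on \<Phi> (comm_core E)" and v: "v \<in> verts E" and "r \<noteq> 0"
  shows "\<Phi> (lpa_scale E r (lpa_path E (v, []))) \<noteq> 0"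
proof
  assume "\<Phi> (lpa_scale E r (lpa_path E (v, []))) = 0"
  then have "lpa_scale E r (lpa_path E (v, [])) = lpa_zero E"
    using vertex_in_comm_core[OF v] comm_core_closed(1,4) hom_zero
    by (intro inj_onD[OF inj]) (auto simp: lpa_zero_def)
  then have "mon r [Vertex v] \<in> I"
    using class_zero_iff[of "mon r [Vertex v]"] v
    by (simp add: scaled_vertex_eq lpa_zero_def free_alg_mon)
  then have "r = 0"
    using paths_independent[of "{(v, [])}" "\<lambda>_. r" "(v, [])"] v
    by (auto simp: awalk_simps path_word_def)
  with \<open>r \<noteq> 0\<close> show False by simp
qed

text \<open>The algebra generated by \<open>omega E \<alpha>\<close> lies in the core, so
  \<open>\<Phi>\<close> is injective on it and the operations on the image are well defined.
  Together with the injectivity of \<open>\<iota>\<close> this makes \<open>h\<close> invertible on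
  its range, and the inverse is the isomorphism.\<close>

lemma core_inj_distinguished:
  assumes inj: "inj_on \<Phi> (comm_core E)" and "distinguished E \<alpha>"
  shows "image_star_iso_laurent E \<Phi> (lpa_star_subalg E {omega E \<alpha>})"
proof -
  obtain u p where \<alpha>: "\<alpha> = (u, p)" by (cases \<alpha>)
  interpret tail_cycle E I u p "path_range E (u, p)" "lambda_cycle E (u, p)"
    using assms(2) \<alpha> distinguished_tail_cycle by blast
  let ?S = "lpa_star_subalg E {omega E \<alpha>}"
  have S: "?S = range (\<lambda>f. cls (\<iota> f))"
    using omega_eq[OF refl] star_subalg_eq by (simp add: \<alpha>)
  define h where "h f = \<Phi> (cls (\<iota> f))" for f
  have inj_S: "X = Y" if "X \<in> ?S" "Y \<in> ?S" "\<Phi> X = \<Phi> Y" for X Y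
    using that cls_\<iota>_comm_core by (intro inj_onD[OF inj]) (auto simp: S)
  have "inj h"
  proof (rule injI)
    fix f g assume "h f = h g"
    then have "cls (\<iota> f) = cls (\<iota> g)" using inj_S[of "cls (\<iota> f)" "cls (\<iota> g)"] by (simp add: S h_def)
    then have "\<iota> f - \<iota> g \<in> I" using \<iota>_free_alg by (simp add: lpa_class_eq_iff I_eq)
    also have "\<iota> f - \<iota> g = \<iota> (f - g)" using \<iota>_add[of "f - g" g] by simp
    finally show "f = g" using \<iota>_injective[of "f - g"] by simp
  qed
  have range_h: "\<Phi> ` ?S = range h" by (auto simp: S h_def)
  define \<theta> where "\<theta> = inv_into UNIV h"
  have \<theta>: "\<theta> (h f) = f" for f using \<open>inj h\<close> by (simp add: \<theta>_def)
  have "bij_betw \<theta> (\<Phi> ` ?S) UNIV"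
    unfolding range_h \<theta>_def using \<open>inj h\<close> by (intro bij_betw_inv_into) (simp add: bij_betw_def)
  moreover have "h f + h g = h (f + g)" "h f * h g = h (f * g)" for f g
    using hom_class[of "\<iota> f" "\<iota> g"] hom_eqv[OF \<iota>_mult] \<iota>_free_alg
    by (auto simp: h_def \<iota>_add free_alg_mult)
  then have "\<theta> (x + y) = \<theta> x + \<theta> y \<and> \<theta> (x * y) = \<theta> x * \<theta> y"
    if "x \<in> \<Phi> ` ?S" "y \<in> \<Phi> ` ?S" for x y
    using that by (auto simp: range_h \<theta>)
  moreover have "\<theta> (\<Phi> (lpa_scale E r X)) = Poly_Mapping.map ((*) r) (\<theta> (\<Phi> X))"
    "\<theta> (\<Phi> (lpa_star E X)) = laurent_star (\<theta> (\<Phi> X))" if "X \<in> ?S" for X r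
    using that \<theta> by (auto simp: S cls_\<iota> h_def)
  ultimately show ?thesis
    unfolding image_star_iso_laurent_def using inj_S by (intro conjI exI[of _ \<theta>]) metis+
qed

end

text \<open>\<open>\<theta>\<close> after \<open>h\<close> is an endomorphism to which
  \<open>laurent_star_endo_inj\<close> applies: it is surjective because \<open>range h\<close> is
  the whole domain of the bijection, and linear because \<open>\<theta>\<close> is linear for the
  action transported by \<open>\<Phi>\<close>.\<close>

lemma (in tail_cycle) hom_\<iota>_kernel:
  assumes "leavitt_hom E I \<Phi>"
    and iso: "image_star_iso_laurent E \<Phi> (range (\<lambda>f. cls (\<iota> f)))"
    and f: "\<Phi> (cls (\<iota> f)) = 0"
  shows "f = 0"
proof -
  interpret leavitt_hom E I \<Phi> by fact
  let ?S = "range (\<lambda>f. cls (\<iota> f))"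
  define h where "h f = \<Phi> (cls (\<iota> f))" for f
  have range_h: "\<Phi> ` ?S = range h" by (auto simp: h_def)
  from iso obtain \<theta> :: "_ \<Rightarrow> int \<Rightarrow>\<^sub>0 'r" where bij: "bij_betw \<theta> (range h) UNIV"
    and \<theta>: "\<forall>x\<in>range h. \<forall>y\<in>range h. \<theta> (x + y) = \<theta> x + \<theta> y \<and> \<theta> (x * y) = \<theta> x * \<theta> y"
    and scale: "\<forall>X\<in>?S. \<forall>r. \<theta> (\<Phi> (lpa_scale E r X)) = Poly_Mapping.map ((*) r) (\<theta> (\<Phi> X))"
    and star: "\<forall>X\<in>?S. \<theta> (\<Phi> (lpa_star E X)) = laurent_star (\<theta> (\<Phi> X))"
    unfolding image_star_iso_laurent_def range_h by (elim conjE exE) (rule that)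
  have h: "h (f + g) = h f + h g" "h (f * g) = h f * h g" for f g
    using hom_class[of "\<iota> f" "\<iota> g"] hom_eqv[OF \<iota>_mult] \<iota>_free_alg
    by (auto simp: h_def \<iota>_add free_alg_mult)
  show ?thesis
  proof (rule laurent_star_endo_inj[of "\<lambda>f. \<theta> (h f)"])
    show add: "\<theta> (h (f + g)) = \<theta> (h f) + \<theta> (h g)" "\<theta> (h (f * g)) = \<theta> (h f) * \<theta> (h g)" for f g
      using \<theta> by (simp_all add: h)
    show "\<theta> (h (Poly_Mapping.map ((*) r) f)) = Poly_Mapping.map ((*) r) (\<theta> (h f))" for r f
      using scale by (simp add: cls_\<iota> h_def)
    show "\<theta> (h (laurent_star f)) = laurent_star (\<theta> (h f))" for f
      using star by (simp add: cls_\<iota> h_def)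
    show "surj (\<lambda>f. \<theta> (h f))" using bij by (auto simp: bij_betw_def image_image)
    have "h 0 = 0" by (simp add: h_def hom_zero)
    then show "\<theta> (h f) = 0" using f add(1)[of 0 0] by (simp add: h_def)
  qed
qed

context leavitt_hom
begin

lemma injective:
  assumes verts: "\<And>v r. \<lbrakk>v \<in> verts E; r \<noteq> 0\<rbrakk> \<Longrightarrow> \<Phi> (lpa_scale E r (lpa_path E (v, []))) \<noteq> 0"
    and iso: "\<And>\<alpha>. distinguished E \<alpha> \<Longrightarrow>
      image_star_iso_laurent E \<Phi> (lpa_star_subalg E {omega E \<alpha>})"
  shows "inj_on \<Phi> (lpa E)"
proof -
  have kernel: "x \<in> I" if x: "x \<in> free_alg E" and \<Phi>x: "\<Phi> (lpa_class E x) = 0" for x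
  proof (rule ccontr)
    assume "x \<notin> I"
    from reduction[OF x this] obtain a b v where ab: "a \<in> free_alg E" "b \<in> free_alg E"
      and v: "v \<in> verts E"
      and cases: "(\<exists>r. r \<noteq> 0 \<and> a * x * b \<approx> mon r [Vertex v]) \<or>
        (\<exists>c K d. exitless_cycle E c \<and> awalk v c v \<and> finite K \<and> (0 :: nat) \<in> K \<and> d 0 \<noteq> 0 \<and>
          a * x * b \<approx> (\<Sum>k\<in>K. mon (d k) (path_word v (list_pow k c))))"
      by (elim bexE) (rule that)
    have "\<Phi> (lpa_class E (a * x * b)) = 0"
      using ab x \<Phi>x by (simp add: hom_class free_alg_mult)
    then have zero: "\<Phi> (lpa_class E y) = 0" if "a * x * b \<approx> y" "y \<in> free_alg E" for y
      using hom_eqv[OF that(1)] that(2) ab x by (simp add: free_alg_mult)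
    from cases show False
    proof (elim disjE exE conjE)
      fix r assume "r \<noteq> 0" "a * x * b \<approx> mon r [Vertex v]"
      then show False using zero[of "mon r [Vertex v]"] verts[OF v] v
        by (simp add: scaled_vertex_eq free_alg_mon)
    next
      fix c d and K :: "nat set"
      assume c: "exitless_cycle E c" "awalk v c v" and K: "finite K" "0 \<in> K" "d 0 \<noteq> 0"
        and eq: "a * x * b \<approx> (\<Sum>k\<in>K. mon (d k) (path_word v (list_pow k c)))"
      have "awalk v [] v" using v by (simp add: awalk_simps)
      then interpret tail_cycle E I v "[]" v c using c by unfold_locales
      \<comment> \<open>With \<open>p = []\<close> the word \<open>W (int k)\<close> is congruent to
        \<open>c ^ k\<close> between two copies of \<open>v\<close>, so the given polynomial in the
        cycle is \<open>\<iota> f\<close> modulo \<open>I\<close>.\<close>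
      define f where "f = (\<Sum>k\<in>K. Poly_Mapping.single (int k) (d k))"
      have "(\<Sum>k\<in>K. mon (d k) (path_word v (list_pow k c))) \<approx> (\<Sum>k\<in>K. mon (d k) (W (int k)))"
      proof (intro eqv_sum mon_weq, rule weq_sym)
        fix k
        have walk: "awalk v (list_pow k c) v" using awalk_list_pow[OF c(2)] .
        have "weq (W (int k)) ([Vertex v] @ path_word v (list_pow k c) @ [Vertex v])"
          using W_path[of k] by (simp add: path_word_def ghost_word_def)
        also have "weq ([Vertex v] @ (path_word v (list_pow k c) @ [Vertex v])) ([Vertex v] @ path_word v (list_pow k c))"
          using path_word_vertex[OF walk] v by (intro weq_append[OF weq_refl]) auto
        also have "weq ([Vertex v] @ path_word v (list_pow k c)) (path_word v (list_pow k c))"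
          using path_word_append[OF p walk] by (simp add: path_word_def)
        finally show "weq (W (int k)) (path_word v (list_pow k c))" .
      qed
      also have "(\<Sum>k\<in>K. mon (d k) (W (int k))) = \<iota> f"
        unfolding f_def \<iota>_def by (subst lin_sum) (simp_all add: lin_single single_add)
      finally have "\<Phi> (cls (\<iota> f)) = 0"
        using zero[of "\<iota> f"] eqv_trans[OF eq] \<iota>_free_alg by blast
      moreover have "image_star_iso_laurent E \<Phi> (range (\<lambda>f. cls (\<iota> f)))"
        using iso[of "(v, [])"] cycle_distinguished[OF c] omega_eq star_subalg_eq by simp
      ultimately have "f = 0" using hom_\<iota>_kernel leavitt_hom_axioms by blast
      moreover have "Poly_Mapping.lookup f 0 = d 0"
        using K by (simp add: f_def lookup_sum lookup_single when_def)
      ultimately show False using K(3) by simp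
    qed
  qed
  show ?thesis
  proof (rule inj_onI)
    fix X Y assume "X \<in> lpa E" "Y \<in> lpa E" and eq: "\<Phi> X = \<Phi> Y"
    then obtain x y where xy: "x \<in> free_alg E" "X = lpa_class E x" "y \<in> free_alg E" "Y = lpa_class E y"
      by (auto simp: lpa_eq)
    have "\<Phi> (lpa_class E (x - y + y)) = \<Phi> (lpa_class E (x - y)) + \<Phi> (lpa_class E y)"
      using xy by (intro hom_class free_alg_diff)
    then have "\<Phi> (lpa_class E (x - y)) = 0" using eq xy by simp
    then have "x - y \<in> I" using xy kernel free_alg_diff by blast
    then show "X = Y" using xy by (simp add: lpa_class_eq_iff I_eq)
  qed
qed

end

theorem theorem5p2:
  fixes E :: "('v, 'e) pre_digraph"
    and \<Phi> :: "('v, 'e, 'r::{comm_ring, comm_monoid_mult}) falg set \<Rightarrow> 'a::ring"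
  assumes "wf_digraph E" and "lpa_ring_hom E \<Phi>"
  shows "(inj_on \<Phi> (lpa E) \<longleftrightarrow> inj_on \<Phi> (comm_core E)) \<and>
    (inj_on \<Phi> (comm_core E) \<longleftrightarrow>
      (\<forall>v\<in>verts E. \<forall>r. r \<noteq> 0 \<longrightarrow> \<Phi> (lpa_scale E r (lpa_path E (v, []))) \<noteq> 0) \<and>
      (\<forall>\<alpha>. distinguished E \<alpha> \<longrightarrow>
        image_star_iso_laurent E \<Phi> (lpa_star_subalg E {omega E \<alpha>})))"
proof -
  interpret leavitt_hom E "lpa_ideal E" \<Phi>
    using assms by (simp add: leavitt_hom_def leavitt_def leavitt_axioms_def leavitt_hom_axioms_def)
  let ?a = "\<forall>v\<in>verts E. \<forall>r. r \<noteq> 0 \<longrightarrow> \<Phi> (lpa_scale E r (lpa_path E (v, []))) \<noteq> 0"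
  let ?b = "\<forall>\<alpha>. distinguished E \<alpha> \<longrightarrow>
    image_star_iso_laurent E \<Phi> (lpa_star_subalg E {omega E \<alpha>})"
  have "inj_on \<Phi> (comm_core E)" if "inj_on \<Phi> (lpa E)"
    using that comm_core_subset by (rule inj_on_subset)
  moreover have "?a \<and> ?b" if "inj_on \<Phi> (comm_core E)"
    using core_inj_vertices[OF that] core_inj_distinguished[OF that] by blast
  moreover have "inj_on \<Phi> (lpa E)" if "?a \<and> ?b"
    using that by (intro injective) blast+
  ultimately show ?thesis by blast
qed

end
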